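(* Let $h\in\{1,\tfrac32,2,\tfrac52,\dots\}$ and let $m\ge 1$ be an integer. Let $\eta_h(m)$ be the number of non-orientable precubic unicellular maps of type $h$ with $2m+\mathbb{1}_{h\in\mathbb{N}}$ edges, and let $\xi_h(m)$ be the number of orientable precubic unicellular maps of type (genus) $h$ with $2m+\mathbb{1}_{h\in\mathbb{N}}$ edges. Then $$(2h-1)\,\eta_h(m)=4\binom{\ell}{3}\eta_{h-1}(m)+3\binom{\ell}{3}\xi_{h-1}(m),\qquad \ell=m+4-3h-\tfrac12\mathbb{1}_{h\notin\mathbb{N}},$$ where $\xi_{h}(m)=0$ if $h\notin\mathbb{N}$ and, for $h\in\mathbb{N}$, $$\xi_h(m)=\frac{1}{(2h)!!}\binom{m+1}{3,3,\dots,3,\,m+1-3h}\mathrm{Cat}(m)=\frac{(2m)!}{12^h\,h!\,m!\,(m+1-3h)!}.$$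
   Context: A map is an embedding (without edge crossings) of a connected finite graph (loops and multiple edges allowed) into a compact connected surface such that each face (connected component of the complement) is simply connected, considered up to homeomorphism. Maps are rooted: a half-edge (root) and one of its sides are distinguished; the vertex of the root is the root vertex. A map is unicellular if it has exactly one face. The type $h\in\frac12\mathbb{N}$ of a map is defined by the Euler characteristic of its surface being $2-2h$ (orientable surface of genus $h$, or non-orientable surface with $2h$ cross-caps). A map is precubic if all its vertices have degree $1$ or $3$ and its root vertex has degree $1$. $\mathrm{Cat}(m)=\frac{1}{m+1}\binom{2m}{m}$; $n!!=n\cdot(n-2)!!$ for $n>1$, $0!!=1!!=1$; the multinomial coefficient has $h$ entries equal to $3$; $\binom{\ell}{3}=0$ if $\ell<3$. *)

theory Defs
  imports Complex_Main
begin

text \<open>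
  Maps on compact connected surfaces, considered up to homeomorphism and possibly non-orientable,
  in their standard combinatorial presentation by flags.

  A flag is a half-edge together with one of its two sides; equivalently, a triangle of the
  barycentric subdivision of the map, with corners at a vertex, an edge midpoint and a face centre.
  The function \<open>adj M i\<close> sends a flag to the neighbouring triangle that differs only in its
  vertex (\<open>i = 0\<close>), its edge (\<open>i = 1\<close>) or its face (\<open>i = 2\<close>).  Conversely,
  gluing triangles along these three involutions produces a closed surface in which the faces are
  open discs, and homeomorphisms of maps correspond to isomorphisms of flag systems.

  The root is a half-edge with a distinguished side, that is, a flag.
\<close>

record 'f rooted_map =
  flags :: "'f set"
  adj :: "nat \<Rightarrow> 'f \<Rightarrow> 'f"
  root :: 'f

definition orbit :: "'f rooted_map \<Rightarrow> nat set \<Rightarrow> 'f \<Rightarrow> 'f set" where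
  "orbit M I x = {(y, z). y \<in> flags M \<and> (\<exists>i\<in>I. z = adj M i y)}\<^sup>* `` {x}"

definition cells :: "'f rooted_map \<Rightarrow> nat set \<Rightarrow> 'f set set" where
  "cells M I = orbit M I ` flags M"

definition is_rooted_map :: "'f rooted_map \<Rightarrow> bool" where
  "is_rooted_map M \<longleftrightarrow>
     finite (flags M) \<and> root M \<in> flags M \<and>
     (\<forall>i\<in>{0, 1, 2}. \<forall>x\<in>flags M.
        adj M i x \<in> flags M \<and> adj M i x \<noteq> x \<and> adj M i (adj M i x) = x) \<and>
     (\<forall>x\<in>flags M. adj M 0 (adj M 2 x) = adj M 2 (adj M 0 x) \<and> adj M 0 (adj M 2 x) \<noteq> x) \<and>
     cells M {0, 1, 2} = {flags M}"

abbreviation vertices :: "'f rooted_map \<Rightarrow> 'f set set" where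
  "vertices M \<equiv> cells M {1, 2}"

abbreviation edges :: "'f rooted_map \<Rightarrow> 'f set set" where
  "edges M \<equiv> cells M {0, 2}"

abbreviation faces :: "'f rooted_map \<Rightarrow> 'f set set" where
  "faces M \<equiv> cells M {0, 1}"

abbreviation half_edges :: "'f rooted_map \<Rightarrow> 'f set set" where
  "half_edges M \<equiv> cells M {2}"

definition root_vertex :: "'f rooted_map \<Rightarrow> 'f set" where
  "root_vertex M = orbit M {1, 2} (root M)"

text \<open>Degrees count half-edges, so that a loop contributes twice.\<close>

definition degree :: "'f rooted_map \<Rightarrow> 'f set \<Rightarrow> nat" where
  "degree M v = card {e \<in> half_edges M. e \<subseteq> v}"

definition unicellular :: "'f rooted_map \<Rightarrow> bool" where
  "unicellular M \<longleftrightarrow> card (faces M) = 1"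

definition precubic :: "'f rooted_map \<Rightarrow> bool" where
  "precubic M \<longleftrightarrow> (\<forall>v\<in>vertices M. degree M v \<in> {1, 3}) \<and> degree M (root_vertex M) = 1"

definition euler_char :: "'f rooted_map \<Rightarrow> int" where
  "euler_char M = int (card (vertices M)) - int (card (edges M)) + int (card (faces M))"

definition has_type :: "'f rooted_map \<Rightarrow> rat \<Rightarrow> bool" where
  "has_type M h \<longleftrightarrow> of_int (euler_char M) = 2 - 2 * h"

text \<open>The surface is orientable iff its triangles can be oriented coherently: a flag gets
  \<open>True\<close> or \<open>False\<close> according to whether vertex, edge midpoint and face centre appear in
  positive or negative order, and coherence means that adjacent triangles get different signs.\<close>

definition orientable :: "'f rooted_map \<Rightarrow> bool" where
  "orientable M \<longleftrightarrow>
     (\<exists>s :: 'f \<Rightarrow> bool. \<forall>x\<in>flags M. \<forall>i\<in>{0, 1, 2}. s (adj M i x) \<noteq> s x)"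

definition map_isomorphic :: "'f rooted_map \<Rightarrow> 'g rooted_map \<Rightarrow> bool" where
  "map_isomorphic M N \<longleftrightarrow>
     (\<exists>\<phi>. bij_betw \<phi> (flags M) (flags N) \<and>
          (\<forall>x\<in>flags M. \<forall>i\<in>{0, 1, 2}. \<phi> (adj M i x) = adj N i (\<phi> x)) \<and>
          \<phi> (root M) = root N)"

text \<open>The number of isomorphism classes of rooted maps with a property.  Flags are taken from
  \<open>nat\<close>, which is no restriction since maps have finitely many flags.\<close>

definition count_maps :: "(nat rooted_map \<Rightarrow> bool) \<Rightarrow> nat" where
  "count_maps P =
     card ({M. is_rooted_map M \<and> P M} //
           {(M, N). is_rooted_map M \<and> is_rooted_map N \<and> map_isomorphic M N})"

definition num_edges :: "rat \<Rightarrow> nat \<Rightarrow> nat" where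
  "num_edges h m = 2 * m + (if h \<in> \<nat> then 1 else 0)"

definition eta :: "rat \<Rightarrow> nat \<Rightarrow> nat" where
  "eta h m = count_maps (\<lambda>M. unicellular M \<and> precubic M \<and> \<not> orientable M \<and>
                              has_type M h \<and> card (edges M) = num_edges h m)"

definition xi :: "rat \<Rightarrow> nat \<Rightarrow> nat" where
  "xi h m = count_maps (\<lambda>M. unicellular M \<and> precubic M \<and> orientable M \<and>
                             has_type M h \<and> card (edges M) = num_edges h m)"

text \<open>For half-integral \<open>h\<close> the argument of the floor is an integer, possibly negative.\<close>

definition ell :: "rat \<Rightarrow> nat \<Rightarrow> int" where
  "ell h m = \<lfloor>of_nat m + 4 - 3 * h - (if h \<in> \<nat> then 0 else 1 / 2)\<rfloor>"

lemma of_int_ell: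
  assumes "2 * h \<in> \<nat>"
  shows "of_int (ell h m) = of_nat m + 4 - 3 * h - (if h \<in> \<nat> then 0 else 1 / 2)"
proof -
  obtain k :: nat where k: "2 * h = of_nat k"
    using assms by (auto elim: Nats_cases)
  have "of_nat m + 4 - 3 * h - (if h \<in> \<nat> then 0 else 1 / 2) \<in> \<int>"
  proof (cases "even k")
    case True
    then obtain j where "k = 2 * j" by (elim evenE)
    with k have "h = of_nat j" by simp
    then show ?thesis by simp
  next
    case False
    then obtain j where "k = 2 * j + 1" by (elim oddE)
    with k have h: "h = of_nat j + 1 / 2" by (simp add: field_simps)
    have "h \<notin> \<nat>"
    proof
      assume "h \<in> \<nat>"
      then obtain n :: nat where "h = of_nat n" by (auto elim: Nats_cases)
      with k have "of_nat (2 * n) = (of_nat k :: rat)" by simp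
      then have "2 * n = k" by (simp only: of_nat_eq_iff)
      with False show False by auto
    qed
    then have "of_nat m + 4 - 3 * h - (if h \<in> \<nat> then 0 else 1 / 2) =
               (of_int (int m + 2 - 3 * int j) :: rat)"
      by (simp add: h)
    then show ?thesis by (metis Ints_of_int)
  qed
  then show ?thesis by (auto simp: ell_def elim: Ints_cases)
qed

text \<open>The convention that the coefficient vanishes for a top argument less than 3, also for a
  negative one.\<close>

definition choose3 :: "int \<Rightarrow> nat" where
  "choose3 l = (if l < 3 then 0 else nat l choose 3)"

fun double_fact :: "nat \<Rightarrow> nat" where
  "double_fact 0 = 1"
| "double_fact (Suc 0) = 1"
| "double_fact (Suc (Suc n)) = Suc (Suc n) * double_fact n"

definition Cat :: "nat \<Rightarrow> rat" where
  "Cat m = of_nat (2 * m choose m) / of_nat (m + 1)"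

text \<open>Multinomial coefficients; as usual they vanish if one of the lower entries is negative.\<close>

definition multinomial :: "nat \<Rightarrow> int list \<Rightarrow> rat" where
  "multinomial n ks =
     (if sum_list ks = int n \<and> (\<forall>k\<in>set ks. 0 \<le> k)
      then fact n / (\<Prod>k\<leftarrow>ks. fact (nat k)) else 0)"

end

theory Submission
  imports Defs "HOL-Computational_Algebra.Formal_Power_Series"
begin

section \<open>Unicellular maps as polygon gluings\<close>

text \<open>
  Walking around the unique face from the root numbers the flags, so a rooted unicellular map with
  \<open>N\<close> flags is the same thing as an involution \<open>a\<close> of \<open>{0,\<dots>,N-1}\<close> that glues the sides of a polygon.
  A vertex of degree three meets the walk at three corners, which cut the walk into blocks
  \<open>A B C D\<close>. In four of the eight possible configurations (the intertwined nodes) splitting the node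
  into three leaves only permutes and reverses the blocks and leaves a unicellular map; conversely
  three leaves can be glued in exactly these four ways, and one of them preserves orientability.

  It remains to count intertwined nodes. Comparing the two visits of every half-edge determines their
  number up to a defect \<open>S\<close> that comes from the edges which the walk traverses twice in the
  same direction. It vanishes for orientable maps, and for non-orientable maps \<open>S\<close> is 1 on average:
  these edges cut the walk into contents, each of which either turns at a single corner or contains
  further edges; exchanging the contents of the two ends at every such edge is an involution (up to
  reversal) that replaces \<open>S\<close> by \<open>2 - S\<close>. Iterating the orientable recurrence down to plane trees,
  which are counted by Catalan numbers, gives the closed form.
\<close>

text \<open>The eight configurations of a node are told apart by letting the walk cross each
  half-edge of the node by \<open>a\<close> instead of turning at its corners, which is what
  splitting into leaves does. In four of them the walk then leads from A through both B and C to D;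
  in the other four it reaches D after missing B or C or both, and the polygon would fall apart. The
  position of a flag on the new walk is the block permutation, so splitting is conjugation by it.
  Splitting adds three leaves and lowers the type by 1 while the number of edges stays fixed. With
  the defect \<open>S\<close> of the overview, a map of type \<open>h\<close> has
  \<open>2 h - S\<close> intertwined nodes; hence the factor \<open>2 h\<close> behind the double
  factorial and the factor \<open>2 h - 1\<close> of the non-orientable recurrence. The obstacle is
  that \<open>S\<close> varies among non-orientable maps, so the recurrence cannot be obtained map
  by map and only the mean of \<open>S\<close> is used. Three of the four ways of gluing always give
  a non-orientable map, which explains the coefficients 4 and 3.\<close>

lemma orbit_refl: "x \<in> orbit M I x"
  by (simp add: orbit_def)

lemma orbit_step: "y \<in> orbit M I x \<Longrightarrow> y \<in> flags M \<Longrightarrow> i \<in> I \<Longrightarrow> adj M i y \<in> orbit M I x"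
  unfolding orbit_def Image_def by (auto intro: rtrancl_into_rtrancl)

lemma orbit_induct [consumes 1, case_names refl step]:
  assumes "y \<in> orbit M I x" "P x"
    "\<And>y i. y \<in> flags M \<Longrightarrow> i \<in> I \<Longrightarrow> P y \<Longrightarrow> P (adj M i y)"
  shows "P y"
proof -
  have "(x, y) \<in> {(y, z). y \<in> flags M \<and> (\<exists>i\<in>I. z = adj M i y)}\<^sup>*"
    using assms(1) by (simp add: orbit_def)
  then show ?thesis by induction (use assms in auto)
qed

lemma orbit_least:
  assumes "x \<in> A" "\<And>y i. y \<in> A \<Longrightarrow> i \<in> I \<Longrightarrow> adj M i y \<in> A"
  shows "orbit M I x \<subseteq> A"
proof
  fix y assume "y \<in> orbit M I x"
  then show "y \<in> A" by (induction rule: orbit_induct) (use assms in auto)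
qed

lemma rooted_map_adj:
  assumes "is_rooted_map M" "x \<in> flags M" "i \<in> {0, 1, 2}"
  shows "adj M i x \<in> flags M" "adj M i x \<noteq> x" "adj M i (adj M i x) = x"
  using assms by (auto simp: is_rooted_map_def)

lemma orbit_subset_flags:
  assumes "is_rooted_map M" "x \<in> flags M" "I \<subseteq> {0, 1, 2}"
  shows "orbit M I x \<subseteq> flags M"
proof (rule orbit_least)
  fix y i assume "y \<in> flags M" "i \<in> I"
  then show "adj M i y \<in> flags M" using assms rooted_map_adj(1)[of M y i] by auto
qed (use assms in simp)

lemma orbit_trans:
  assumes "y \<in> orbit M I x" "z \<in> orbit M I y"
  shows "z \<in> orbit M I x"
  using assms unfolding orbit_def Image_def by (auto intro: rtrancl_trans)

lemma orbit_sym: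
  assumes "is_rooted_map M" "x \<in> flags M" "I \<subseteq> {0, 1, 2}" "y \<in> orbit M I x"
  shows "x \<in> orbit M I y"
proof -
  have "y \<in> flags M \<and> x \<in> orbit M I y"
    using assms(4)
  proof (induction rule: orbit_induct)
    case refl
    then show ?case using assms by (simp add: orbit_refl)
  next
    case (step y i)
    then have i: "i \<in> {0, 1, 2}" using assms by auto
    have "adj M i (adj M i y) \<in> orbit M I (adj M i y)"
      using step assms i by (intro orbit_step orbit_refl rooted_map_adj) auto
    then have "y \<in> orbit M I (adj M i y)"
      using step assms i by (simp add: rooted_map_adj)
    then show ?case
      using step assms i by (auto intro: orbit_trans rooted_map_adj)
  qed
  then show ?thesis ..
qed

lemma orbit_eq:
  assumes "is_rooted_map M" "x \<in> flags M" "I \<subseteq> {0, 1, 2}" "y \<in> orbit M I x"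
  shows "orbit M I y = orbit M I x"
  using assms orbit_sym[OF assms] by (auto intro: orbit_trans)

text \<open>The bijection stays explicit because later constructions need the isomorphism itself:
  the walk around the face is one, and it carries statements about positions to statements about
  flags.\<close>

definition iso_by :: "('f \<Rightarrow> 'g) \<Rightarrow> 'f rooted_map \<Rightarrow> 'g rooted_map \<Rightarrow> bool" where
  "iso_by \<phi> M N \<longleftrightarrow> bij_betw \<phi> (flags M) (flags N) \<and>
     (\<forall>x\<in>flags M. \<forall>i\<in>{0, 1, 2}. \<phi> (adj M i x) = adj N i (\<phi> x)) \<and> \<phi> (root M) = root N"

lemma map_isomorphic_iff: "map_isomorphic M N \<longleftrightarrow> (\<exists>\<phi>. iso_by \<phi> M N)"
  by (simp add: map_isomorphic_def iso_by_def)

lemma iso_by_refl: "iso_by id M M"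
  by (auto simp: iso_by_def)

lemma iso_by_trans:
  assumes "iso_by f M N" "iso_by g N K"
  shows "iso_by (g \<circ> f) M K"
proof -
  have "f x \<in> flags N" if "x \<in> flags M" for x
    using assms(1) that by (auto simp: iso_by_def bij_betw_def)
  then show ?thesis
    using assms bij_betw_trans by (fastforce simp: iso_by_def)
qed

lemma iso_by_sym:
  assumes "iso_by f M N" "is_rooted_map M"
  shows "iso_by (inv_into (flags M) f) N M"
proof -
  let ?g = "inv_into (flags M) f"
  have b: "bij_betw f (flags M) (flags N)" using assms by (simp add: iso_by_def)
  then have i: "inj_on f (flags M)" by (simp add: bij_betw_def)
  have "?g (adj N i y) = adj M i (?g y)" if y: "y \<in> flags N" and i': "i \<in> {0, 1, 2}" for y i
  proof -
    obtain x where x: "x \<in> flags M" "f x = y" using b y by (metis bij_betw_def imageE)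
    have "f (adj M i x) = adj N i y" using assms x i' by (auto simp: iso_by_def)
    then have "?g (adj N i y) = adj M i x"
      using assms x i i' by (metis inv_into_f_f rooted_map_adj(1))
    then show ?thesis using x i by (auto simp: inv_into_f_f)
  qed
  moreover have "?g (root N) = root M"
    using assms i by (metis iso_by_def inv_into_f_f is_rooted_map_def)
  ultimately show ?thesis using bij_betw_inv_into[OF b] by (simp add: iso_by_def)
qed

lemma map_isomorphic_sym: "map_isomorphic M N \<Longrightarrow> is_rooted_map M \<Longrightarrow> map_isomorphic N M"
  using iso_by_sym by (auto simp: map_isomorphic_iff)

lemma map_isomorphic_trans:
  "map_isomorphic M N \<Longrightarrow> map_isomorphic N K \<Longrightarrow> map_isomorphic M K"
  unfolding map_isomorphic_iff using iso_by_trans by metis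

lemma equiv_map_isomorphic:
  "equiv {M. is_rooted_map M} {(M, N). is_rooted_map M \<and> is_rooted_map N \<and> map_isomorphic M N}"
proof (rule equivI)
  show "refl_on {M. is_rooted_map M} {(M, N). is_rooted_map M \<and> is_rooted_map N \<and> map_isomorphic M N}"
    using iso_by_refl by (auto simp: refl_on_def map_isomorphic_iff)
  show "sym {(M, N). is_rooted_map M \<and> is_rooted_map N \<and> map_isomorphic M N}"
    using map_isomorphic_sym by (auto intro!: symI)
  show "trans {(M, N). is_rooted_map M \<and> is_rooted_map N \<and> map_isomorphic M N}"
    using map_isomorphic_trans by (auto intro!: transI)
qed auto

context
  fixes \<phi> :: "'f \<Rightarrow> 'g" and M N
  assumes iso: "iso_by \<phi> M N" and M: "is_rooted_map M"
begin

lemma iso_inj: "inj_on \<phi> (flags M)" and iso_image: "\<phi> ` flags M = flags N"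
  using iso by (auto simp: iso_by_def bij_betw_def)

lemma iso_adj: "x \<in> flags M \<Longrightarrow> i \<in> {0, 1, 2} \<Longrightarrow> adj N i (\<phi> x) = \<phi> (adj M i x)"
  using iso by (auto simp: iso_by_def)

lemma iso_root: "\<phi> (root M) = root N"
  using iso by (auto simp: iso_by_def)

lemma iso_orbit:
  assumes x: "x \<in> flags M" and I: "I \<subseteq> {0, 1, 2}"
  shows "orbit N I (\<phi> x) = \<phi> ` orbit M I x"
proof (intro equalityI)
  show "orbit N I (\<phi> x) \<subseteq> \<phi> ` orbit M I x"
  proof (rule orbit_least)
    show "\<phi> x \<in> \<phi> ` orbit M I x" by (simp add: orbit_refl)
  next
    fix y i assume "y \<in> \<phi> ` orbit M I x" "i \<in> I"
    then obtain z where z: "z \<in> orbit M I x" "y = \<phi> z" by auto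
    then have "z \<in> flags M" using orbit_subset_flags[OF M x I] by auto
    then show "adj N i y \<in> \<phi> ` orbit M I x"
      using z \<open>i \<in> I\<close> I iso_adj[of z i] by (auto intro: orbit_step)
  qed
next
  show "\<phi> ` orbit M I x \<subseteq> orbit N I (\<phi> x)"
  proof
    fix y assume "y \<in> \<phi> ` orbit M I x"
    then obtain z where z: "z \<in> orbit M I x" "y = \<phi> z" by auto
    from z(1) have "\<phi> z \<in> orbit N I (\<phi> x)"
    proof (induction rule: orbit_induct)
      case refl
      then show ?case by (rule orbit_refl)
    next
      case (step y i)
      then have "adj N i (\<phi> y) \<in> orbit N I (\<phi> x)"
        using iso_image by (intro orbit_step) auto
      then show ?case using step I iso_adj[of y i] by auto
    qed
    then show "y \<in> orbit N I (\<phi> x)" using z by simp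
  qed
qed

lemma iso_cells:
  assumes I: "I \<subseteq> {0, 1, 2}"
  shows "cells N I = image \<phi> ` cells M I"
  unfolding cells_def iso_image[symmetric] image_image
  using I by (intro image_cong refl iso_orbit) auto

lemma cells_subset:
  assumes I: "I \<subseteq> {0, 1, 2}" and "v \<in> cells M I"
  shows "v \<subseteq> flags M"
  using assms orbit_subset_flags[OF M] by (auto simp: cells_def)

lemma iso_card_cells:
  assumes I: "I \<subseteq> {0, 1, 2}"
  shows "card (cells N I) = card (cells M I)"
proof -
  have "inj_on (image \<phi>) (cells M I)"
    using iso_inj cells_subset[OF I] by (meson inj_on_image_eq_iff inj_onI)
  then show ?thesis by (simp add: iso_cells[OF I] card_image)
qed

lemma iso_degree:
  assumes "v \<subseteq> flags M"
  shows "degree N (\<phi> ` v) = degree M v"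
proof -
  have s: "e \<subseteq> flags M" if "e \<in> half_edges M" for e
    using cells_subset[of "{2}"] that by auto
  have "{e \<in> half_edges N. e \<subseteq> \<phi> ` v} = image \<phi> ` {e \<in> half_edges M. e \<subseteq> v}"
  proof -
    have "\<phi> ` e \<subseteq> \<phi> ` v \<longleftrightarrow> e \<subseteq> v" if "e \<in> half_edges M" for e
      using s[OF that] assms inj_on_image_mem_iff[OF iso_inj _ assms] by blast
    then show ?thesis by (auto simp: iso_cells)
  qed
  moreover have "inj_on (image \<phi>) {e \<in> half_edges M. e \<subseteq> v}"
    using iso_inj s by (metis (no_types, lifting) inj_on_image_eq_iff inj_onI mem_Collect_eq)
  ultimately show ?thesis by (simp add: degree_def card_image)
qed

lemma iso_unicellular: "unicellular N \<longleftrightarrow> unicellular M"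
  by (simp add: unicellular_def iso_card_cells)

lemma iso_precubic: "precubic N \<longleftrightarrow> precubic M"
proof -
  have "root_vertex N = \<phi> ` root_vertex M"
    using M by (simp add: root_vertex_def iso_root[symmetric] iso_orbit is_rooted_map_def)
  moreover have "root_vertex M \<subseteq> flags M"
    using M unfolding root_vertex_def by (intro orbit_subset_flags) (auto simp: is_rooted_map_def)
  ultimately have "degree N (root_vertex N) = degree M (root_vertex M)"
    by (simp add: iso_degree)
  then show ?thesis
    using cells_subset[of "{1, 2}"] by (simp add: precubic_def iso_cells iso_degree)
qed

lemma iso_has_type: "has_type N h \<longleftrightarrow> has_type M h"
  by (simp add: has_type_def euler_char_def iso_card_cells)

lemma iso_orientable: "orientable N \<longleftrightarrow> orientable M"
proof
  assume "orientable N"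
  then obtain s :: "'g \<Rightarrow> bool" where s: "\<forall>x\<in>flags N. \<forall>i\<in>{0, 1, 2}. s (adj N i x) \<noteq> s x"
    by (auto simp: orientable_def)
  have "s (\<phi> (adj M i x)) \<noteq> s (\<phi> x)" if "x \<in> flags M" "i \<in> {0, 1, 2}" for x i
    using s that iso_image iso_adj[OF that] by (metis image_eqI)
  then show "orientable M" unfolding orientable_def by (intro exI[of _ "s \<circ> \<phi>"]) (metis comp_apply)
next
  assume "orientable M"
  then obtain s :: "'f \<Rightarrow> bool" where s: "\<forall>x\<in>flags M. \<forall>i\<in>{0, 1, 2}. s (adj M i x) \<noteq> s x"
    by (auto simp: orientable_def)
  let ?g = "inv_into (flags M) \<phi>"
  have "s (?g (adj N i y)) \<noteq> s (?g y)" if y: "y \<in> flags N" and i: "i \<in> {0, 1, 2}" for y i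
  proof -
    obtain x where x: "x \<in> flags M" "y = \<phi> x" using y iso_image by auto
    have "adj M i x \<in> flags M" using rooted_map_adj(1)[OF M x(1) i] .
    then have "?g (adj N i y) = adj M i x" "?g y = x"
      using x(1) iso_inj by (simp_all add: x(2) iso_adj[OF x(1) i])
    then show ?thesis using s x(1) i by metis
  qed
  then show "orientable N" unfolding orientable_def by (intro exI[of _ "s \<circ> ?g"]) (metis comp_apply)
qed

end

text \<open>In the polygon, side \<open>i\<close> consists of the flags \<open>2 i\<close> and \<open>2 i + 1\<close>, exchanged by \<open>sd\<close>, and the
  corner after it of \<open>2 i + 1\<close> and \<open>2 i + 2\<close> (modulo \<open>N\<close>), exchanged by \<open>cn\<close>. The walk leaves
  corners through even flags and enters them through odd ones.\<close>

definition sd :: "nat \<Rightarrow> nat" where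
  "sd x = (if even x then Suc x else x - 1)"

definition cn :: "nat \<Rightarrow> nat \<Rightarrow> nat" where
  "cn N x = (if even x then (if x = 0 then N - 1 else x - 1) else (if Suc x = N then 0 else Suc x))"

text \<open>Fixing every argument from \<open>N\<close> on makes two gluings equal as functions once
  they agree on the polygon, so maps can be counted as functions. The condition on
  \<open>a x\<close> and \<open>sd x\<close> is the one on rooted maps that \<open>adj M 0\<close>
  after \<open>adj M 2\<close> has no fixed flag.\<close>

definition gluings :: "nat \<Rightarrow> (nat \<Rightarrow> nat) set" where
  "gluings N = {a. (\<forall>x<N. a x < N \<and> a x \<noteq> x \<and> a (a x) = x \<and> a (sd x) = sd (a x) \<and> a x \<noteq> sd x) \<and>
                   (\<forall>x\<ge>N. a x = x)}"

definition polygon_map :: "nat \<Rightarrow> (nat \<Rightarrow> nat) \<Rightarrow> nat rooted_map" where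
  "polygon_map N a = \<lparr>flags = {..<N}, adj = (\<lambda>i. if i = 0 then sd else if i = 1 then cn N else a), root = 0\<rparr>"

lemma polygon_map_simps [simp]:
  "flags (polygon_map N a) = {..<N}" "root (polygon_map N a) = 0"
  "adj (polygon_map N a) 0 = sd" "adj (polygon_map N a) (Suc 0) = cn N"
  "adj (polygon_map N a) 2 = a"
  by (simp_all add: polygon_map_def)

lemma sd_sd [simp]: "sd (sd x) = x"
  by (auto simp: sd_def)

lemma even_sd [simp]: "even (sd x) \<longleftrightarrow> odd x"
  by (auto simp: sd_def)

lemma sd_neq [simp]: "sd x \<noteq> x" "x \<noteq> sd x"
  by (auto simp: sd_def elim: oddE)

lemma sd_eq_iff [simp]: "sd x = sd y \<longleftrightarrow> x = y"
  by (metis sd_sd)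

lemma sd_less: "even N \<Longrightarrow> x < N \<Longrightarrow> sd x < N"
  by (auto simp: sd_def elim!: evenE)

lemma cn_less: "x < N \<Longrightarrow> cn N x < N"
  by (auto simp: cn_def)

lemma cn_cn: "even N \<Longrightarrow> x < N \<Longrightarrow> cn N (cn N x) = x"
  by (auto simp: cn_def elim!: oddE)

lemma even_cn: "even N \<Longrightarrow> x < N \<Longrightarrow> even (cn N x) \<longleftrightarrow> odd x"
  by (auto simp: cn_def)

lemma cn_neq: "even N \<Longrightarrow> x < N \<Longrightarrow> cn N x \<noteq> x"
  using even_cn by metis

lemma gluingsD:
  assumes "a \<in> gluings N" "x < N"
  shows "a x < N" "a x \<noteq> x" "a (a x) = x" "a (sd x) = sd (a x)" "a x \<noteq> sd x"
  using assms by (auto simp: gluings_def)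

lemma polygon_orbit_sides:
  assumes "even N" "0 < N"
  shows "orbit (polygon_map N a) {0, 1} 0 = {..<N}"
proof
  show "orbit (polygon_map N a) {0, 1} 0 \<subseteq> {..<N}"
    by (rule orbit_least) (use assms in \<open>auto simp: sd_less cn_less\<close>)
  have "x < N \<Longrightarrow> x \<in> orbit (polygon_map N a) {0, 1} 0" for x
  proof (induction x)
    case (Suc x)
    have "adj (polygon_map N a) (if even x then 0 else 1) x \<in> orbit (polygon_map N a) {0, 1} 0"
      using Suc by (intro orbit_step) auto
    then show ?case using Suc.prems by (auto simp: sd_def cn_def split: if_splits)
  qed (simp add: orbit_refl)
  then show "{..<N} \<subseteq> orbit (polygon_map N a) {0, 1} 0" by auto
qed

lemma orbit_mono: "I \<subseteq> J \<Longrightarrow> orbit M I x \<subseteq> orbit M J x"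
  unfolding orbit_def by (intro Image_mono rtrancl_mono) auto

text \<open>Stated for invertible moves rather than for rooted maps, since it has to establish
  connectedness, which is part of being a rooted map; it serves the single face as well.\<close>

lemma cells_singleton:
  assumes "\<And>x i. x \<in> flags M \<Longrightarrow> i \<in> {0, 1, 2} \<Longrightarrow> adj M i x \<in> flags M \<and> adj M i (adj M i x) = x"
    and "I \<subseteq> {0, 1, 2}" "r \<in> flags M" "flags M \<subseteq> orbit M I r"
  shows "cells M I = {flags M}"
proof -
  have "orbit M I x = flags M" if x: "x \<in> flags M" for x
  proof
    have *: "orbit M I y \<subseteq> flags M" if y: "y \<in> flags M" for y
    proof (rule orbit_least[OF y])
      fix z i assume "z \<in> flags M" "i \<in> I"
      then show "adj M i z \<in> flags M" using assms(1)[of z i] assms(2) by auto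
    qed
    show "orbit M I x \<subseteq> flags M" using * x .
    have "x \<in> orbit M I r" using assms x by auto
    then have "r \<in> orbit M I x"
    proof (induction rule: orbit_induct)
      case (step y i)
      then have i: "i \<in> {0, 1, 2}" using assms by auto
      have "adj M i (adj M i y) \<in> orbit M I (adj M i y)"
        using step assms(1)[of y i] i by (intro orbit_step orbit_refl) auto
      then show ?case using step assms(1)[of y i] i by (metis orbit_trans)
    qed (rule orbit_refl)
    then show "flags M \<subseteq> orbit M I x" using assms(4) orbit_trans by (meson subset_iff)
  qed
  then show ?thesis using assms(3) by (auto simp: cells_def)
qed

lemma polygon_map_adj:
  assumes "even N" "a \<in> gluings N" "x \<in> flags (polygon_map N a)" "i \<in> {0, 1, 2}"
  shows "adj (polygon_map N a) i x \<in> flags (polygon_map N a) \<and> adj (polygon_map N a) i x \<noteq> x \<and>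
    adj (polygon_map N a) i (adj (polygon_map N a) i x) = x"
  using assms gluingsD[of a N x] by (auto simp: sd_less cn_less cn_cn cn_neq)

lemma polygon_map_rooted:
  assumes "even N" "0 < N" "a \<in> gluings N"
  shows "is_rooted_map (polygon_map N a)"
proof -
  have "flags (polygon_map N a) \<subseteq> orbit (polygon_map N a) {0, 1, 2} 0"
    using polygon_orbit_sides[of N a] orbit_mono[of "{0,1}" "{0,1,2}" "polygon_map N a" 0] assms by auto
  then have "cells (polygon_map N a) {0, 1, 2} = {flags (polygon_map N a)}"
    using polygon_map_adj assms by (intro cells_singleton[where r = 0]) auto
  moreover have "\<forall>x<N. sd (a x) = a (sd x) \<and> sd (a x) \<noteq> x"
    using assms gluingsD by (metis sd_sd)
  ultimately show ?thesis
    unfolding is_rooted_map_def using polygon_map_adj assms by auto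
qed

lemma polygon_map_unicellular:
  assumes "even N" "0 < N" "a \<in> gluings N"
  shows "unicellular (polygon_map N a)"
proof -
  have "faces (polygon_map N a) = {flags (polygon_map N a)}"
    using assms polygon_map_adj polygon_orbit_sides[of N a]
    by (intro cells_singleton[where r = 0]) auto
  then show ?thesis by (simp add: unicellular_def)
qed

text \<open>An isomorphism is determined by the image of the root, since the walk around the face is.\<close>

lemma polygon_map_unique:
  assumes "even N" "a \<in> gluings N" "b \<in> gluings N"
    and "map_isomorphic (polygon_map N a) (polygon_map N b)"
  shows "a = b"
proof -
  obtain \<phi> where \<phi>: "iso_by \<phi> (polygon_map N a) (polygon_map N b)"
    using assms by (auto simp: map_isomorphic_iff)
  have adj: "\<phi> (adj (polygon_map N a) i x) = adj (polygon_map N b) i (\<phi> x)"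
    if "x < N" "i \<in> {0, 1, 2}" for i x
    using \<phi> that by (auto simp: iso_by_def)
  have id: "x < N \<Longrightarrow> \<phi> x = x" for x
  proof (induction x)
    case 0
    then show ?case using \<phi> by (simp add: iso_by_def)
  next
    case (Suc x)
    then show ?case
      using adj[of x 0] adj[of x 1] by (cases "even x") (auto simp: sd_def cn_def)
  qed
  have "a x = b x" if "x < N" for x
    using adj[OF that, of 2] id that gluingsD(1)[OF assms(2) that] by simp
  moreover have "a x = b x" if "\<not> x < N" for x
    using that assms by (auto simp: gluings_def)
  ultimately show ?thesis by blast
qed

section \<open>The walk around the face as a normal form\<close>

fun tour :: "'f rooted_map \<Rightarrow> nat \<Rightarrow> 'f" where
  "tour M 0 = root M"
| "tour M (Suc n) = adj M (if even n then 0 else 1) (tour M n)"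

context
  fixes M :: "'f rooted_map"
  assumes M: "is_rooted_map M" and uni: "unicellular M"
begin

lemma tour_flags: "tour M n \<in> flags M"
proof (induction n)
  case (Suc n)
  then show ?case using rooted_map_adj(1)[OF M Suc, of "if even n then 0 else 1"] by auto
qed (use M in \<open>simp add: is_rooted_map_def\<close>)

lemma tour_back: "adj M (if even n then 0 else 1) (tour M (Suc n)) = tour M n"
  using rooted_map_adj(3)[OF M tour_flags[of n], of "if even n then 0 else 1"] by auto

text \<open>Indices of equal parity are reached by the same kind of step, and each step is its own
  inverse, so a coincidence can be traced back.\<close>

lemma tour_shift_back: "tour M i = tour M j \<Longrightarrow> k \<le> i \<Longrightarrow> k \<le> j \<Longrightarrow> even (i + j) \<Longrightarrow> tour M (i - k) = tour M (j - k)"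
proof (induction k)
  case (Suc k)
  then have e: "tour M (i - k) = tour M (j - k)" by auto
  obtain i' j' where ij: "i - k = Suc i'" "j - k = Suc j'"
    using Suc.prems(2,3) that[of "i - Suc k" "j - Suc k"] by (simp add: Suc_diff_Suc Suc_le_eq)
  have "i = i' + Suc k" "j = j' + Suc k" using ij by linarith+
  then have ev: "even i' = even j'" using Suc.prems(4) by (simp add: even_add) blast
  have "tour M i' = adj M (if even i' then 0 else 1) (tour M (Suc i'))"
    by (rule tour_back[symmetric])
  also have "\<dots> = adj M (if even j' then 0 else 1) (tour M (Suc j'))"
    using e unfolding ij by (simp only: ev)
  also have "\<dots> = tour M j'" by (rule tour_back)
  finally have "tour M i' = tour M j'" .
  moreover have "i - Suc k = i'" "j - Suc k = j'" using ij by auto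
  ultimately show ?case by simp
qed simp

text \<open>At an odd distance the step leaving the earlier index and the step arriving at the later
  one are the same involution. Applying it moves both indices inward, until at distance 1 it would
  have a fixed point.\<close>

lemma tour_neq_odd: "tour M i \<noteq> tour M (i + (2 * k + 1))"
proof (induction k arbitrary: i)
  case 0
  show ?case
    using rooted_map_adj(2)[OF M tour_flags[of i], of "if even i then 0 else 1"] by auto
next
  case (Suc k)
  have b: "adj M (if even i then 0 else 1) (tour M (i + (2 * k + 3))) = tour M (i + (2 * k + 2))"
  proof -
    have e: "even (i + (2 * k + 2)) = even i" "i + (2 * k + 3) = Suc (i + (2 * k + 2))" by simp_all
    show ?thesis unfolding e(2) using tour_back[of "i + (2 * k + 2)"] unfolding e(1) .
  qed
  show ?case
  proof
    assume "tour M i = tour M (i + (2 * Suc k + 1))"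
    then have "tour M i = tour M (i + (2 * k + 3))" by (simp add: eval_nat_numeral)
    then have "tour M (Suc i) = tour M (i + (2 * k + 2))"
      using b by simp
    moreover have "i + (2 * k + 2) = Suc i + (2 * k + 1)" by simp
    ultimately show False using Suc.IH[of "Suc i"] by metis
  qed
qed

text \<open>The period is the first positive return to the root. It is even since coincidences at
  odd distance are impossible, minimality makes the walk injective below it, and the image is closed
  under both kinds of step. So the image is a face, and with one face it is everything.\<close>

lemma tour_bij:
  assumes N: "card (flags M) = N"
  shows "even N" "0 < N" "bij_betw (tour M) {..<N} (flags M)" "tour M N = root M"
proof -
  have fin: "finite (flags M)" using M by (simp add: is_rooted_map_def)
  \<comment> \<open>Pigeonhole: there is one index more than there are flags.\<close>
  have "\<not> inj_on (tour M) {..card (flags M)}"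
  proof
    assume "inj_on (tour M) {..card (flags M)}"
    then have "card {..card (flags M)} \<le> card (flags M)"
      using fin tour_flags by (intro card_inj_on_le[of "tour M"]) auto
    then show False by simp
  qed
  then obtain i j where "tour M i = tour M j" "i \<noteq> j" by (auto simp: inj_on_def)
  then obtain i j where ij: "tour M i = tour M j" "i < j" by (metis linorder_neqE_nat)
  have evij: "even (i + j)" if "tour M i = tour M j" "i < j" for i j
  proof (rule ccontr)
    assume "odd (i + j)"
    then have "odd (j - i)" using \<open>i < j\<close> by simp
    then obtain k where "j - i = 2 * k + 1" by (elim oddE)
    then have "j = i + (2 * k + 1)" using \<open>i < j\<close> by linarith
    then show False using tour_neq_odd[of i k] \<open>tour M i = tour M j\<close> by metis
  qed
  define P where "P d \<longleftrightarrow> 0 < d \<and> tour M d = root M" for d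
  have "P (j - i)" using tour_shift_back[OF ij(1), of i] ij evij by (auto simp: P_def)
  then obtain d where d: "P d" "\<And>d'. P d' \<Longrightarrow> d \<le> d'"
    by (metis LeastI Least_le)
  then have ed: "even d" using evij[of 0 d] by (auto simp: P_def)
  have inj: "inj_on (tour M) {..<d}"
  proof (rule ccontr)
    assume "\<not> inj_on (tour M) {..<d}"
    then obtain i j where "tour M i = tour M j" "i \<noteq> j" "i < d" "j < d" by (auto simp: inj_on_def)
    then obtain i j where ij: "tour M i = tour M j" "i < j" "j < d" by (metis linorder_neqE_nat)
    then have "P (j - i)" using tour_shift_back[OF ij(1), of i] evij by (auto simp: P_def)
    then show False using d(2)[of "j - i"] ij by auto
  qed
  have "orbit M {0, 1} (root M) \<subseteq> tour M ` {..<d}"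
  proof (rule orbit_least)
    show "root M \<in> tour M ` {..<d}" using d by (force simp: P_def)
  next
    fix y i assume "y \<in> tour M ` {..<d}" and i: "i \<in> {0, 1::nat}"
    then obtain k where k: "k < d" "y = tour M k" by auto
    \<comment> \<open>One of the two moves leads to the next index, the other one back to the
      previous index, both modulo \<open>d\<close>.\<close>
    show "adj M i y \<in> tour M ` {..<d}"
    proof (cases "i = (if even k then 0 else 1)")
      case True
      then have "adj M i y = tour M (Suc k)" using k by simp
      moreover have "tour M (Suc k) \<in> tour M ` {..<d}"
      proof (cases "Suc k = d")
        case True
        then have "tour M (Suc k) = tour M 0" using d(1) unfolding P_def tour.simps(1) by metis
        moreover have "0 \<in> {..<d}" using d(1) by (simp add: P_def)
        ultimately show ?thesis by (metis image_eqI)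
      next
        case False
        then have "Suc k \<in> {..<d}" using k by simp
        then show ?thesis by (rule imageI)
      qed
      ultimately show ?thesis by simp
    next
      case False
      then obtain k' where k': "k' < d" "tour M (Suc k') = y" "i = (if even k' then 0 else 1)"
      proof (cases k)
        case 0
        \<comment> \<open>The predecessor of index 0 is \<open>d - 1\<close>; it is odd, so the
          connecting step is a corner.\<close>
        have d0: "Suc (d - 1) = d" "tour M d = root M" using d by (auto simp: P_def)
        moreover have "odd (d - 1)" using ed d0 by presburger
        moreover have "i = 1" "y = root M" using False i k 0 by auto
        ultimately show ?thesis using that[of "d - 1"] by (metis lessI)
      next
        case (Suc k')
        
        then have "i = (if even k' then 0 else 1)" using False i by (auto split: if_splits)
        moreover have "k' < d" using k Suc by simp
        ultimately show ?thesis using that[of k'] k Suc by metis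
      qed
      then show ?thesis using tour_back[of k'] by (metis imageI lessThan_iff)
    qed
  qed
  moreover have "orbit M {0, 1} (root M) = flags M"
  proof -
    obtain F where F: "faces M = {F}" using uni by (auto simp: unicellular_def card_1_singleton_iff)
    have o: "orbit M {0, 1} x = F" if "x \<in> flags M" for x
    proof -
      have "orbit M {0, 1} x \<in> faces M" using that by (simp add: cells_def)
      then show ?thesis using F by simp
    qed
    have r: "root M \<in> flags M" using M by (simp add: is_rooted_map_def)
    have "flags M \<subseteq> F"
    proof
      fix x assume "x \<in> flags M"
      then show "x \<in> F" using o orbit_refl[of x M "{0, 1}"] by metis
    qed
    moreover have "F \<subseteq> flags M" using orbit_subset_flags[OF M r, of "{0,1}"] o[OF r] by auto
    ultimately show ?thesis using o[OF r] by auto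
  qed
  ultimately have img: "tour M ` {..<d} = flags M" using tour_flags by auto
  then have "d = N" using N card_image[OF inj] by simp
  then show "even N" "0 < N" "bij_betw (tour M) {..<N} (flags M)" "tour M N = root M"
    using ed d inj img by (auto simp: P_def bij_betw_def)
qed

lemma tour_sd: "tour M (sd k) = adj M 0 (tour M k)"
proof (cases "even k")
  case True
  then show ?thesis by (simp add: sd_def)
next
  case False
  then obtain n where "k = Suc n" "even n" by (cases k) auto
  then show ?thesis using tour_back[of n] by (simp add: sd_def)
qed

lemma tour_cn:
  assumes N: "card (flags M) = N" and k: "k < N"
  shows "tour M (cn N k) = adj M 1 (tour M k)"
proof (cases "even k")
  case True
  show ?thesis
  proof (cases k)
    case 0
    obtain n where n: "N = Suc n" "odd n" using tour_bij[OF N] by (cases N) auto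
    then show ?thesis using tour_back[of n] tour_bij(4)[OF N] 0 by (simp add: cn_def)
  next
    case (Suc n)
    then show ?thesis using True tour_back[of n] by (simp add: cn_def)
  qed
next
  case False
  then have "adj M 1 (tour M k) = tour M (Suc k)" by simp
  then show ?thesis using False tour_bij(4)[OF N] by (auto simp: cn_def)
qed

text \<open>The gluing is the third involution of the map, read through positions on the walk; by
  the construction of the walk the other two involutions turn into \<open>sd\<close> and
  \<open>cn N\<close>.\<close>

lemma normal_form_tour:
  assumes N: "card (flags M) = N"
  obtains a where "a \<in> gluings N" "iso_by (tour M) (polygon_map N a) M"
proof -
  define p where "p = inv_into {..<N} (tour M)"
  define a where "a x = (if x < N then p (adj M 2 (tour M x)) else x)" for x
  note b = tour_bij[OF N]
  have tp: "tour M (p y) = y" "p y < N" if "y \<in> flags M" for y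
    using b(3) that unfolding p_def bij_betw_def
    by (auto simp: f_inv_into_f) (metis inv_into_into lessThan_iff)
  have pt: "p (tour M x) = x" if "x < N" for x
    using b(3) that unfolding p_def bij_betw_def by (simp add: inv_into_f_f)
  have ta: "tour M (a x) = adj M 2 (tour M x)" if "x < N" for x
    using tp that rooted_map_adj(1)[OF M tour_flags, of 2] by (simp add: a_def)
  have M2: "adj M 0 (adj M 2 y) = adj M 2 (adj M 0 y)" "adj M 0 (adj M 2 y) \<noteq> y" if "y \<in> flags M" for y
    using M that by (auto simp: is_rooted_map_def)
  have inj: "x = y" if "tour M x = tour M y" "x < N" "y < N" for x y
    using pt that by metis
  have "a \<in> gluings N"
    unfolding gluings_def
  proof (intro CollectI conjI allI impI)
    fix x assume x: "x < N"
    note A = rooted_map_adj[OF M tour_flags, of 2]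
    show ax: "a x < N" using x tp A by (simp add: a_def)
    show "a x \<noteq> x" using ta[OF x] A(2)[of x] by force
    show "a (a x) = x" 
    proof -
      have "a (a x) = p (adj M 2 (tour M (a x)))" using ax a_def[of "a x"] by metis
      then show ?thesis using pt[OF x] A(3)[of x] by (simp add: ta[OF x])
    qed
    have sx: "sd x < N" using x b(1) by (simp add: sd_less)
    have "tour M (a (sd x)) = tour M (sd (a x))"
      using ta[OF sx] ta[OF x] M2(1)[OF tour_flags] by (simp add: tour_sd)
    moreover have "a (sd x) < N" using sx tp(2)[OF A(1)[of "sd x"]] by (simp add: a_def)
    ultimately show "a (sd x) = sd (a x)" using inj sd_less[OF b(1) ax] by blast
    show "a x \<noteq> sd x"
    proof
      assume "a x = sd x"
      then have "adj M 0 (adj M 2 (tour M x)) = tour M x"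
        using ta[OF x] tour_sd[of "sd x"] by simp
      then show False using M2(2)[OF tour_flags] by blast
    qed
  qed (simp add: a_def)
  moreover have "iso_by (tour M) (polygon_map N a) M"
    using b(3) ta tour_sd tour_cn[OF N] by (auto simp: iso_by_def)
  ultimately show ?thesis using that by blast
qed

end

text \<open>Each isomorphism class contains a polygon map by the normal form and only one by
  uniqueness. Invariance of \<open>P\<close> allows it to be tested on this representative.\<close>

lemma count_maps_eq_card_gluings:
  assumes N: "even N" "0 < N"
    and uni: "\<And>M. P M \<Longrightarrow> unicellular M"
    and cardP: "\<And>M. is_rooted_map M \<Longrightarrow> P M \<Longrightarrow> card (flags M) = N"
    and inv: "\<And>\<phi> M K. iso_by \<phi> M K \<Longrightarrow> is_rooted_map M \<Longrightarrow> P K \<longleftrightarrow> P M"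
  shows "count_maps P = card {a \<in> gluings N. P (polygon_map N a)}"
proof -
  define r :: "(nat rooted_map \<times> nat rooted_map) set"
    where "r = {(M, N). is_rooted_map M \<and> is_rooted_map N \<and> map_isomorphic M N}"
  have eq: "equiv {M. is_rooted_map M} r" unfolding r_def by (rule equiv_map_isomorphic)
  have "bij_betw (\<lambda>a. r `` {polygon_map N a}) {a \<in> gluings N. P (polygon_map N a)}
          ({M. is_rooted_map M \<and> P M} // r)"
  proof (rule bij_betw_imageI)
    show "inj_on (\<lambda>a. r `` {polygon_map N a}) {a \<in> gluings N. P (polygon_map N a)}"
    proof (rule inj_onI)
      fix a b assume *: "a \<in> {a \<in> gluings N. P (polygon_map N a)}" "b \<in> {a \<in> gluings N. P (polygon_map N a)}"
        "r `` {polygon_map N a} = r `` {polygon_map N b}"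
      then have "(polygon_map N a, polygon_map N b) \<in> r"
        using eq N by (intro eq_equiv_class[OF *(3) eq]) (auto simp: polygon_map_rooted)
      then show "a = b" using * N by (intro polygon_map_unique) (auto simp: r_def)
    qed
    show "(\<lambda>a. r `` {polygon_map N a}) ` {a \<in> gluings N. P (polygon_map N a)} = {M. is_rooted_map M \<and> P M} // r"
    proof (intro equalityI subsetI)
      fix X assume "X \<in> (\<lambda>a. r `` {polygon_map N a}) ` {a \<in> gluings N. P (polygon_map N a)}"
      then show "X \<in> {M. is_rooted_map M \<and> P M} // r"
        using N by (auto simp: polygon_map_rooted intro!: quotientI)
    next
      fix X assume "X \<in> {M. is_rooted_map M \<and> P M} // r"
      then obtain M where M: "is_rooted_map M" "P M" "X = r `` {M}" by (auto elim!: quotientE)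
      then obtain a where a: "a \<in> gluings N" "iso_by (tour M) (polygon_map N a) M"
        using normal_form_tour[OF M(1) uni[OF M(2)] cardP[OF M(1,2)]] by metis
      then have pm: "is_rooted_map (polygon_map N a)" using N by (simp add: polygon_map_rooted)
      have "(polygon_map N a, M) \<in> r" using a pm M by (auto simp: r_def map_isomorphic_iff)
      then have "X = r `` {polygon_map N a}" using M equiv_class_eq[OF eq] by metis
      moreover have "P (polygon_map N a)" using inv[OF a(2) pm] M by simp
      ultimately show "X \<in> (\<lambda>a. r `` {polygon_map N a}) ` {a \<in> gluings N. P (polygon_map N a)}"
        using a by auto
    qed
  qed
  then show ?thesis
    unfolding count_maps_def r_def[symmetric] by (simp add: bij_betw_same_card)
qed

section \<open>Precubic gluings and their nodes\<close>

lemma sum_card_cells: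
  assumes M: "is_rooted_map M" and I: "I \<subseteq> {0, 1, 2}"
  shows "(\<Sum>v\<in>cells M I. card v) = card (flags M)"
proof -
  have fin: "finite (flags M)" using M by (simp add: is_rooted_map_def)
  have sub: "v \<subseteq> flags M" if "v \<in> cells M I" for v
    using that orbit_subset_flags[OF M _ I] by (auto simp: cells_def)
  have disj: "u \<inter> v = {}" if "u \<in> cells M I" "v \<in> cells M I" "u \<noteq> v" for u v
  proof (rule ccontr)
    assume "u \<inter> v \<noteq> {}"
    then obtain z where z: "z \<in> u" "z \<in> v" by auto
    from that obtain x y where "x \<in> flags M" "u = orbit M I x" "y \<in> flags M" "v = orbit M I y"
      unfolding cells_def by blast
    then show False using orbit_eq[OF M _ I] z that(3) by metis
  qed
  have "\<Union>(cells M I) = flags M"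
    using sub orbit_refl by (fastforce simp: cells_def)
  moreover have "card (\<Union>(cells M I)) = (\<Sum>v\<in>cells M I. card v)"
    using disj finite_subset[OF sub fin]
    by (intro card_Union_disjoint) (auto simp: pairwise_def disjnt_def)
  ultimately show ?thesis by simp
qed

text \<open>An edge is an orbit of two commuting involutions which, like their product, have no
  fixed flag; such an orbit has four elements.\<close>

lemma card_flags_eq_edges:
  assumes M: "is_rooted_map M"
  shows "card (flags M) = 4 * card (edges M)"
proof -
  have "card v = 4" if "v \<in> edges M" for v
  proof -
    from that obtain x where x: "x \<in> flags M" "v = orbit M {0, 2} x"
      unfolding cells_def by blast
    let ?s = "adj M 0" and ?a = "adj M 2"
    have sx: "?s y \<in> flags M" "?s (?s y) = y" "?s y \<noteq> y"
      and ax: "?a y \<in> flags M" "?a (?a y) = y" "?a y \<noteq> y"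
      and sa: "?s (?a y) = ?a (?s y)" "?s (?a y) \<noteq> y" if "y \<in> flags M" for y
      using M that by (auto simp: is_rooted_map_def)
    have "v = {x, ?s x, ?a x, ?s (?a x)}"
    proof
      show "v \<subseteq> {x, ?s x, ?a x, ?s (?a x)}"
        unfolding x(2) by (rule orbit_least) (use sx ax sa x in auto)
      have "?s x \<in> v" "?a x \<in> v" unfolding x(2) by (auto intro!: orbit_step orbit_refl x)
      moreover from this have "?s (?a x) \<in> v" unfolding x(2) by (intro orbit_step) (auto simp: ax x orbit_refl)
      moreover have "x \<in> v" unfolding x(2) by (rule orbit_refl)
      ultimately show "{x, ?s x, ?a x, ?s (?a x)} \<subseteq> v" by simp
    qed
    moreover have "distinct [x, ?s x, ?a x, ?s (?a x)]"
      using sx ax sa x by simp metis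
    then have "card (set [x, ?s x, ?a x, ?s (?a x)]) = 4" by (subst distinct_card) simp_all
    ultimately show ?thesis by simp
  qed
  then show ?thesis using sum_card_cells[OF M, of "{0, 2}"] by simp
qed

text \<open>Turning around a vertex is \<open>cn N\<close> after \<open>a\<close>. Requiring its
  third power to be the identity allows exactly the divisors 1 and 3 of 3 as degrees. Since
  \<open>N - 1\<close> is \<open>cn N 0\<close>, the value at 0 makes the root vertex a
  leaf.\<close>

definition cubic_gluings :: "nat \<Rightarrow> (nat \<Rightarrow> nat) set" where
  "cubic_gluings N = {a \<in> gluings N. a 0 = N - 1 \<and>
     (\<forall>x<N. cn N (a (cn N (a (cn N (a x))))) = x)}"

text \<open>A leaf has one even and one odd flag; recording the even one counts each leaf once. The
  root leaf is recorded as 0.\<close>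

definition leaves :: "nat \<Rightarrow> (nat \<Rightarrow> nat) \<Rightarrow> nat set" where
  "leaves N a = {x. x < N \<and> even x \<and> a x = cn N x}"

definition parity_changing :: "nat \<Rightarrow> (nat \<Rightarrow> nat) \<Rightarrow> bool" where
  "parity_changing N a \<longleftrightarrow> (\<forall>x<N. even (a x) \<longleftrightarrow> odd x)"

context
  fixes N a
  assumes N: "even N" "0 < N" and a: "a \<in> gluings N"
begin

text \<open>Coherent signs alternate along the walk, so they are the parity of the flags up to a
  global change, and only compatibility with the gluing remains.\<close>

lemma polygon_orientable: "orientable (polygon_map N a) \<longleftrightarrow> parity_changing N a"
proof
  assume "parity_changing N a"
  then show "orientable (polygon_map N a)"
    unfolding orientable_def parity_changing_def
    by (intro exI[of _ even]) (auto simp: even_cn[OF N(1)])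
next
  assume "orientable (polygon_map N a)"
  then obtain s :: "nat \<Rightarrow> bool" where
    s': "\<forall>x\<in>flags (polygon_map N a). \<forall>i\<in>{0, 1, 2}. s (adj (polygon_map N a) i x) \<noteq> s x"
    unfolding orientable_def by blast
  have s: "s (sd x) \<noteq> s x" "s (cn N x) \<noteq> s x" "s (a x) \<noteq> s x" if "x < N" for x
    using s' that by auto
  have "x < N \<Longrightarrow> s x = (s 0 = even x)" for x
  proof (induction x)
    case (Suc x)
    then show ?case using s(1,2)[of x] by (cases "even x") (auto simp: sd_def cn_def)
  qed simp
  then show "parity_changing N a"
    using s(3) gluingsD(1)[OF a] unfolding parity_changing_def by blast
qed

lemma polygon_half_edges: "half_edges (polygon_map N a) = (\<lambda>x. {x, a x}) ` {..<N}"
proof -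
  have "orbit (polygon_map N a) {2} x = {x, a x}" if "x < N" for x
  proof
    show "orbit (polygon_map N a) {2} x \<subseteq> {x, a x}"
      by (rule orbit_least) (use gluingsD[OF a that] in auto)
    show "{x, a x} \<subseteq> orbit (polygon_map N a) {2} x"
      using orbit_step[of x "polygon_map N a" "{2}" x 2] that by (auto simp: orbit_refl)
  qed
  then show ?thesis by (auto simp: cells_def)
qed

lemma finite_polygon_half_edges: "finite {e \<in> half_edges (polygon_map N a). e \<subseteq> v}"
  by (simp add: polygon_half_edges)

lemma vertex_orbit_step:
  assumes "y \<in> orbit (polygon_map N a) {1, 2} x" "y < N"
  shows "cn N y \<in> orbit (polygon_map N a) {1, 2} x" "a y \<in> orbit (polygon_map N a) {1, 2} x"
  using orbit_step[OF assms(1), of 1] orbit_step[OF assms(1), of 2] assms(2) by auto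

lemma leaf_orbit:
  assumes "x < N" "a x = cn N x"
  shows "orbit (polygon_map N a) {1, 2} x = {x, a x}"
proof
  show "orbit (polygon_map N a) {1, 2} x \<subseteq> {x, a x}"
    by (rule orbit_least) (use assms gluingsD[OF a assms(1)] cn_cn[OF N(1)] in auto)
  show "{x, a x} \<subseteq> orbit (polygon_map N a) {1, 2} x"
    using vertex_orbit_step(2)[OF orbit_refl assms(1)] by (auto simp: orbit_refl)
qed

lemma node_orbit:
  assumes x: "x < N" and neq: "a x \<noteq> cn N x" and cub: "cn N (a (cn N (a (cn N (a x))))) = x"
  defines "x1 \<equiv> a x" and "x2 \<equiv> cn N (a x)" and "x3 \<equiv> a (cn N (a x))"
    and "x4 \<equiv> cn N (a (cn N (a x)))" and "x5 \<equiv> a (cn N (a (cn N (a x))))"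
  shows "orbit (polygon_map N a) {1, 2} x = {x, x1, x2, x3, x4, x5}"
    and "distinct [x, x1, x2, x3, x4, x5]"
proof -
  note A = gluingsD[OF a] and C = cn_less[of _ N] cn_cn[OF N(1)] cn_neq[OF N(1)]
  have l: "x1 < N" "x2 < N" "x3 < N" "x4 < N" "x5 < N"
    unfolding x1_def x2_def x3_def x4_def x5_def using x A(1) C(1) by simp_all
  have e: "x1 = a x" "a x1 = x" "x2 = cn N x1" "cn N x2 = x1" "x3 = a x2" "a x3 = x2"
    "x4 = cn N x3" "cn N x4 = x3" "x5 = a x4" "a x5 = x4" "cn N x5 = x" "cn N x = x5"
    using x l A(3) C(1,2) cub unfolding x1_def x2_def x3_def x4_def x5_def by (metis A(1) C(1,2))+
  have n: "x1 \<noteq> x" "x2 \<noteq> x1" "x3 \<noteq> x2" "x4 \<noteq> x3" "x5 \<noteq> x4" "x5 \<noteq> x" "x5 \<noteq> x1"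
    using A(2) C(3) l x e neq by metis+
  show "distinct [x, x1, x2, x3, x4, x5]"
    using e n by simp metis
  show "orbit (polygon_map N a) {1, 2} x = {x, x1, x2, x3, x4, x5}"
  proof
    show "orbit (polygon_map N a) {1, 2} x \<subseteq> {x, x1, x2, x3, x4, x5}"
      by (rule orbit_least) (use e in auto)
    note S = vertex_orbit_step
    have "x1 \<in> orbit (polygon_map N a) {1, 2} x" using S[OF orbit_refl x] e by auto
    moreover from S[OF this l(1)] have "x2 \<in> orbit (polygon_map N a) {1, 2} x" using e by auto
    moreover from S[OF this l(2)] have "x3 \<in> orbit (polygon_map N a) {1, 2} x" using e by auto
    moreover from S[OF this l(3)] have "x4 \<in> orbit (polygon_map N a) {1, 2} x" using e by auto
    moreover from S[OF this l(4)] have "x5 \<in> orbit (polygon_map N a) {1, 2} x" using e by auto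
    ultimately show "{x, x1, x2, x3, x4, x5} \<subseteq> orbit (polygon_map N a) {1, 2} x"
      by (auto simp: orbit_refl)
  qed
qed

lemma leaf_degree:
  assumes "x < N" "a x = cn N x"
  shows "degree (polygon_map N a) (orbit (polygon_map N a) {1, 2} x) = 1"
proof -
  have "{e \<in> half_edges (polygon_map N a). e \<subseteq> {x, a x}} = {{x, a x}}"
    using assms gluingsD[OF a] by (auto simp: polygon_half_edges)
  then show ?thesis unfolding degree_def leaf_orbit[OF assms] by simp
qed

lemma node_degree:
  assumes x: "x < N" and neq: "a x \<noteq> cn N x" and cub: "cn N (a (cn N (a (cn N (a x))))) = x"
  shows "degree (polygon_map N a) (orbit (polygon_map N a) {1, 2} x) = 3"
proof -
  define x1 x2 x3 x4 x5 where d: "x1 = a x" "x2 = cn N (a x)" "x3 = a (cn N (a x))"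
    "x4 = cn N (a (cn N (a x)))" "x5 = a (cn N (a (cn N (a x))))"
  have o: "orbit (polygon_map N a) {1, 2} x = {x, x1, x2, x3, x4, x5}"
    "distinct [x, x1, x2, x3, x4, x5]"
    using node_orbit[OF assms] unfolding d by blast+
  have l: "x < N" "x2 < N" "x4 < N"
    unfolding d using x gluingsD(1)[OF a] cn_less[of _ N] by simp_all
  have e: "a x = x1" "a x1 = x" "a x2 = x3" "a x3 = x2" "a x4 = x5" "a x5 = x4"
    using l gluingsD(3)[OF a] unfolding d by auto
  have "{e \<in> half_edges (polygon_map N a). e \<subseteq> {x, x1, x2, x3, x4, x5}} =
      {{x, x1}, {x2, x3}, {x4, x5}}"
  proof (intro equalityI subsetI)
    fix e assume "e \<in> {e \<in> half_edges (polygon_map N a). e \<subseteq> {x, x1, x2, x3, x4, x5}}"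
    then obtain y where "e = {y, a y}" "y \<in> {x, x1, x2, x3, x4, x5}"
      by (auto simp: polygon_half_edges)
    then show "e \<in> {{x, x1}, {x2, x3}, {x4, x5}}" using e by (auto simp: insert_commute)
  next
    fix f assume "f \<in> {{x, x1}, {x2, x3}, {x4, x5}}"
    then have "f = {x, a x} \<or> f = {x2, a x2} \<or> f = {x4, a x4}" using e by auto
    then show "f \<in> {e \<in> half_edges (polygon_map N a). e \<subseteq> {x, x1, x2, x3, x4, x5}}"
      using l e by (auto simp: polygon_half_edges)
  qed
  moreover have "distinct [{x, x1}, {x2, x3}, {x4, x5}]"
    using o(2) by (auto simp: doubleton_eq_iff)
  then have "card (set [{x, x1}, {x2, x3}, {x4, x5}]) = 3" by (subst distinct_card) simp_all
  ultimately show ?thesis unfolding degree_def o(1) by simp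
qed

text \<open>Four successive half-edges around the vertex are followed. A degree of at most 3 makes
  two of them equal, and each possible coincidence closes the turn after one or three rounds, or
  after two.\<close>

lemma cubic_if_degree:
  assumes x: "x < N" and deg: "degree (polygon_map N a) (orbit (polygon_map N a) {1, 2} x) \<in> {1, 3}"
  shows "cn N (a (cn N (a (cn N (a x))))) = x"
proof -
  define V where "V = orbit (polygon_map N a) {1, 2} x"
  define H where "H = {e \<in> half_edges (polygon_map N a). e \<subseteq> V}"
  define x1 x2 x3 x4 x5 x6 x7 where d: "x1 = a x" "x2 = cn N x1" "x3 = a x2"
    "x4 = cn N x3" "x5 = a x4" "x6 = cn N x5" "x7 = a x6"
  note A = gluingsD[OF a] and C = cn_less[of _ N] cn_cn[OF N(1)] cn_neq[OF N(1)]
  have l: "x1 < N" "x2 < N" "x3 < N" "x4 < N" "x5 < N" "x6 < N" "x7 < N"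
    unfolding d using x A(1) C(1) by simp_all
  have e: "a x1 = x" "cn N x2 = x1" "a x3 = x2" "cn N x4 = x3" "a x5 = x4" "cn N x6 = x5" "a x7 = x6"
    using x l A(3) C(2) unfolding d by simp_all
  have n: "x1 \<noteq> x" "x2 \<noteq> x1" "x3 \<noteq> x2" "x4 \<noteq> x3" "x5 \<noteq> x4" "x6 \<noteq> x5" "x7 \<noteq> x6"
    using A(2) C(3) l x unfolding d by simp_all
  note S = vertex_orbit_step[of _ x, folded V_def]
  have v0: "x \<in> V" by (simp add: V_def orbit_refl)
  have v1: "x1 \<in> V" using S(2)[OF v0 x] by (simp add: d)
  have v2: "x2 \<in> V" using S(1)[OF v1 l(1)] by (simp add: d)
  have v3: "x3 \<in> V" using S(2)[OF v2 l(2)] by (simp add: d)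
  have v4: "x4 \<in> V" using S(1)[OF v3 l(3)] by (simp add: d)
  have v5: "x5 \<in> V" using S(2)[OF v4 l(4)] by (simp add: d)
  have v6: "x6 \<in> V" using S(1)[OF v5 l(5)] by (simp add: d)
  have v7: "x7 \<in> V" using S(2)[OF v6 l(6)] by (simp add: d)
  define h0 h1 h2 h3 where h: "h0 = {x, x1}" "h1 = {x2, x3}" "h2 = {x4, x5}" "h3 = {x6, x7}"
  have H: "h0 \<in> H" "h1 \<in> H" "h2 \<in> H" "h3 \<in> H"
    using v0 v1 v2 v3 v4 v5 v6 v7 x l unfolding H_def h polygon_half_edges d by auto
  have fin: "finite H" unfolding H_def by (rule finite_polygon_half_edges)
  have cH: "card H \<in> {1, 3}" using deg by (simp add: degree_def H_def V_def)
  have x20: "x6 = x" if "x2 = x" using that by (simp add: d)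
  \<comment> \<open>A turn that closes after two rounds meets at most two half-edges; as the degree
    is 1 or 3, it is 1, and the turn closes after one round already.\<close>
  have ndeg2: "x2 = x" if x4: "x4 = x"
  proof -
    have Vs: "V \<subseteq> {x, x1, x2, x3}"
      unfolding V_def using x4 e by (intro orbit_least) (auto simp: d)
    have "H \<subseteq> {h0, h1}"
    proof
      fix f assume "f \<in> H"
      then obtain y where y: "f = {y, a y}" "y \<in> V" by (auto simp: H_def polygon_half_edges)
      then have "y \<in> {x, x1, x2, x3}" using Vs by auto
      then show "f \<in> {h0, h1}" using y(1) e d by (auto simp: h insert_commute)
    qed
    then have "card H \<le> 2" using card_mono[of "{h0, h1}" H] card_insert_le_m1[of 2 "{h1}" h0] by simp
    then have c1: "card H = 1" using cH by auto
    then have "h0 = h1" using H by (auto simp: card_1_singleton_iff)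
    then show "x2 = x" using n by (auto simp: h doubleton_eq_iff)
  qed
  have "h0 = h1 \<or> h0 = h2 \<or> h0 = h3 \<or> h1 = h2 \<or> h1 = h3 \<or> h2 = h3"
  proof (rule ccontr)
    assume "\<not> ?thesis"
    then have "distinct [h0, h1, h2, h3]" by simp
    then have "card (set [h0, h1, h2, h3]) = 4" by (subst distinct_card) simp_all
    then have "4 \<le> card H" using card_mono[OF fin, of "set [h0, h1, h2, h3]"] H by simp
    then show False using cH by auto
  qed
  then have "x6 = x"
  proof (elim disjE)
    assume "h0 = h1"
    then have "x2 = x" using n by (auto simp: h doubleton_eq_iff)
    then show ?thesis by (rule x20)
  next
    assume "h0 = h2"
    then have "x4 = x \<or> x4 = x1" by (auto simp: h doubleton_eq_iff)
    moreover have "x4 \<noteq> x1" using e d n by metis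
    ultimately show ?thesis using ndeg2 x20 by blast
  next
    assume "h0 = h3"
    then have "x6 = x \<or> x6 = x1" by (auto simp: h doubleton_eq_iff)
    moreover have "x6 \<noteq> x1"
    proof
      assume "x6 = x1"
      then have "x5 = x2" using e d by metis
      then have "x4 = x3" using e d by metis
      then show False using n by simp
    qed
    ultimately show ?thesis by simp
  next
    assume "h1 = h2"
    then have "x4 = x2" using n by (auto simp: h doubleton_eq_iff)
    then have "x3 = x1" using e d by metis
    then have "x2 = x" using e d by metis
    then show ?thesis by (rule x20)
  next
    assume "h1 = h3"
    then have "x6 = x2 \<or> x6 = x3" by (auto simp: h doubleton_eq_iff)
    moreover have "x6 \<noteq> x3" using e d n by metis
    ultimately have "x5 = x1" using e d by metis
    then have "x4 = x" using e d by metis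
    then show ?thesis using ndeg2 x20 by blast
  next
    assume "h2 = h3"
    then have "x6 = x4" using n by (auto simp: h doubleton_eq_iff)
    then have "x5 = x3" using e d by metis
    then have "x4 = x2" using e d by metis
    then have "x3 = x1" using e d by metis
    then have "x2 = x" using e d by metis
    then show ?thesis by (rule x20)
  qed
  then show ?thesis by (simp add: d)
qed

lemma polygon_precubic: "precubic (polygon_map N a) \<longleftrightarrow> a \<in> cubic_gluings N"
proof
  assume p: "precubic (polygon_map N a)"
  have cub: "cn N (a (cn N (a (cn N (a x))))) = x" if "x < N" for x
    using p that by (intro cubic_if_degree) (auto simp: precubic_def cells_def)
  have "degree (polygon_map N a) (orbit (polygon_map N a) {1, 2} 0) = 1"
    using p by (simp add: precubic_def root_vertex_def)
  then have "a 0 = cn N 0" using node_degree[OF N(2) _ cub[OF N(2)]] by fastforce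
  then show "a \<in> cubic_gluings N" using cub a by (simp add: cubic_gluings_def cn_def)
next
  assume c: "a \<in> cubic_gluings N"
  then have "a 0 = cn N 0" by (simp add: cubic_gluings_def cn_def)
  then have "degree (polygon_map N a) (root_vertex (polygon_map N a)) = 1"
    using leaf_degree[OF N(2)] by (simp add: root_vertex_def)
  moreover have "degree (polygon_map N a) (orbit (polygon_map N a) {1, 2} x) \<in> {1, 3}" if "x < N" for x
    using leaf_degree[OF that] node_degree[OF that] c that
    by (cases "a x = cn N x") (auto simp: cubic_gluings_def)
  ultimately show "precubic (polygon_map N a)"
    by (auto simp: precubic_def cells_def)
qed

text \<open>Leaves have two flags and nodes have six, so \<open>N = 2 L + 6 (V - L)\<close> for
  \<open>L\<close> leaves among \<open>V\<close> vertices.\<close>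

lemma card_polygon_vertices:
  assumes c: "a \<in> cubic_gluings N"
  shows "6 * card (vertices (polygon_map N a)) = N + 4 * card (leaves N a)"
proof -
  let ?V = "vertices (polygon_map N a)" and ?o = "orbit (polygon_map N a) {1, 2}"
  have pm: "is_rooted_map (polygon_map N a)" using N a by (rule polygon_map_rooted)
  have finV: "finite ?V" by (simp add: cells_def)
  define W where "W = ?o ` leaves N a"
  have LN: "x < N" "even x" "a x = cn N x" if "x \<in> leaves N a" for x
    using that by (auto simp: leaves_def)
  have WV: "W \<subseteq> ?V" using LN by (auto simp: W_def cells_def)
  have inj: "inj_on ?o (leaves N a)"
  proof (rule inj_onI)
    fix x y assume xy: "x \<in> leaves N a" "y \<in> leaves N a" "?o x = ?o y"
    then have "{x, a x} = {y, a y}" using leaf_orbit LN by metis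
    then show "x = y" using LN xy even_cn[OF N(1)] by (metis doubleton_eq_iff)
  qed
  have c2: "card v = 2" if "v \<in> W" for v
  proof -
    obtain x where x: "x \<in> leaves N a" "v = ?o x" using \<open>v \<in> W\<close> unfolding W_def by blast
    then have "v = {x, a x}" "a x \<noteq> x" using leaf_orbit LN gluingsD[OF a] by metis+
    then show ?thesis by auto
  qed
  have c6: "card v = 6" if "v \<in> ?V - W" for v
  proof -
    obtain x where x: "x < N" "v = ?o x" using \<open>v \<in> ?V - W\<close> by (auto simp: cells_def)
    have "a x \<noteq> cn N x"
    proof
      assume ax: "a x = cn N x"
      have "\<exists>y\<in>leaves N a. ?o y = v"
      proof (cases "even x")
        case True
        then show ?thesis using x ax by (auto simp: leaves_def)
      next
        case False
        then have "a x \<in> leaves N a"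
          using ax x gluingsD[OF a x(1)] even_cn[OF N(1) x(1)] cn_cn[OF N(1) x(1)]
          by (auto simp: leaves_def)
        moreover have "?o (a x) = ?o x"
          using orbit_eq[OF pm, of x "{1, 2}" "a x"] x vertex_orbit_step(2)[OF orbit_refl x(1)] by simp
        ultimately show ?thesis using x by auto
      qed
      then show False using that by (auto simp: W_def)
    qed
    then have "v = set [x, a x, cn N (a x), a (cn N (a x)), cn N (a (cn N (a x))), a (cn N (a (cn N (a x))))]"
      and "distinct [x, a x, cn N (a x), a (cn N (a x)), cn N (a (cn N (a x))), a (cn N (a (cn N (a x))))]"
      using node_orbit[OF x(1)] c x by (auto simp: cubic_gluings_def)
    then show ?thesis using distinct_card by fastforce
  qed
  have "N = (\<Sum>v\<in>?V. card v)" using sum_card_cells[OF pm, of "{1, 2}"] by simp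
  also have "\<dots> = (\<Sum>v\<in>W. card v) + (\<Sum>v\<in>?V - W. card v)"
    using sum.subset_diff[OF WV finV, of card] by simp
  also have "\<dots> = 2 * card W + 6 * card (?V - W)" using c2 c6 by simp
  also have "card (?V - W) = card ?V - card W" using WV finV finite_subset by (intro card_Diff_subset) auto
  finally have "N = 2 * card W + 6 * (card ?V - card W)" .
  moreover have "card W \<le> card ?V" using WV finV by (rule card_mono[rotated])
  moreover have "card W = card (leaves N a)" using inj by (simp add: W_def card_image)
  ultimately show ?thesis by linarith
qed

text \<open>Euler's formula with one face, where the previous count reads
  \<open>6 V = 4 E + 4 L\<close>. This trades the type for a number of leaves.\<close>

lemma polygon_has_type:
  assumes c: "a \<in> cubic_gluings N" and E: "N = 4 * E"
  shows "has_type (polygon_map N a) h \<longleftrightarrow> 2 * of_nat (card (leaves N a)) = of_nat E + 3 - 6 * h"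
proof -
  have pm: "is_rooted_map (polygon_map N a)" using N a by (rule polygon_map_rooted)
  have "card (edges (polygon_map N a)) = E" using card_flags_eq_edges[OF pm] E by simp
  moreover have "card (faces (polygon_map N a)) = 1"
    using polygon_map_unicellular[OF N a] by (simp add: unicellular_def)
  moreover have "6 * of_nat (card (vertices (polygon_map N a))) = (4 * of_nat E + 4 * of_nat (card (leaves N a)) :: rat)"
    using card_polygon_vertices[OF c] E by (metis of_nat_add of_nat_mult of_nat_numeral)
  ultimately show ?thesis
    unfolding has_type_def euler_char_def by simp linarith
qed

end

text \<open>A node is recorded by its three even flags \<open>p < q < r\<close>; the odd flags of its corners are
  \<open>p - 1\<close>, \<open>q - 1\<close> and \<open>r - 1\<close>.\<close>

definition node_triple :: "nat \<Rightarrow> nat \<Rightarrow> nat \<Rightarrow> nat \<Rightarrow> bool" where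
  "node_triple N p q r \<longleftrightarrow> even p \<and> even q \<and> even r \<and> 0 < p \<and> p < q \<and> q < r \<and> r < N"

text \<open>Each pattern lists three of the six values of \<open>a\<close> at the node; the others
  follow because \<open>a\<close> is an involution. Pattern 0 is the one in which \<open>a\<close>
  changes all parities, as it does in an orientable map.\<close>

definition pattern :: "nat \<Rightarrow> (nat \<Rightarrow> nat) \<Rightarrow> nat \<Rightarrow> nat \<Rightarrow> nat \<Rightarrow> bool" where
  "pattern k a p q r \<longleftrightarrow>
     (if k = 0 then a p = r - 1 \<and> a (q - 1) = r \<and> a q = p - 1
      else if k = 1 then a p = r - 1 \<and> a (q - 1) = p - 1 \<and> a q = r
      else if k = 2 then a (q - 1) = r \<and> a p = q \<and> a (r - 1) = p - 1
      else a q = p - 1 \<and> a (q - 1) = r - 1 \<and> a p = r)"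

text \<open>The other four ways of joining three corners to one vertex. Crossing by \<open>a\<close>
  from \<open>p - 1\<close> on, one arrives at \<open>r\<close> without having passed both inner
  blocks.\<close>

definition plain :: "(nat \<Rightarrow> nat) \<Rightarrow> nat \<Rightarrow> nat \<Rightarrow> nat \<Rightarrow> bool" where
  "plain a p q r \<longleftrightarrow>
     a p = q - 1 \<and> a q = r - 1 \<and> a r = p - 1 \<or>
     a p = q - 1 \<and> a q = r \<and> a (r - 1) = p - 1 \<or>
     a q = r - 1 \<and> a p = r \<and> a (q - 1) = p - 1 \<or>
     a r = p - 1 \<and> a p = q \<and> a (q - 1) = r - 1"

definition intertwined :: "(nat \<Rightarrow> nat) \<Rightarrow> nat \<Rightarrow> nat \<Rightarrow> nat \<Rightarrow> bool" where
  "intertwined a p q r \<longleftrightarrow> (\<exists>k<4. pattern k a p q r)"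

lemma ex_less_4: "(\<exists>k<4. P k) \<longleftrightarrow> P 0 \<or> P 1 \<or> P 2 \<or> P (3::nat)"
  by (auto simp: less_Suc_eq numeral_eq_Suc)

lemma intertwined_iff:
  "intertwined a p q r \<longleftrightarrow>
     a p = r - 1 \<and> a (q - 1) = r \<and> a q = p - 1 \<or>
     a p = r - 1 \<and> a (q - 1) = p - 1 \<and> a q = r \<or>
     a (q - 1) = r \<and> a p = q \<and> a (r - 1) = p - 1 \<or>
     a q = p - 1 \<and> a (q - 1) = r - 1 \<and> a p = r"
  unfolding intertwined_def ex_less_4 by (simp add: pattern_def)

lemma pattern_unique:
  assumes t: "node_triple N p q r" and i: "pattern i a p q r" "i < 4" and j: "pattern j a p q r" "j < 4"
  shows "i = j"
proof -
  have ne: "r - 1 \<noteq> q" "r \<noteq> q" "p - 1 \<noteq> r" "r - 1 \<noteq> r"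
    using t unfolding node_triple_def by presburger+
  have P: "a p = r - 1 \<and> a q = p - 1 \<and> i = 0 \<or> a p = r - 1 \<and> a q = r \<and> i = 1 \<or> a p = q \<and> i = 2 \<or> a p = r \<and> i = 3"
    if "pattern i a p q r" "i < 4" for i
    using that unfolding pattern_def by (auto split: if_splits)
  show ?thesis using P[OF i] P[OF j] ne by metis
qed

definition nodes_of :: "nat \<Rightarrow> nat \<Rightarrow> (nat \<Rightarrow> nat) \<Rightarrow> (nat \<times> nat \<times> nat) set" where
  "nodes_of N k a = {(p, q, r). node_triple N p q r \<and> pattern k a p q r}"

definition all_nodes :: "nat \<Rightarrow> (nat \<Rightarrow> nat) \<Rightarrow> (nat \<times> nat \<times> nat) set" where
  "all_nodes N a = {(p, q, r). node_triple N p q r \<and> (intertwined a p q r \<or> plain a p q r)}"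

definition corner_out :: "nat \<Rightarrow> nat \<Rightarrow> nat" where
  "corner_out N x = (if even x then x else cn N x)"

text \<open>Nonzero only at a corner between two half-edges whose edges are traversed twice in the
  same direction. Such edges have no \<open>edge_sign\<close>; the correction compares whether the
  visits of the two half-edges at this corner are their first ones.\<close>

definition through_sign :: "(nat \<Rightarrow> nat) \<Rightarrow> nat \<Rightarrow> int" where
  "through_sign a x = (if even (a x) \<and> odd (a (x - 1))
     then of_bool (x - 1 < a (x - 1)) - of_bool (x < a x) else 0)"

text \<open>For even \<open>x\<close> and odd \<open>a x\<close> the walk leaves the vertex at
  \<open>x\<close> and returns along the same half-edge at \<open>a x\<close>; the sign tells which
  happens first.\<close>

definition edge_sign :: "(nat \<Rightarrow> nat) \<Rightarrow> nat \<Rightarrow> int" where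
  "edge_sign a x = (if odd (a x) then if x < a x then 1 else - 1 else 0)"

definition inner_evens :: "nat \<Rightarrow> nat set" where
  "inner_evens N = {x. even x \<and> 0 < x \<and> x < N}"

definition through_sum :: "nat \<Rightarrow> (nat \<Rightarrow> nat) \<Rightarrow> int" where
  "through_sum N a = (\<Sum>x\<in>inner_evens N. through_sign a x)"

section \<open>Corners, signs and the number of intertwined nodes\<close>

lemma finite_node_triples: "finite {(p, q, r). node_triple N p q r}"
  by (rule finite_subset[of _ "{..<N} \<times> {..<N} \<times> {..<N}"]) (auto simp: node_triple_def)

lemma finite_nodes_of: "finite (nodes_of N k a)" and finite_all_nodes: "finite (all_nodes N a)"
  by (auto simp: nodes_of_def all_nodes_def intro: finite_subset[OF _ finite_node_triples[of N]])

lemma finite_inner_evens [simp]: "finite (inner_evens N)"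
  by (simp add: inner_evens_def)

context
  fixes N a
  assumes N: "even N" "0 < N" and a: "a \<in> cubic_gluings N"
begin

lemma a_gluing: "a \<in> gluings N"
  using a by (simp add: cubic_gluings_def)

lemma a_cubic: "x < N \<Longrightarrow> cn N (a (cn N (a (cn N (a x))))) = x"
  using a by (simp add: cubic_gluings_def)

lemma a_root: "a 0 = N - 1" "a (N - 1) = 0"
  using a gluingsD(3)[OF a_gluing N(2)] by (simp_all add: cubic_gluings_def)

lemma a_inner:
  assumes "0 < x" "x < N - 1"
  shows "0 < a x" "a x < N - 1"
proof -
  have x: "x < N" using assms by simp
  have "a x \<noteq> 0" "a x \<noteq> N - 1"
    using gluingsD(3)[OF a_gluing x] a_root assms by (metis less_irrefl)+
  then show "0 < a x" "a x < N - 1" using gluingsD(1)[OF a_gluing x] by auto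
qed

lemma node_flags:
  assumes t: "node_triple N p q r"
  obtains p' q' r' where "p - 1 = p'" "q - 1 = q'" "r - 1 = r'"
    "p' < p" "p < q'" "q' < q" "q < r'" "r' < r" "r < N"
    "even p" "even q" "even r" "odd p'" "odd q'" "odd r'"
    "p = Suc p'" "q = Suc q'" "r = Suc r'" "0 < p'" "r < N - 1"
    "a (a p) = p" "a (a p') = p'" "a (a q) = q" "a (a q') = q'" "a (a r) = r" "a (a r') = r'"
proof (rule that[of "p - 1" "q - 1" "r - 1"])
  have d: "even p" "even q" "even r" "0 < p" "p < q" "q < r" "r < N"
    using t by (auto simp: node_triple_def)
  show "p < q - 1" "q < r - 1" "0 < p - 1" "r < N - 1" using d N by presburger+
  show "a (a p) = p" "a (a (p - 1)) = p - 1" "a (a q) = q" "a (a (q - 1)) = q - 1"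
    "a (a r) = r" "a (a (r - 1)) = r - 1"
    using d by (auto intro!: gluingsD(3)[OF a_gluing])
qed (use t in \<open>auto simp: node_triple_def\<close>)

lemma node_values:
  assumes e: "p - 1 = p'" "q - 1 = q'" "r - 1 = r'"
    and i: "a (a p) = p" "a (a p') = p'" "a (a q) = q" "a (a q') = q'" "a (a r) = r" "a (a r') = r'"
  shows "intertwined a p q r \<Longrightarrow>
      (a p = r' \<and> a r' = p \<and> a q' = r \<and> a r = q' \<and> a q = p' \<and> a p' = q) \<or>
      (a p = r' \<and> a r' = p \<and> a q' = p' \<and> a p' = q' \<and> a q = r \<and> a r = q) \<or>
      (a q' = r \<and> a r = q' \<and> a p = q \<and> a q = p \<and> a r' = p' \<and> a p' = r') \<or>
      (a q = p' \<and> a p' = q \<and> a q' = r' \<and> a r' = q' \<and> a p = r \<and> a r = p)"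
    and "plain a p q r \<Longrightarrow>
      (a p = q' \<and> a q' = p \<and> a q = r' \<and> a r' = q \<and> a r = p' \<and> a p' = r) \<or>
      (a p = q' \<and> a q' = p \<and> a q = r \<and> a r = q \<and> a r' = p' \<and> a p' = r') \<or>
      (a q = r' \<and> a r' = q \<and> a p = r \<and> a r = p \<and> a q' = p' \<and> a p' = q') \<or>
      (a r = p' \<and> a p' = r \<and> a p = q \<and> a q = p \<and> a q' = r' \<and> a r' = q')"
  unfolding intertwined_iff plain_def e using i by metis+

text \<open>A node is recovered from any one of its corners by crossing \<open>a\<close> from the
  two flags of that corner. Hence distinct nodes share no corner.\<close>

lemma node_corners:
  assumes t: "node_triple N p q r" and ip: "intertwined a p q r \<or> plain a p q r"
    and x: "x \<in> {p, q, r}"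
  shows "{p, q, r} = {x, corner_out N (a x), corner_out N (a (x - 1))}"
    and "a x \<noteq> cn N x"
proof -
  obtain p' q' r' where e: "p - 1 = p'" "q - 1 = q'" "r - 1 = r'"
    and o: "p' < p" "p < q'" "q' < q" "q < r'" "r' < r" "r < N"
    and par: "even p" "even q" "even r" "odd p'" "odd q'" "odd r'"
    and Suc: "p = Suc p'" "q = Suc q'" "r = Suc r'" "0 < p'" "r < N - 1"
    and i: "a (a p) = p" "a (a p') = p'" "a (a q) = q" "a (a q') = q'" "a (a r) = r" "a (a r') = r'"
    using node_flags[OF t] by metis
  have c: "corner_out N p = p" "corner_out N p' = p" "corner_out N q = q" "corner_out N q' = q"
    "corner_out N r = r" "corner_out N r' = r" "cn N p = p'" "cn N q = q'" "cn N r = r'"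
    using par o Suc e by (auto simp: corner_out_def cn_def)
  have ne: "p' \<noteq> q" "p' \<noteq> r" "q' \<noteq> p" "q' \<noteq> r" "r' \<noteq> p" "r' \<noteq> q" "p' \<noteq> q'" "q' \<noteq> r'" "p' \<noteq> r'"
    using o by simp_all
  have "{p, q, r} = {x, corner_out N (a x), corner_out N (a (x - 1))} \<and> a x \<noteq> cn N x"
    using ip
  proof
    assume "intertwined a p q r"
    from node_values(1)[OF e i this] show ?thesis
      using x by (elim disjE conjE insertE emptyE; simp only: e c ne ne[symmetric] not_False_eq_True simp_thms; simp only: insert_commute)
  next
    assume "plain a p q r"
    from node_values(2)[OF e i this] show ?thesis
      using x by (elim disjE conjE insertE emptyE; simp only: e c ne ne[symmetric] not_False_eq_True simp_thms; simp only: insert_commute)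
  qed
  then show "{p, q, r} = {x, corner_out N (a x), corner_out N (a (x - 1))}" "a x \<noteq> cn N x"
    by blast+
qed

lemma node_unique:
  assumes "(p, q, r) \<in> all_nodes N a" "(p', q', r') \<in> all_nodes N a" "x \<in> {p, q, r}" "x \<in> {p', q', r'}"
  shows "(p, q, r) = (p', q', r')"
proof -
  have "{p, q, r} = {p', q', r'}"
    using node_corners(1)[of p q r x] node_corners(1)[of p' q' r' x] assms
    unfolding all_nodes_def by simp
  moreover have "p < q" "q < r" "p' < q'" "q' < r'"
    using assms(1,2) by (auto simp: all_nodes_def node_triple_def)
  moreover from this have "Min {p, q, r} = p" "Max {p, q, r} = r"
    "Min {p', q', r'} = p'" "Max {p', q', r'} = r'" by simp_all
  ultimately have "p = p'" "r = r'" "q \<in> {p', q', r'}" by auto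
  then show ?thesis using \<open>p < q\<close> \<open>q < r\<close> by auto
qed

text \<open>The other two corners are those reached by \<open>a\<close> from \<open>x\<close> and
  from \<open>x - 1\<close>; they are distinct and different from the corner of \<open>x\<close>
  because \<open>x\<close> is not at a leaf.\<close>

lemma node_exists:
  assumes x: "x \<in> inner_evens N" and nl: "a x \<noteq> cn N x"
  obtains p q r where "(p, q, r) \<in> all_nodes N a" "x \<in> {p, q, r}"
proof -
  note I = gluingsD(3)[OF a_gluing]
  have x': "even x" "0 < x" "x < N" "x < N - 1" "0 < x - 1" "x - 1 < N - 1" "x - 1 < N" "odd (x - 1)" "Suc (x - 1) = x"
    using x N by (auto simp: inner_evens_def elim!: evenE)
  define y w where y: "y = corner_out N (a x)" and w: "w = corner_out N (a (x - 1))"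
  have ye: "even y \<and> 0 < y \<and> y < N \<and> (a x = y \<or> a x = y - 1)"
    using a_inner[OF x'(2,4)] x' N unfolding y corner_out_def cn_def by auto
  have we: "even w \<and> 0 < w \<and> w < N \<and> (a (x - 1) = w \<or> a (x - 1) = w - 1)"
    using a_inner[OF x'(5,6)] x' N unfolding w corner_out_def cn_def by auto
  have cx: "cn N x = x - 1" "cn N y = y - 1" "cn N (y - 1) = y" "cn N w = w - 1" "cn N (w - 1) = w"
    using x' ye we by (auto simp: cn_def)
  \<comment> \<open>The cubic relation read from the opposite side: the half-edge that does not
    touch the corner of \<open>x\<close> joins the other two corners.\<close>
  have third: "a (cn N (a x)) = cn N (a (x - 1))"
  proof -
    note A = gluingsD[OF a_gluing] and C = cn_less[of _ N] cn_cn[OF N(1)]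
    have "a (cn N (a (cn N (a x)))) = x - 1"
      using a_cubic[OF x'(3)] cx(1) A(1) C x'(3) by metis
    then have "cn N (a (cn N (a x))) = a (x - 1)"
      using A(1,3) C(1) x'(3) by metis
    then show ?thesis using A(1) C x'(3) by metis
  qed
  have iv: "a (a x) = x" "a (a (x - 1)) = x - 1" "a (a (cn N (a x))) = cn N (a x)"
    using x' gluingsD(1)[OF a_gluing x'(3)] cn_less[of _ N] by (auto intro!: I)
  have yx: "y \<noteq> x" using ye nl gluingsD(2)[OF a_gluing x'(3)] cx by auto
  have wx: "w \<noteq> x" using we nl gluingsD(2)[OF a_gluing x'(7)] cx iv by auto
  have yw: "y \<noteq> w"
  proof
    assume "y = w"
    then have or: "a (x - 1) = a x \<or> a (x - 1) = cn N (a x)" using ye we cx by auto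
    have "a (x - 1) \<noteq> a x"
    proof
      assume "a (x - 1) = a x"
      then have "x - 1 = x" using iv(1,2) by metis
      then show False using x'(2) by simp
    qed
    then have d: "a (x - 1) = cn N (a x)" using or by simp
    have "cn N (a (x - 1)) = a x"
      unfolding d by (rule cn_cn[OF N(1) gluingsD(1)[OF a_gluing x'(3)]])
    moreover have "a (cn N (a x)) = x - 1" using iv(2) d by metis
    ultimately have "a x = cn N x" using third cx(1) by metis
    then show False using nl by simp
  qed
  have ex: "\<exists>p q r. (p, q, r) \<in> all_nodes N a \<and> x \<in> {p, q, r}"
  proof -
    \<comment> \<open>Six orders of the corners and four ways of attaching them give 24 cases, three
      for each of the eight configurations, as \<open>x\<close> may be any of its three
      corners.\<close>
    have ord: "x < y \<and> y < w \<or> x < w \<and> w < y \<or> y < x \<and> x < w \<or> y < w \<and> w < x \<or> w < x \<and> x < y \<or> w < y \<and> y < x"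
      using yx wx yw by linarith
    have eqs: "a x = y \<and> a (x - 1) = w \<and> a (y - 1) = w - 1 \<and> a y = x \<and> a w = x - 1 \<and> a (w - 1) = y - 1 \<or>
      a x = y \<and> a (x - 1) = w - 1 \<and> a (y - 1) = w \<and> a y = x \<and> a (w - 1) = x - 1 \<and> a w = y - 1 \<or>
      a x = y - 1 \<and> a (x - 1) = w \<and> a y = w - 1 \<and> a (y - 1) = x \<and> a w = x - 1 \<and> a (w - 1) = y \<or>
      a x = y - 1 \<and> a (x - 1) = w - 1 \<and> a y = w \<and> a (y - 1) = x \<and> a (w - 1) = x - 1 \<and> a w = y"
    proof -
      consider "a x = y" "a (x - 1) = w" | "a x = y" "a (x - 1) = w - 1" | "a x = y - 1" "a (x - 1) = w" | "a x = y - 1" "a (x - 1) = w - 1"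
        using ye we by blast
      then show ?thesis
      proof cases
        case 1
        have "a (y - 1) = w - 1" using third by (simp only: 1 cx)
        moreover have "a y = x" "a w = x - 1" using iv(1,2) by (simp_all only: 1)
        moreover from calculation have "a (w - 1) = y - 1" using iv(3) by (simp only: 1 cx)
        ultimately show ?thesis using 1 by blast
      next
        case 2
        have "a (y - 1) = w" using third by (simp only: 2 cx)
        moreover have "a y = x" "a (w - 1) = x - 1" using iv(1,2) by (simp_all only: 2)
        moreover from calculation have "a w = y - 1" using iv(3) by (simp only: 2 cx)
        ultimately show ?thesis using 2 by blast
      next
        case 3
        have "a y = w - 1" using third by (simp only: 3 cx)
        moreover have "a (y - 1) = x" "a w = x - 1" using iv(1,2) by (simp_all only: 3)
        moreover from calculation have "a (w - 1) = y" using iv(3) by (simp only: 3 cx)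
        ultimately show ?thesis using 3 by blast
      next
        case 4
        have "a y = w" using third by (simp only: 4 cx)
        moreover have "a (y - 1) = x" "a (w - 1) = x - 1" using iv(1,2) by (simp_all only: 4)
        moreover from calculation have "a w = y" using iv(3) by (simp only: 4 cx)
        ultimately show ?thesis using 4 by blast
      qed
    qed
    have tr: "node_triple N u v t" if "{u, v, t} = {x, y, w}" "u < v" "v < t" for u v t
    proof -
      have "u \<in> {x, y, w}" "v \<in> {x, y, w}" "t \<in> {x, y, w}" using that(1) by auto
      then show ?thesis using that(2,3) x' ye we by (auto simp: node_triple_def)
    qed
    from ord show ?thesis
    proof (elim disjE)
      assume o: "x < y \<and> y < w"
      then have "intertwined a x y w \<or> plain a x y w"
        using eqs unfolding intertwined_iff plain_def by auto
      then show ?thesis using o tr[of x y w] by (auto simp: all_nodes_def)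
    next
      assume o: "x < w \<and> w < y"
      then have "intertwined a x w y \<or> plain a x w y"
        using eqs unfolding intertwined_iff plain_def by auto
      then show ?thesis using o tr[of x w y] by (auto simp: all_nodes_def insert_commute)
    next
      assume o: "y < x \<and> x < w"
      then have "intertwined a y x w \<or> plain a y x w"
        using eqs unfolding intertwined_iff plain_def by auto
      then show ?thesis using o tr[of y x w] by (auto simp: all_nodes_def insert_commute)
    next
      assume o: "y < w \<and> w < x"
      then have "intertwined a y w x \<or> plain a y w x"
        using eqs unfolding intertwined_iff plain_def by auto
      then show ?thesis using o tr[of y w x] by (auto simp: all_nodes_def insert_commute)
    next
      assume o: "w < x \<and> x < y"
      then have "intertwined a w x y \<or> plain a w x y"
        using eqs unfolding intertwined_iff plain_def by auto
      then show ?thesis using o tr[of w x y] by (auto simp: all_nodes_def insert_commute)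
    next
      assume o: "w < y \<and> y < x"
      then have "intertwined a w y x \<or> plain a w y x"
        using eqs unfolding intertwined_iff plain_def by auto
      then show ?thesis using o tr[of w y x] by (auto simp: all_nodes_def insert_commute)
    qed
  qed
  then show ?thesis using that by blast
qed

text \<open>Every corner except that of the root belongs to exactly one leaf or exactly one node,
  and is represented by its even flag.\<close>

lemma sum_inner_evens:
  fixes f :: "nat \<Rightarrow> 'b :: comm_monoid_add"
  shows "(\<Sum>x\<in>inner_evens N. f x) =
    (\<Sum>x\<in>leaves N a - {0}. f x) + (\<Sum>(p, q, r)\<in>all_nodes N a. f p + f q + f r)"
proof -
  have split: "inner_evens N = (leaves N a - {0}) \<union> (\<Union>(p, q, r)\<in>all_nodes N a. {p, q, r})"
  proof (intro equalityI subsetI)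
    fix x assume x: "x \<in> inner_evens N"
    show "x \<in> (leaves N a - {0}) \<union> (\<Union>(p, q, r)\<in>all_nodes N a. {p, q, r})"
    proof (cases "a x = cn N x")
      case True
      then show ?thesis using x by (auto simp: leaves_def inner_evens_def)
    next
      case False
      then show ?thesis using node_exists[OF x] by blast
    qed
  next
    fix x assume "x \<in> (leaves N a - {0}) \<union> (\<Union>(p, q, r)\<in>all_nodes N a. {p, q, r})"
    then show "x \<in> inner_evens N"
      by (auto simp: leaves_def inner_evens_def all_nodes_def node_triple_def)
  qed
  have disj: "(leaves N a - {0}) \<inter> (\<Union>(p, q, r)\<in>all_nodes N a. {p, q, r}) = {}"
    using node_corners(2) by (fastforce simp: leaves_def all_nodes_def)
  have fin: "finite (leaves N a - {0})" by (simp add: leaves_def)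
  have U: "(\<Sum>x\<in>(\<Union>(p, q, r)\<in>all_nodes N a. {p, q, r}). f x) = (\<Sum>(p, q, r)\<in>all_nodes N a. f p + f q + f r)"
  proof -
    have "(\<Sum>x\<in>(\<Union>(p, q, r)\<in>all_nodes N a. {p, q, r}). f x) =
        (\<Sum>t\<in>all_nodes N a. \<Sum>x\<in>(case t of (p, q, r) \<Rightarrow> {p, q, r}). f x)"
    proof (rule sum.UNION_disjoint)
      show "\<forall>s\<in>all_nodes N a. \<forall>t\<in>all_nodes N a. s \<noteq> t \<longrightarrow>
          (case s of (p, q, r) \<Rightarrow> {p, q, r}) \<inter> (case t of (p, q, r) \<Rightarrow> {p, q, r}) = {}"
    proof (intro ballI impI)
      fix s t assume st: "s \<in> all_nodes N a" "t \<in> all_nodes N a" "s \<noteq> t"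
      obtain p q r p' q' r' where pq: "s = (p, q, r)" "t = (p', q', r')"
        by (metis prod_cases3)
      show "(case s of (p, q, r) \<Rightarrow> {p, q, r}) \<inter> (case t of (p, q, r) \<Rightarrow> {p, q, r}) = {}"
      proof (rule ccontr)
        assume "\<not> ?thesis"
        then obtain x where "x \<in> {p, q, r}" "x \<in> {p', q', r'}" unfolding pq by auto
        then show False using node_unique[of p q r p' q' r' x] st unfolding pq by simp
      qed
    qed
    qed (auto simp: finite_all_nodes)
    also have "\<dots> = (\<Sum>(p, q, r)\<in>all_nodes N a. f p + f q + f r)"
      by (intro sum.cong refl) (auto simp: all_nodes_def node_triple_def add.assoc)
    finally show ?thesis .
  qed
  show ?thesis
    unfolding split using disj fin U
    by (subst sum.union_disjoint) (auto simp: finite_all_nodes)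
qed

lemma root_leaf: "0 \<in> leaves N a"
  using N a_root by (simp add: leaves_def cn_def)

lemma card_all_nodes: "6 * card (all_nodes N a) + 2 * card (leaves N a) = N"
proof -
  have "card (inner_evens N) = card (leaves N a - {0}) + 3 * card (all_nodes N a)"
    using sum_inner_evens[of "\<lambda>_. 1::nat"] by (simp add: case_prod_unfold)
  moreover have "card (leaves N a) = Suc (card (leaves N a - {0}))"
    using root_leaf by (subst card.remove[of _ 0]) (auto simp: leaves_def)
  moreover have "2 * Suc (card (inner_evens N)) = N"
  proof -
    have "(*) 2 ` {..<N div 2} = insert 0 (inner_evens N)"
      using N by (auto simp: inner_evens_def image_iff elim!: evenE)
    then have "card (insert 0 (inner_evens N)) = N div 2"
      using card_image[of "(*) 2" "{..<N div 2}"] by (metis card_lessThan inj_on_mult nat_mult_eq_cancel1 inj_onI zero_less_numeral)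
    then show ?thesis using N by (simp add: inner_evens_def)
  qed
  ultimately show ?thesis by simp
qed

text \<open>Passing to the other end of an edge by \<open>sd (a x)\<close> reverses the order of the
  two visits, so over all even flags the signs cancel. The omitted root flag has sign 1, because its
  edge is left at the very start of the walk.\<close>

lemma sum_edge_sign: "(\<Sum>x\<in>inner_evens N. edge_sign a x) = - 1"
proof -
  let ?T = "{x. x < N \<and> even x \<and> odd (a x)}"
  note A = gluingsD[OF a_gluing]
  have bij: "bij_betw (\<lambda>x. sd (a x)) ?T ?T"
    by (rule bij_betw_byWitness[where f' = "\<lambda>x. sd (a x)"])
      (use A sd_less[OF N(1)] in \<open>auto simp: A(3,4)\<close>)
  have neg: "edge_sign a (sd (a x)) = - edge_sign a x" if "x \<in> ?T" for x
  proof -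
    have x: "x < N" "even x" "odd (a x)" using that by auto
    have "a (sd (a x)) = sd x" using A x by (metis sd_less[OF N(1)])
    moreover have "sd x = Suc x" "sd (a x) = a x - 1" using x by (auto simp: sd_def)
    moreover have "a x \<noteq> Suc x" using A(5)[OF x(1)] x by (simp add: sd_def)
    ultimately show ?thesis using x by (auto simp: edge_sign_def elim!: oddE evenE)
  qed
  have "(\<Sum>x\<in>?T. edge_sign a x) = (\<Sum>x\<in>?T. edge_sign a (sd (a x)))"
    using sum.reindex_bij_betw[OF bij, of "edge_sign a"] by simp
  also have "\<dots> = - (\<Sum>x\<in>?T. edge_sign a x)" using neg by (simp add: sum_negf)
  finally have T0: "(\<Sum>x\<in>?T. edge_sign a x) = 0" by simp
  have "(\<Sum>x\<in>insert 0 (inner_evens N). edge_sign a x) = (\<Sum>x\<in>?T. edge_sign a x)"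
    using N by (intro sum.mono_neutral_right) (auto simp: inner_evens_def edge_sign_def)
  then have "edge_sign a 0 + (\<Sum>x\<in>inner_evens N. edge_sign a x) = 0"
    using T0 by (simp add: inner_evens_def)
  moreover have "edge_sign a 0 = 1"
    using a_root N by (auto simp: edge_sign_def elim!: evenE)
  ultimately show ?thesis by simp
qed

text \<open>A check of the eight configurations. In the two parity-changing ones all three edge
  signs are present; in each of the others one edge sign remains, and twice the through sign of one
  corner stands in for the missing two.\<close>

lemma node_sign:
  assumes "(p, q, r) \<in> all_nodes N a"
  defines "f \<equiv> \<lambda>x. edge_sign a x + 2 * through_sign a x"
  shows "f p + f q + f r = (if intertwined a p q r then - 1 else 1)"
proof -
  have t: "node_triple N p q r" and ip: "intertwined a p q r \<or> plain a p q r"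
    using assms by (auto simp: all_nodes_def)
  obtain p' q' r' where e: "p - 1 = p'" "q - 1 = q'" "r - 1 = r'"
    and o: "p' < p" "p < q'" "q' < q" "q < r'" "r' < r"
    and par: "even p" "even q" "even r" "odd p'" "odd q'" "odd r'"
    and i: "a (a p) = p" "a (a p') = p'" "a (a q) = q" "a (a q') = q'" "a (a r) = r" "a (a r') = r'"
    using node_flags[OF t] by metis
  have o': "p' < q'" "p' < q" "p' < r'" "p' < r" "p < q" "p < r'" "p < r" "q' < r'" "q' < r" "q < r"
    using o by simp_all
  have n: "\<not> p < p'" "\<not> q < q'" "\<not> r < r'" "\<not> q < p'" "\<not> q < p" "\<not> q' < p'" "\<not> q' < p"
    "\<not> r < p'" "\<not> r < p" "\<not> r' < p'" "\<not> r' < p" "\<not> r < q'" "\<not> r < q" "\<not> r' < q'" "\<not> r' < q"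
    using o o' by simp_all
  show ?thesis
  proof (cases "intertwined a p q r")
    case True
    from node_values(1)[OF e i True] have "f p + f q + f r = - 1"
      unfolding f_def edge_sign_def through_sign_def e
      by (elim disjE conjE; simp only: o o' n par if_True if_False not_True_eq_False not_False_eq_True
        simp_thms of_bool_eq; simp)
    then show ?thesis using True by simp
  next
    case False
    then have "plain a p q r" using ip by simp
    from node_values(2)[OF e i this] have "f p + f q + f r = 1"
      unfolding f_def edge_sign_def through_sign_def e
      by (elim disjE conjE; simp only: o o' n par if_True if_False not_True_eq_False not_False_eq_True
        simp_thms of_bool_eq; simp)
    then show ?thesis using False by simp
  qed
qed

text \<open>A two-way edge is crossed outward first at exactly one of its two ends, so the signs of the
  half-edges cancel; at a vertex they count the intertwined nodes up to the defect
  \<^const>\<open>through_sum\<close> caused by the edges traversed twice in the same direction.\<close>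

lemma intertwined_count:
  "2 * int (card {(p, q, r) \<in> all_nodes N a. intertwined a p q r}) =
     int (card (all_nodes N a)) - int (card (leaves N a)) + 2 - 2 * through_sum N a"
proof -
  define f where "f x = edge_sign a x + 2 * through_sign a x" for x
  let ?I = "{(p, q, r) \<in> all_nodes N a. intertwined a p q r}"
  have leaf: "f x = - 1" if "x \<in> leaves N a - {0}" for x
  proof -
    have "a x = x - 1" "even x" "0 < x" using that by (auto simp: leaves_def cn_def)
    then show ?thesis by (auto simp: f_def edge_sign_def through_sign_def)
  qed
  have "- 1 + 2 * through_sum N a = (\<Sum>x\<in>inner_evens N. f x)"
    using sum_edge_sign by (simp add: f_def sum.distrib through_sum_def sum_distrib_left)
  also have "\<dots> = - int (card (leaves N a - {0})) +
      (\<Sum>(p, q, r)\<in>all_nodes N a. if intertwined a p q r then - 1 else 1)"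
    unfolding sum_inner_evens using leaf node_sign
    by (intro arg_cong2[of _ _ _ _ "(+)"] sum.cong) (auto simp: f_def)
  also have "(\<Sum>(p, q, r)\<in>all_nodes N a. if intertwined a p q r then - 1 else 1) =
      (\<Sum>t\<in>all_nodes N a. 1 - 2 * of_bool (t \<in> ?I) :: int)"
    by (intro sum.cong refl) (auto simp: of_bool_def split: if_splits)
  also have "\<dots> = int (card (all_nodes N a)) - 2 * int (card ?I)"
  proof -
    have "all_nodes N a \<inter> ?I = ?I" by auto
    then show ?thesis
      by (simp add: sum_subtractf sum_distrib_left[symmetric] finite_all_nodes sum.If_cases of_bool_def)
  qed
  finally have "- 1 + 2 * through_sum N a =
    - int (card (leaves N a - {0})) + (int (card (all_nodes N a)) - 2 * int (card ?I))" .
  moreover have "card (leaves N a) = Suc (card (leaves N a - {0}))"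
    using root_leaf by (subst card.remove[of _ 0]) (auto simp: leaves_def)
  ultimately show ?thesis by simp
qed

lemma card_intertwined:
  "card {(p, q, r) \<in> all_nodes N a. intertwined a p q r} = (\<Sum>k<4. card (nodes_of N k a))"
proof -
  have "{(p, q, r) \<in> all_nodes N a. intertwined a p q r} = (\<Union>k<4. nodes_of N k a)"
    by (auto simp: all_nodes_def nodes_of_def intertwined_def)
  moreover have "card (\<Union>k<4. nodes_of N k a) = (\<Sum>k<4. card (nodes_of N k a))"
  proof (rule card_UN_disjoint)
    show "\<forall>i\<in>{..<4}. \<forall>j\<in>{..<4}. i \<noteq> j \<longrightarrow> nodes_of N i a \<inter> nodes_of N j a = {}"
      using pattern_unique unfolding nodes_of_def by fastforce
  qed (auto simp: finite_nodes_of)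
  ultimately show ?thesis by simp
qed

end

section \<open>Splitting nodes and gluing leaves\<close>

definition node_flag_set :: "nat \<Rightarrow> nat \<Rightarrow> nat \<Rightarrow> nat set" where
  "node_flag_set p q r = {p - 1, p, q - 1, q, r - 1, r}"

text \<open>With the polygon cut into blocks \<open>A = [0,p)\<close>, \<open>B = [p,q)\<close>, \<open>C = [q,r)\<close>, \<open>D = [r,N)\<close>,
  the four permutations rearrange it as \<open>A C B D\<close>, \<open>A B\<^sup>r C\<^sup>r D\<close>, \<open>A C\<^sup>r B D\<close> and
  \<open>A C B\<^sup>r D\<close>, where the exponent denotes reversal.\<close>

definition block_perm :: "nat \<Rightarrow> nat \<Rightarrow> nat \<Rightarrow> nat \<Rightarrow> nat \<Rightarrow> nat" where
  "block_perm k p q r x =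
     (if p \<le> x \<and> x < q then
        (if k = 0 \<or> k = 2 then x + (r - q) else if k = 1 then p + q - 1 - x else r - 1 + p - x)
      else if q \<le> x \<and> x < r then
        (if k = 0 \<or> k = 3 then x - (q - p) else if k = 1 then q + r - 1 - x else p + (r - 1 - x))
      else x)"

text \<open>The middle cut after the rearrangement: it moves unless the order of B and C is kept,
  which happens for permutation 1 only.\<close>

definition block_mid :: "nat \<Rightarrow> nat \<Rightarrow> nat \<Rightarrow> nat \<Rightarrow> nat" where
  "block_mid k p q r = (if k = 1 then q else p + r - q)"

text \<open>The index of the inverse permutation. The two that reverse just one block are inverse to
  each other, the remaining two are inverted by their own kind.\<close>

definition block_dual :: "nat \<Rightarrow> nat" where
  "block_dual k = (if k = 2 then 3 else if k = 3 then 2 else k)"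

definition leaf_flags :: "nat \<Rightarrow> (nat \<Rightarrow> nat) \<Rightarrow> nat set" where
  "leaf_flags N a = {x. x < N \<and> a x = cn N x}"

lemma block_dual [simp]: "k < 4 \<Longrightarrow> block_dual k < 4" "block_dual (block_dual k) = k"
  by (auto simp: block_dual_def)

lemma node_order:
  assumes "node_triple N p q r"
  shows "0 < p" "p < q - 1" "q < r - 1" "r < N"
  using assms unfolding node_triple_def by presburger+

lemma node_neq:
  assumes "node_triple N p q r"
  shows "p - 1 \<noteq> p" "p - 1 \<noteq> q - 1" "p - 1 \<noteq> q" "p - 1 \<noteq> r - 1" "p - 1 \<noteq> r" "p \<noteq> q - 1" "p \<noteq> q"
    "p \<noteq> r - 1" "p \<noteq> r" "q - 1 \<noteq> q" "q - 1 \<noteq> r - 1" "q - 1 \<noteq> r" "q \<noteq> r - 1" "q \<noteq> r" "r - 1 \<noteq> r"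
  using node_order[OF assms] by linarith+

lemma node_cn:
  assumes "node_triple N p q r"
  shows "cn N p = p - 1" "cn N (p - 1) = p" "cn N q = q - 1" "cn N (q - 1) = q" "cn N r = r - 1" "cn N (r - 1) = r"
proof -
  have "cn N x = x - 1 \<and> cn N (x - 1) = x" if "x \<in> {p, q, r}" for x
  proof -
    have "even x" "0 < x" "x < N" using that assms by (auto simp: node_triple_def)
    then show ?thesis by (simp add: cn_def)
  qed
  then show "cn N p = p - 1" "cn N (p - 1) = p" "cn N q = q - 1" "cn N (q - 1) = q" "cn N r = r - 1" "cn N (r - 1) = r"
    by simp_all
qed

lemma less_4_cases: "(k::nat) < 4 \<Longrightarrow> k = 0 \<or> k = 1 \<or> k = 2 \<or> k = 3"
  by auto

lemma sd_add: "even u \<Longrightarrow> sd (u + d) = u + sd d"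
  by (auto simp: sd_def elim!: oddE)

lemma sd_rev: "even n \<Longrightarrow> d < n \<Longrightarrow> sd (n - 1 - d) = n - 1 - sd d"
  by (auto simp: sd_def elim!: oddE evenE)

lemma cn_add: "even u \<Longrightarrow> 0 < d \<Longrightarrow> Suc (u + d) < N \<Longrightarrow> Suc d < M \<Longrightarrow> cn N (u + d) = u + cn M d"
  by (auto simp: cn_def)

lemma cn_rev: "even n \<Longrightarrow> 0 < d \<Longrightarrow> Suc d < n \<Longrightarrow> cn n (n - 1 - d) = n - 1 - cn n d"
  by (cases "even d") (auto simp: cn_def)

context
  fixes N p q r k
  assumes N: "even N" and t: "node_triple N p q r" and k: "k < (4::nat)"
begin

lemma block_mid_triple: "node_triple N p (block_mid k p q r) r"
  using t by (auto simp: node_triple_def block_mid_def)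

lemma block_mid_mid: "block_mid (block_dual k) p (block_mid k p q r) r = q"
  using t less_4_cases[OF k] by (auto simp: node_triple_def block_mid_def block_dual_def)

lemma block_lengths:
  obtains i j where "q = p + i" "r = p + i + j" "0 < i" "0 < j" "even i" "even j" "even p" "0 < p" "p + i + j < N"
proof (rule that[of "q - p" "r - q"])
  show "even (q - p)" "even (r - q)" using t by (simp_all add: node_triple_def)
qed (use t in \<open>auto simp: node_triple_def\<close>)

lemma block_perm_blocks:
  assumes "q = p + i" "r = p + i + j" "0 < i" "0 < j"
  shows "d < i \<Longrightarrow> block_perm k p q r (p + d) =
      (if k = 0 \<or> k = 2 then p + j + d else if k = 1 then p + (i - 1 - d) else p + j + (i - 1 - d))"
    and "d < j \<Longrightarrow> block_perm k p q r (p + i + d) =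
      (if k = 0 \<or> k = 3 then p + d else if k = 1 then p + i + (j - 1 - d) else p + (j - 1 - d))"
  using assms by (auto simp: block_perm_def)

lemma block_perm_outside: "x < p \<or> r \<le> x \<Longrightarrow> block_perm k p q r x = x"
  using t unfolding node_triple_def block_perm_def by auto

lemma block_cases:
  assumes "q = p + i" "r = p + i + j"
  obtains "x < p \<or> r \<le> x" | d where "x = p + d" "d < i" | d where "x = p + i + d" "d < j"
proof -
  consider "x < p \<or> r \<le> x" | "p \<le> x" "x < p + i" | "p + i \<le> x" "x < p + i + j"
    using assms by linarith
  then show ?thesis
    by cases (use that(1) that(2)[of "x - p"] that(3)[of "x - (p + i)"] in auto)
qed

lemma block_perm_less: "x < N \<Longrightarrow> block_perm k p q r x < N"
  using t unfolding node_triple_def block_perm_def by auto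

text \<open>Blocks start at even flags and have even length, so translating or reversing them maps
  sides to sides.\<close>

lemma block_perm_sd: "block_perm k p q r (sd x) = sd (block_perm k p q r x)"
proof -
  obtain i j where ij: "q = p + i" "r = p + i + j" "0 < i" "0 < j"
    and e: "even i" "even j" "even p" by (rule block_lengths)
  have e': "even (p + i)" "even (p + j)" "even r" using e ij by simp_all
  note B = block_perm_blocks[OF ij]
  show ?thesis
  proof (cases rule: block_cases[OF ij(1,2), of x])
    case 1
    then have "sd x < p \<or> r \<le> sd x" using e(3) e'(3) by (auto simp: sd_def elim!: evenE oddE)
    then show ?thesis using 1 by (simp add: block_perm_outside)
  next
    case (2 d)
    have "sd (p + d) = p + sd d" "sd (p + j + d) = p + j + sd d"
      "sd (p + (i - 1 - d)) = p + (i - 1 - sd d)" "sd (p + j + (i - 1 - d)) = p + j + (i - 1 - sd d)"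
      using sd_rev[OF e(1) 2(2)] by (simp_all only: sd_add[OF e(3)] sd_add[OF e'(2)])
    then show ?thesis
      using sd_less[OF e(1) 2(2)] 2 by (simp add: B)
  next
    case (3 d)
    have "sd (p + i + d) = p + i + sd d" "sd (p + d) = p + sd d"
      "sd (p + i + (j - 1 - d)) = p + i + (j - 1 - sd d)" "sd (p + (j - 1 - d)) = p + (j - 1 - sd d)"
      using sd_rev[OF e(2) 3(2)] by (simp_all only: sd_add[OF e(3)] sd_add[OF e'(1)])
    then show ?thesis
      using sd_less[OF e(2) 3(2)] 3 by (simp add: B)
  qed
qed

text \<open>A corner inside a block moves with the block. Only the corners at the three cuts are
  torn apart, and they consist of the six node flags.\<close>

lemma block_perm_cn:
  assumes x: "x < N" "x \<notin> node_flag_set p q r"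
  shows "block_perm k p q r (cn N x) = cn N (block_perm k p q r x)"
proof -
  obtain i j where ij: "q = p + i" "r = p + i + j" "0 < i" "0 < j"
    and e: "even i" "even j" "even p" "0 < p" "p + i + j < N" by (rule block_lengths)
  have e': "even (p + i)" "even (p + j)" "even r" using e ij by simp_all
  have nx: "x \<noteq> p - 1" "x \<noteq> p" "x \<noteq> q - 1" "x \<noteq> q" "x \<noteq> r - 1" "x \<noteq> r"
    using x by (auto simp: node_flag_set_def)
  note B = block_perm_blocks[OF ij]
  show ?thesis
  proof (cases rule: block_cases[OF ij(1,2), of x])
    case 1
    then have "cn N x < p \<or> r \<le> cn N x"
    proof
      assume "x < p"
      then show ?thesis using nx(1) t unfolding cn_def node_triple_def by (cases "even x"; cases "x = 0"; simp) linarith+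
    next
      assume "r \<le> x"
      then show ?thesis using nx(6) e(4) unfolding cn_def by (cases "even x"; simp) linarith+
    qed
    then show ?thesis using 1 by (simp add: block_perm_outside)
  next
    case (2 d)
    then have d: "0 < d" "Suc d < i" using nx ij by auto
    then have c: "cn i d < i" by (simp add: cn_less)
    have "cn N (p + d) = p + cn i d" "cn N (p + j + d) = p + j + cn i d"
      "cn N (p + (i - 1 - d)) = p + cn i (i - 1 - d)" "cn N (p + j + (i - 1 - d)) = p + j + cn i (i - 1 - d)"
      using d e e' by (intro cn_add; simp)+
    then show ?thesis
      using c cn_rev[OF e(1) d] 2 by (simp add: B)
  next
    case (3 d)
    then have d: "0 < d" "Suc d < j" using nx ij by auto
    then have c: "cn j d < j" by (simp add: cn_less)
    have "cn N (p + i + d) = p + i + cn j d" "cn N (p + d) = p + cn j d"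
      "cn N (p + i + (j - 1 - d)) = p + i + cn j (j - 1 - d)" "cn N (p + (j - 1 - d)) = p + cn j (j - 1 - d)"
      using d e e' by (intro cn_add; simp)+
    then show ?thesis
      using c cn_rev[OF e(2) d] 3 by (simp add: B)
  qed
qed

lemma block_perm_flags:
  "block_perm k p q r (p - 1) = p - 1" "block_perm k p q r r = r"
  "block_perm k p q r p = (if k = 0 \<or> k = 2 then block_mid k p q r else if k = 1 then q - 1 else r - 1)"
  "block_perm k p q r (q - 1) = (if k = 0 \<or> k = 2 then r - 1 else if k = 1 then p else block_mid k p q r)"
  "block_perm k p q r q = (if k = 0 \<or> k = 3 then p else if k = 1 then r - 1 else block_mid k p q r - 1)"
  "block_perm k p q r (r - 1) = (if k = 0 \<or> k = 3 then block_mid k p q r - 1 else if k = 1 then q else p)"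
  using t less_4_cases[OF k] unfolding node_triple_def block_perm_def block_mid_def
  by auto

lemma block_perm_flag_set: "block_perm k p q r ` node_flag_set p q r = node_flag_set p (block_mid k p q r) r"
  using block_perm_flags less_4_cases[OF k] unfolding node_flag_set_def
  by (elim disjE) (simp_all add: block_mid_def insert_commute)

end

lemma block_perm_inverse:
  assumes N: "even N" and t: "node_triple N p q r" and k: "k < (4::nat)"
  shows "block_perm (block_dual k) p (block_mid k p q r) r (block_perm k p q r x) = x"
proof -
  obtain i j where ij: "q = p + i" "r = p + i + j" "0 < i" "0 < j" by (rule block_lengths[OF N t k])
  define s where "s = block_mid k p q r"
  have s1: "s = p + i" if "k = 1" using that ij by (simp add: s_def block_mid_def)
  have s2: "s = p + j" "r = p + j + i" if "k \<noteq> 1" using that ij by (simp_all add: s_def block_mid_def)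
  note B = block_perm_blocks[OF N t k ij]
  have "block_perm (block_dual k) p s r (block_perm k p q r x) = x"
  proof (cases rule: block_cases[OF N t k ij(1,2), of x])
    case 1
    then show ?thesis using block_perm_outside[OF N t k] block_perm_outside[OF N block_mid_triple[OF N t k] block_dual(1)[OF k]]
      unfolding s_def by auto
  next
    case (2 d)
    then show ?thesis
      using less_4_cases[OF k] ij s1 s2 by (auto simp: B block_perm_def block_dual_def)
  next
    case (3 d)
    then show ?thesis
      using less_4_cases[OF k] ij s1 s2 by (auto simp: B block_perm_def block_dual_def)
  qed
  then show ?thesis by (simp add: s_def)
qed

lemma finite_cubic_gluings: "finite (cubic_gluings N)"
proof -
  define e where "e a = (\<lambda>x. if x < N then a x else (0::nat))" for a :: "nat \<Rightarrow> nat"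
  have "e ` cubic_gluings N \<subseteq> {f. \<forall>x. (x \<in> {..<N} \<longrightarrow> f x \<in> {..<N}) \<and> (x \<notin> {..<N} \<longrightarrow> f x = 0)}"
    by (auto simp: cubic_gluings_def gluings_def e_def)
  then have "finite (e ` cubic_gluings N)"
    by (rule finite_subset) (intro finite_set_of_finite_funs; simp)
  moreover have "inj_on e (cubic_gluings N)"
  proof (rule inj_onI, rule ext)
    fix a b x assume ab: "a \<in> cubic_gluings N" "b \<in> cubic_gluings N" "e a = e b"
    show "a x = b x"
    proof (cases "x < N")
      case True
      then show ?thesis using fun_cong[OF ab(3), of x] by (simp add: e_def)
    next
      case False
      then show ?thesis using ab by (simp add: cubic_gluings_def gluings_def)
    qed
  qed
  ultimately show ?thesis by (rule finite_imageD)
qed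

lemma card_leaf_flags:
  assumes "even N" "a \<in> gluings N"
  shows "card (leaf_flags N a) = 2 * card (leaves N a)"
proof -
  note A = gluingsD[OF assms(2)]
  have "leaf_flags N a = leaves N a \<union> a ` leaves N a"
  proof (intro equalityI subsetI)
    fix x assume "x \<in> leaf_flags N a"
    then have x: "x < N" "a x = cn N x" by (auto simp: leaf_flags_def)
    show "x \<in> leaves N a \<union> a ` leaves N a"
    proof (cases "even x")
      case True
      then show ?thesis using x by (simp add: leaves_def)
    next
      case False
      then have "a x \<in> leaves N a"
        using x A(1,3)[OF x(1)] even_cn[OF assms(1) x(1)] cn_cn[OF assms(1) x(1)]
        unfolding leaves_def by simp
      then show ?thesis using A(3)[OF x(1)] by (metis UnI2 imageI)
    qed
  next
    fix x assume "x \<in> leaves N a \<union> a ` leaves N a"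
    then show "x \<in> leaf_flags N a"
    proof
      assume "x \<in> leaves N a"
      then show ?thesis by (simp add: leaves_def leaf_flags_def)
    next
      assume "x \<in> a ` leaves N a"
      then obtain y where y: "y < N" "a y = cn N y" "x = a y" by (auto simp: leaves_def)
      then have "a x = y" "cn N x = y" using A(3)[OF y(1)] cn_cn[OF assms(1) y(1)] by metis+
      then show ?thesis using y(1,3) A(1)[OF y(1)] by (simp add: leaf_flags_def)
    qed
  qed
  moreover have "leaves N a \<inter> a ` leaves N a = {}"
    using even_cn[OF assms(1)] by (auto simp: leaves_def)
  moreover have "inj_on a (leaves N a)"
    by (rule inj_onI) (metis A(3) leaves_def mem_Collect_eq)
  moreover have "finite (leaves N a)" by (simp add: leaves_def)
  ultimately show ?thesis by (simp add: card_Un_disjoint card_image)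
qed

text \<open>If every corner of the node is replaced by \<open>a\<close>, so that its half-edges end
  in leaves, the walk runs through the blocks in the order given by \<open>block_perm k\<close>.
  That permutation thus sends a flag to its position on the new walk, and conjugation writes the
  split map in normal form. With the dual index the same formula glues three leaves.\<close>

definition regluing :: "nat \<Rightarrow> (nat \<Rightarrow> nat) \<times> nat \<times> nat \<times> nat \<Rightarrow> (nat \<Rightarrow> nat) \<times> nat \<times> nat \<times> nat" where
  "regluing k = (\<lambda>(a, p, q, r).
     (\<lambda>x. block_perm k p q r (a (block_perm (block_dual k) p (block_mid k p q r) r x)),
      p, block_mid k p q r, r))"

definition leaf_triples :: "nat \<Rightarrow> (nat \<Rightarrow> nat) \<Rightarrow> (nat \<times> nat \<times> nat) set" where
  "leaf_triples N a = {(p, q, r). node_triple N p q r \<and> {p, q, r} \<subseteq> leaves N a}"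

context
  fixes N p q r k a a'
  assumes N: "even N" and t: "node_triple N p q r" and k: "k < (4::nat)"
    and a: "a \<in> gluings N" "a 0 = N - 1"
    and aQ: "a ` node_flag_set p q r \<subseteq> node_flag_set p q r"
    and cub: "\<And>x. x < N \<Longrightarrow> x \<notin> node_flag_set p q r \<Longrightarrow> cn N (a (cn N (a (cn N (a x))))) = x"
  defines "a' \<equiv> \<lambda>x. block_perm k p q r (a (block_perm (block_dual k) p (block_mid k p q r) r x))"
begin

private abbreviation "s \<equiv> block_mid k p q r"
private abbreviation "f \<equiv> block_perm k p q r"
private abbreviation "g \<equiv> block_perm (block_dual k) p s r"
private abbreviation "Q \<equiv> node_flag_set p q r"
private abbreviation "Q' \<equiv> node_flag_set p s r"

private lemma t': "node_triple N p s r" and k': "block_dual k < 4"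
  using block_mid_triple[OF N t k] k by simp_all

private lemma gf: "g (f x) = x"
  by (rule block_perm_inverse[OF N t k])

private lemma fg: "f (g x) = x"
  using block_perm_inverse[OF N t' k', of x] block_mid_mid[OF N t k] by simp

private lemma fg_less: "x < N \<Longrightarrow> f x < N" "x < N \<Longrightarrow> g x < N"
  using block_perm_less[OF N t k] block_perm_less[OF N t' k'] by auto

private lemma Q_iff: "g x \<in> Q \<longleftrightarrow> x \<in> Q'"
proof -
  have "x \<in> Q' \<longleftrightarrow> x \<in> f ` Q" by (simp only: block_perm_flag_set[OF N t k])
  also have "\<dots> \<longleftrightarrow> g x \<in> Q" using gf fg by (metis image_iff)
  finally show ?thesis by simp
qed

private lemma a_notQ: "x < N \<Longrightarrow> x \<notin> Q \<Longrightarrow> a x \<notin> Q"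
  using aQ gluingsD(3)[OF a(1)] by (metis image_subset_iff)

private lemma cn_Q: "x \<in> Q \<Longrightarrow> cn N x \<in> Q"
  unfolding node_flag_set_def by (elim insertE emptyE) (simp_all only: node_cn[OF t] insert_iff simp_thms)

private lemma cn_notQ: "x < N \<Longrightarrow> x \<notin> Q \<Longrightarrow> cn N x \<notin> Q"
  using cn_Q cn_cn[OF N] by metis

text \<open>The assumptions of this context are chosen to fit both directions: a node to be split
  and three leaves to be glued. In either case \<open>a\<close> preserves the six flags and is cubic
  elsewhere.\<close>

lemma regluing_gluing: "a' \<in> gluings N"
  unfolding gluings_def
proof (intro CollectI conjI allI impI)
  fix x assume x: "x < N"
  note A = gluingsD[OF a(1) fg_less(2)[OF x]]
  show "a' x < N" unfolding a'_def using fg_less A(1) by blast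
  show "a' x \<noteq> x" unfolding a'_def using A(2) gf by metis
  show "a' (a' x) = x" unfolding a'_def gf A(3) by (rule fg)
  show "a' (sd x) = sd (a' x)"
    unfolding a'_def using A(4) by (simp add: block_perm_sd[OF N t k] block_perm_sd[OF N t' k'])
  show "a' x \<noteq> sd x"
  proof
    assume "a' x = sd x"
    then have "a (g x) = g (sd x)" unfolding a'_def using gf by metis
    then show False using A(5) by (simp add: block_perm_sd[OF N t' k'])
  qed
next
  fix x assume x: "N \<le> x"
  then have "x < p \<or> r \<le> x" using t by (auto simp: node_triple_def)
  then have "g x = x" "f x = x" using block_perm_outside[OF N t k] block_perm_outside[OF N t' k'] by auto
  then show "a' x = x" unfolding a'_def using a x by (simp add: gluings_def)
qed

lemma regluing_root: "a' 0 = N - 1"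
proof -
  have "g 0 = 0" "f (N - 1) = N - 1"
    using t t' by (auto intro!: block_perm_outside[OF N t k] block_perm_outside[OF N t' k'] simp: node_triple_def)
  then show ?thesis unfolding a'_def using a by simp
qed

text \<open>Away from the six flags the block permutation commutes with \<open>cn N\<close>, and
  neither \<open>a\<close> nor \<open>cn N\<close> leads into them from outside, so the relation is
  merely conjugated.\<close>

lemma regluing_cubic: "x < N \<Longrightarrow> x \<notin> Q' \<Longrightarrow> cn N (a' (cn N (a' (cn N (a' x))))) = x"
proof -
  assume x: "x < N" "x \<notin> Q'"
  define y where "y = g x"
  have xy: "x = f y" unfolding y_def fg ..
  have y: "y < N" "y \<notin> Q" unfolding y_def using x fg_less Q_iff by auto
  have a'f: "a' (f z) = f (a z)" for z unfolding a'_def gf ..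
  have C: "cn N (f z) = f (cn N z)" if "z < N" "z \<notin> Q" for z
    using block_perm_cn[OF N t k that] by simp
  note A = gluingsD(1)[OF a(1)]
  have s: "a z < N \<and> a z \<notin> Q" "cn N z < N \<and> cn N z \<notin> Q" if "z < N \<and> z \<notin> Q" for z
    using that A a_notQ cn_notQ cn_less by blast+
  have "cn N (a' (cn N (a' (cn N (a' x))))) = f (cn N (a (cn N (a (cn N (a y))))))"
    unfolding xy by (simp add: a'f C s y)
  then show ?thesis using cub[OF y] xy by simp
qed

lemma regluing_leaf_flags: "card (leaf_flags N a' - Q') = card (leaf_flags N a - Q)"
proof -
  have a'f: "a' (f z) = f (a z)" for z unfolding a'_def gf ..
  have C: "cn N (f z) = f (cn N z)" if "z < N" "z \<notin> Q" for z
    using block_perm_cn[OF N t k that] by simp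
  have inj: "f x = f y \<longleftrightarrow> x = y" for x y using gf by metis
  have Q': "f z \<in> Q' \<longleftrightarrow> z \<in> Q" for z using Q_iff[of "f z"] gf by simp
  have "leaf_flags N a' - Q' = f ` (leaf_flags N a - Q)"
  proof (intro equalityI subsetI)
    fix x assume x: "x \<in> leaf_flags N a' - Q'"
    define y where "y = g x"
    have xy: "x = f y" unfolding y_def fg ..
    have y: "y < N" "y \<notin> Q" unfolding y_def using x fg_less Q_iff by (auto simp: leaf_flags_def)
    have "f (a y) = f (cn N y)" using x C[OF y] unfolding xy by (auto simp: leaf_flags_def a'f)
    then show "x \<in> f ` (leaf_flags N a - Q)" using y xy inj by (auto simp: leaf_flags_def)
  next
    fix x assume "x \<in> f ` (leaf_flags N a - Q)"
    then obtain y where y: "x = f y" "y < N" "y \<notin> Q" "a y = cn N y" by (auto simp: leaf_flags_def)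
    then show "x \<in> leaf_flags N a' - Q'" using C fg_less Q' by (auto simp: leaf_flags_def a'f)
  qed
  moreover have "inj_on f (leaf_flags N a - Q)" using inj by (auto simp: inj_on_def)
  ultimately show ?thesis by (simp add: card_image)
qed

text \<open>Permutation 0 reverses no block and translates by even lengths, so every flag keeps its
  parity.\<close>

lemma regluing_parity: "k = 0 \<Longrightarrow> parity_changing N a' \<longleftrightarrow> parity_changing N a"
proof -
  assume k0: "k = 0"
  then have d0: "block_dual k = 0" by (simp add: block_dual_def)
  have e: "even (f x) \<longleftrightarrow> even x" for x
    using t unfolding k0 node_triple_def block_perm_def by auto
  have e': "even (g x) \<longleftrightarrow> even x" for x
    using t' unfolding d0 node_triple_def block_perm_def by auto
  show ?thesis unfolding parity_changing_def a'_def
    using fg_less gf e e' by metis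
qed

end

lemma card_node_flag_set: "node_triple N p q r \<Longrightarrow> card (node_flag_set p q r) = 6"
proof -
  assume t: "node_triple N p q r"
  then show ?thesis
    using node_neq unfolding node_flag_set_def by (simp add: card_insert_if)
qed

lemma leaf_triple_flags:
  assumes "even N" "a \<in> gluings N" "(p, q, r) \<in> leaf_triples N a"
  shows "a p = p - 1" "a (p - 1) = p" "a q = q - 1" "a (q - 1) = q" "a r = r - 1" "a (r - 1) = r"
proof -
  have "x \<in> {p, q, r} \<Longrightarrow> a x = x - 1 \<and> x < N" for x
    using assms by (auto simp: leaf_triples_def leaves_def node_triple_def cn_def)
  then show "a p = p - 1" "a (p - 1) = p" "a q = q - 1" "a (q - 1) = q" "a r = r - 1" "a (r - 1) = r"
    using gluingsD(3)[OF assms(2)] by (metis insertCI)+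
qed

lemma pattern_flags:
  assumes "a \<in> gluings N" "node_triple N p q r" "pattern k a p q r" "k < 4"
  shows "k = 0 \<and> a p = r - 1 \<and> a (r - 1) = p \<and> a (q - 1) = r \<and> a r = q - 1 \<and> a q = p - 1 \<and> a (p - 1) = q \<or>
    k = 1 \<and> a p = r - 1 \<and> a (r - 1) = p \<and> a (q - 1) = p - 1 \<and> a (p - 1) = q - 1 \<and> a q = r \<and> a r = q \<or>
    k = 2 \<and> a (q - 1) = r \<and> a r = q - 1 \<and> a p = q \<and> a q = p \<and> a (r - 1) = p - 1 \<and> a (p - 1) = r - 1 \<or>
    k = 3 \<and> a q = p - 1 \<and> a (p - 1) = q \<and> a (q - 1) = r - 1 \<and> a (r - 1) = q - 1 \<and> a p = r \<and> a r = p"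
proof -
  have "a (a p) = p" "a (a (p - 1)) = p - 1" "a (a q) = q" "a (a (q - 1)) = q - 1"
    "a (a r) = r" "a (a (r - 1)) = r - 1"
    using assms(2) by (auto simp: node_triple_def intro!: gluingsD(3)[OF assms(1)])
  then show ?thesis
    using assms(3) less_4_cases[OF assms(4)] unfolding pattern_def by (elim disjE) (simp, metis)+
qed

text \<open>Flags that \<open>a\<close> joins at the node become neighbours on the new walk, so
  there the new gluing agrees with the corner involution. This creates six leaf flags where there
  were none, hence three leaves, and all other leaf flags are carried along.\<close>

lemma regluing_unglue:
  assumes N: "even N" and k: "k < 4" and a: "a \<in> cubic_gluings N" and t: "(p, q, r) \<in> nodes_of N k a"
    and a': "regluing k (a, p, q, r) = (a', p', s, r')"
  shows "a' \<in> cubic_gluings N" "(p', s, r') \<in> leaf_triples N a'"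
    "card (leaves N a') = card (leaves N a) + 3"
    "k = 0 \<Longrightarrow> parity_changing N a' \<longleftrightarrow> parity_changing N a"
    "regluing (block_dual k) (a', p', s, r') = (a, p, q, r)"
proof -
  have ag: "a \<in> gluings N" "a 0 = N - 1" using a by (auto simp: cubic_gluings_def)
  have nt: "node_triple N p q r" and pat: "pattern k a p q r" using t by (auto simp: nodes_of_def)
  note P = pattern_flags[OF ag(1) nt pat k]
  have aQ: "a ` node_flag_set p q r \<subseteq> node_flag_set p q r"
    using P unfolding node_flag_set_def by (elim disjE) simp_all
  have cub: "cn N (a (cn N (a (cn N (a x))))) = x" if "x < N" "x \<notin> node_flag_set p q r" for x
    using a that by (simp add: cubic_gluings_def)
  have e: "p' = p" "r' = r" "s = block_mid k p q r"
    "a' = (\<lambda>x. block_perm k p q r (a (block_perm (block_dual k) p (block_mid k p q r) r x)))"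
    using a' by (auto simp: regluing_def)
  note R = N nt k ag aQ cub
  have nt': "node_triple N p s r" unfolding e by (rule block_mid_triple[OF N nt k])
  have a'f: "a' (block_perm k p q r x) = block_perm k p q r (a x)" for x
    unfolding e by (simp add: block_perm_inverse[OF N nt k])
  note F = block_perm_flags[OF N nt k, folded e(3)]
  have g': "a' \<in> gluings N" unfolding e by (rule regluing_gluing[OF R])
  have s1: "k = 1 \<Longrightarrow> s = q" unfolding e by (simp add: block_mid_def)
  have "a' (p - 1) = p \<and> a' (s - 1) = s \<and> a' (r - 1) = r"
    using P s1 F a'f[of "p - 1"] a'f[of p] a'f[of q] a'f[of "q - 1"] a'f[of r] a'f[of "r - 1"]
    by (elim disjE) simp_all
  then have lv: "a' (p - 1) = p" "a' (s - 1) = s" "a' (r - 1) = r" by blast+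
  have d: "0 < p" "p < s" "s < r" "r < N" "even p" "even s" "even r" using nt' by (auto simp: node_triple_def)
  have lv': "a' p = p - 1" "a' s = s - 1" "a' r = r - 1"
    using lv gluingsD(3)[OF g'] d by (metis less_imp_diff_less order.strict_trans)+
  have cnQ: "cn N x = a' x" if "x \<in> node_flag_set p s r" for x
    using that d lv lv' unfolding node_flag_set_def cn_def by auto
  have Qless: "x < N" if "x \<in> node_flag_set p s r" for x
    using that d by (auto simp: node_flag_set_def)
  have cub': "cn N (a' (cn N (a' (cn N (a' x))))) = x" if x: "x < N" for x
  proof (cases "x \<in> node_flag_set p s r")
    case True
    then have "a' x = cn N x" using cnQ by simp
    then show ?thesis using x cn_cn[OF N x] by simp
  next
    case False
    then show ?thesis using regluing_cubic[OF R x] unfolding e by simp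
  qed
  have r0: "a' 0 = N - 1" unfolding e by (rule regluing_root[OF R])
  show "a' \<in> cubic_gluings N" using g' r0 cub' by (simp add: cubic_gluings_def)
  show "(p', s, r') \<in> leaf_triples N a'"
    using nt' lv' d unfolding e(1,2) by (auto simp: leaf_triples_def leaves_def cn_def)
  show "k = 0 \<Longrightarrow> parity_changing N a' \<longleftrightarrow> parity_changing N a"
    unfolding e by (rule regluing_parity[OF R])
  have fin: "finite (leaf_flags N b)" for b by (simp add: leaf_flags_def)
  have "leaf_flags N a \<inter> node_flag_set p q r = {}"
  proof -
    have "a x \<noteq> cn N x" if "x \<in> node_flag_set p q r" for x
    proof -
      note ne = node_neq[OF nt]
      show ?thesis
        using P that unfolding node_flag_set_def
        by (elim disjE insertE emptyE conjE; simp only: node_cn[OF nt] ne ne[symmetric] not_False_eq_True)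
    qed
    then show ?thesis by (auto simp: leaf_flags_def)
  qed
  then have "leaf_flags N a - node_flag_set p q r = leaf_flags N a" by auto
  moreover have "card (leaf_flags N a' - node_flag_set p s r) = card (leaf_flags N a') - 6"
    using cnQ Qless card_node_flag_set[OF nt']
    by (subst card_Diff_subset) (auto simp: leaf_flags_def node_flag_set_def)
  moreover have "card (leaf_flags N a' - node_flag_set p s r) = card (leaf_flags N a - node_flag_set p q r)"
    unfolding e by (rule regluing_leaf_flags[OF R])
  moreover have "6 \<le> card (leaf_flags N a')"
    using cnQ Qless card_node_flag_set[OF nt'] fin[of a']
    by (metis (mono_tags, lifting) card_mono leaf_flags_def mem_Collect_eq subsetI)
  ultimately have "card (leaf_flags N a') - 6 = card (leaf_flags N a)" "6 \<le> card (leaf_flags N a')" by simp_all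
  then have "card (leaf_flags N a') = card (leaf_flags N a) + 6" by linarith
  then show "card (leaves N a') = card (leaves N a) + 3"
    using card_leaf_flags[OF N] ag g' by simp
  show "regluing (block_dual k) (a', p', s, r') = (a, p, q, r)"
    using block_perm_inverse[OF N nt k] unfolding regluing_def e
    by (simp add: block_mid_mid[OF N nt k])
qed

text \<open>The images of the three leaf pairs under the dual permutation are exactly the pairs of
  pattern \<open>k\<close>; checking the cubic relation at these six flags is a finite
  computation.\<close>

lemma regluing_glue:
  assumes N: "even N" and k: "k < 4" and a: "a \<in> cubic_gluings N" and t: "(p, q, r) \<in> leaf_triples N a"
    and a': "regluing (block_dual k) (a, p, q, r) = (a', p', s, r')"
  shows "a' \<in> cubic_gluings N" "(p', s, r') \<in> nodes_of N k a'"
    "regluing k (a', p', s, r') = (a, p, q, r)"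
proof -
  have ag: "a \<in> gluings N" "a 0 = N - 1" using a by (auto simp: cubic_gluings_def)
  have nt: "node_triple N p q r" using t by (auto simp: leaf_triples_def)
  have kd: "block_dual k < 4" using k by simp
  note P = leaf_triple_flags[OF N ag(1) t]
  have aQ: "a ` node_flag_set p q r \<subseteq> node_flag_set p q r"
    using P unfolding node_flag_set_def by simp
  have cub: "cn N (a (cn N (a (cn N (a x))))) = x" if "x < N" "x \<notin> node_flag_set p q r" for x
    using a that by (simp add: cubic_gluings_def)
  have e: "p' = p" "r' = r" "s = block_mid (block_dual k) p q r"
    "a' = (\<lambda>x. block_perm (block_dual k) p q r
            (a (block_perm (block_dual (block_dual k)) p (block_mid (block_dual k) p q r) r x)))"
    using a' by (auto simp: regluing_def)
  note R = N nt kd ag aQ cub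
  have nt': "node_triple N p s r" unfolding e by (rule block_mid_triple[OF N nt kd])
  have a'f: "a' (block_perm (block_dual k) p q r x) = block_perm (block_dual k) p q r (a x)" for x
    unfolding e by (simp only: block_perm_inverse[OF N nt kd])
  note F = block_perm_flags[OF N nt kd, folded e(3)]
  have g': "a' \<in> gluings N" unfolding e by (rule regluing_gluing[OF R])
  have s1: "k = 1 \<Longrightarrow> s = q" unfolding e by (simp add: block_mid_def block_dual_def)
  have pat: "pattern k a' p s r"
    using less_4_cases[OF k] P s1 F
      a'f[of "p - 1"] a'f[of p] a'f[of q] a'f[of "q - 1"] a'f[of r] a'f[of "r - 1"]
    by (elim disjE) (simp_all add: pattern_def block_dual_def)
  show n: "(p', s, r') \<in> nodes_of N k a'"
    using nt' pat unfolding e(1,2) by (simp add: nodes_of_def)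
  note P' = pattern_flags[OF g' nt' pat k]
  have d: "0 < p" "p < s" "s < r" "r < N" "even p" "even s" "even r" using nt' by (auto simp: node_triple_def)
  note c = node_cn[OF nt']
  have cub': "cn N (a' (cn N (a' (cn N (a' x))))) = x" if x: "x < N" for x
  proof (cases "x \<in> node_flag_set p s r")
    case True
    then show ?thesis
      using P' unfolding node_flag_set_def by (elim disjE insertE emptyE conjE; simp only: c)
  next
    case False
    then show ?thesis using regluing_cubic[OF R x] unfolding e by simp
  qed
  have r0: "a' 0 = N - 1" unfolding e by (rule regluing_root[OF R])
  show "a' \<in> cubic_gluings N" using g' r0 cub' by (simp add: cubic_gluings_def)
  show "regluing k (a', p', s, r') = (a, p, q, r)"
    using block_perm_inverse[OF N nt kd] block_mid_mid[OF N nt kd] unfolding regluing_def e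
    by simp
qed

section \<open>Double counting of nodes and triples of leaves\<close>

definition cubics :: "bool \<Rightarrow> nat \<Rightarrow> nat \<Rightarrow> (nat \<Rightarrow> nat) set" where
  "cubics b N l = {a \<in> cubic_gluings N. card (leaves N a) = l \<and> parity_changing N a = b}"

lemma finite_cubics [simp]: "finite (cubics b N l)"
  using finite_cubic_gluings by (auto simp: cubics_def)

lemma finite_leaf_triples: "finite (leaf_triples N a)"
  by (auto simp: leaf_triples_def intro: finite_subset[OF _ finite_node_triples[of N]])

lemma pattern_not_parity_changing:
  assumes "node_triple N p q r" "pattern k a p q r" "k < 4" "k \<noteq> 0"
  shows "\<not> parity_changing N a"
proof -
  have "p < N" "q < N" "even p" "even q" "even r" using assms(1) by (auto simp: node_triple_def)
  moreover have "a q = r \<or> a p = q \<or> a p = r"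
    using assms(2-4) unfolding pattern_def by (auto split: if_splits)
  ultimately show ?thesis unfolding parity_changing_def by metis
qed

text \<open>The root leaf is 0 and node triples are positive, so three leaves are chosen among the
  others.\<close>

lemma card_leaf_triples:
  assumes "even N" "0 < N" "a \<in> cubic_gluings N"
  shows "card (leaf_triples N a) = (card (leaves N a) - 1) choose 3"
proof -
  let ?S = "leaves N a - {0}"
  have fin: "finite ?S" by (simp add: leaves_def)
  have "bij_betw (\<lambda>(p, q, r). {p, q, r}) (leaf_triples N a) {K. K \<subseteq> ?S \<and> card K = 3}"
  proof (rule bij_betw_imageI)
    show "inj_on (\<lambda>(p, q, r). {p, q, r}) (leaf_triples N a)"
    proof (rule inj_onI)
      fix x y
      assume xy: "x \<in> leaf_triples N a" "y \<in> leaf_triples N a"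
        "(\<lambda>(p, q, r). {p, q, r}) x = (\<lambda>(p, q, r). {p, q, r}) y"
      obtain p q r p' q' r' where e: "x = (p, q, r)" "y = (p', q', r')" by (metis prod_cases3)
      have t: "(p, q, r) \<in> leaf_triples N a" "(p', q', r') \<in> leaf_triples N a" "{p, q, r} = {p', q', r'}"
        using xy unfolding e by simp_all
      have o: "p < q" "q < r" "p' < q'" "q' < r'"
        using t(1,2) by (auto simp: leaf_triples_def node_triple_def)
      then have "Min {p, q, r} = p" "Max {p, q, r} = r" "Min {p', q', r'} = p'" "Max {p', q', r'} = r'"
        by simp_all
      then have "p = p'" "r = r'" "q \<in> {p', q', r'}" using t(3) by auto
      then show "x = y" using o unfolding e by auto
    qed
    show "(\<lambda>(p, q, r). {p, q, r}) ` leaf_triples N a = {K. K \<subseteq> ?S \<and> card K = 3}"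
    proof (intro equalityI subsetI)
      fix K assume "K \<in> (\<lambda>(p, q, r). {p, q, r}) ` leaf_triples N a"
      then show "K \<in> {K. K \<subseteq> ?S \<and> card K = 3}" by (auto simp: leaf_triples_def node_triple_def)
    next
      fix K assume K: "K \<in> {K. K \<subseteq> ?S \<and> card K = 3}"
      then have finK: "finite K" using fin finite_subset by blast
      define xs where "xs = sorted_list_of_set K"
      have xs: "set xs = K" "length xs = 3" "sorted_wrt (<) xs"
        using K finK by (simp_all add: xs_def)
      then obtain p q r where pqr: "xs = [p, q, r]"
        by (auto simp: numeral_3_eq_3 length_Suc_conv)
      then have "K = {p, q, r}" "p < q" "q < r" using xs(1,3) by simp_all
      moreover from this have "(p, q, r) \<in> leaf_triples N a"
        using K by (auto simp: leaf_triples_def leaves_def node_triple_def)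
      ultimately show "K \<in> (\<lambda>(p, q, r). {p, q, r}) ` leaf_triples N a"
        by (intro image_eqI[of _ _ "(p, q, r)"]) simp_all
    qed
  qed
  then have "card (leaf_triples N a) = card {K. K \<subseteq> ?S \<and> card K = 3}" by (rule bij_betw_same_card)
  also have "\<dots> = card ?S choose 3" using n_subsets[OF fin] by simp
  also have "card ?S = card (leaves N a) - 1"
    using root_leaf[OF assms] by (simp add: leaves_def)
  finally show ?thesis .
qed

text \<open>Gluings with a marked node of pattern \<open>k\<close> correspond to gluings with three
  marked leaves. The closure conditions on the two sets isolate everything that depends on
  orientability.\<close>

lemma sum_card_nodes_of:
  assumes N: "even N" "0 < N" and k: "k < 4"
    and S: "S \<subseteq> cubic_gluings N" and S': "S' \<subseteq> cubic_gluings N"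
    and lv: "\<And>a. a \<in> S' \<Longrightarrow> card (leaves N a) = l"
    and fwd: "\<And>a p q r. a \<in> S \<Longrightarrow> (p, q, r) \<in> nodes_of N k a \<Longrightarrow> fst (regluing k (a, p, q, r)) \<in> S'"
    and bwd: "\<And>a p q r. a \<in> S' \<Longrightarrow> (p, q, r) \<in> leaf_triples N a \<Longrightarrow> fst (regluing (block_dual k) (a, p, q, r)) \<in> S"
  shows "(\<Sum>a\<in>S. card (nodes_of N k a)) = ((l - 1) choose 3) * card S'"
proof -
  have fin: "finite S" "finite S'" using S S' finite_cubic_gluings finite_subset by blast+
  let ?A = "SIGMA a:S. nodes_of N k a" and ?B = "SIGMA a:S'. leaf_triples N a"
  have "bij_betw (regluing k) ?A ?B"
  proof (rule bij_betw_byWitness[where f' = "regluing (block_dual k)"])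
    show "\<forall>x\<in>?A. regluing (block_dual k) (regluing k x) = x"
    proof
      fix x assume "x \<in> ?A"
      then obtain a p q r where x: "a \<in> S" "(p, q, r) \<in> nodes_of N k a" "x = (a, p, q, r)" by auto
      obtain a' p' s r' where y: "regluing k x = (a', p', s, r')" by (metis prod_cases4)
      then show "regluing (block_dual k) (regluing k x) = x"
        using regluing_unglue(5)[OF N(1) k _ x(2), of a' p' s r'] x S by auto
    qed
    show "\<forall>x\<in>?B. regluing k (regluing (block_dual k) x) = x"
    proof
      fix x assume "x \<in> ?B"
      then obtain a p q r where x: "a \<in> S'" "(p, q, r) \<in> leaf_triples N a" "x = (a, p, q, r)" by auto
      obtain a' p' s r' where y: "regluing (block_dual k) x = (a', p', s, r')" by (metis prod_cases4)
      then show "regluing k (regluing (block_dual k) x) = x"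
        using regluing_glue(3)[OF N(1) k _ x(2), of a' p' s r'] x S' by auto
    qed
    show "regluing k ` ?A \<subseteq> ?B"
    proof
      fix y assume "y \<in> regluing k ` ?A"
      then obtain a p q r where x: "a \<in> S" "(p, q, r) \<in> nodes_of N k a" "y = regluing k (a, p, q, r)" by auto
      obtain a' p' s r' where e: "regluing k (a, p, q, r) = (a', p', s, r')" by (metis prod_cases4)
      show "y \<in> ?B"
        using fwd[OF x(1,2)] regluing_unglue(2)[OF N(1) k _ x(2) e] x(1) S unfolding x(3) e by auto
    qed
    show "regluing (block_dual k) ` ?B \<subseteq> ?A"
    proof
      fix y assume "y \<in> regluing (block_dual k) ` ?B"
      then obtain a p q r where x: "a \<in> S'" "(p, q, r) \<in> leaf_triples N a" "y = regluing (block_dual k) (a, p, q, r)" by auto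
      obtain a' p' s r' where e: "regluing (block_dual k) (a, p, q, r) = (a', p', s, r')" by (metis prod_cases4)
      show "y \<in> ?A"
        using bwd[OF x(1,2)] regluing_glue(2)[OF N(1) k _ x(2) e] x(1) S' unfolding x(3) e by auto
    qed
  qed
  then have "card ?A = card ?B" by (rule bij_betw_same_card)
  moreover have "card ?A = (\<Sum>a\<in>S. card (nodes_of N k a))" using fin finite_nodes_of by simp
  moreover have "card ?B = (\<Sum>a\<in>S'. card (leaf_triples N a))" using fin finite_leaf_triples by simp
  moreover have "(\<Sum>a\<in>S'. card (leaf_triples N a)) = (\<Sum>a\<in>S'. (l - 1) choose 3)"
    using lv S' by (intro sum.cong) (auto simp: card_leaf_triples[OF N])
  ultimately show ?thesis by simp
qed

lemma sum_card_nodes_of_0: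
  assumes N: "even N" "0 < N"
  shows "(\<Sum>a\<in>cubics b N l. card (nodes_of N 0 a)) = ((l + 2) choose 3) * card (cubics b N (l + 3))"
proof -
  have d0: "block_dual 0 = 0" by (simp add: block_dual_def)
  have "(\<Sum>a\<in>cubics b N l. card (nodes_of N 0 a)) = ((l + 3 - 1) choose 3) * card (cubics b N (l + 3))"
  proof (rule sum_card_nodes_of[OF N])
    fix a p q r assume a: "a \<in> cubics b N l" "(p, q, r) \<in> nodes_of N 0 a"
    obtain a' p' s r' where e: "regluing 0 (a, p, q, r) = (a', p', s, r')" by (metis prod_cases4)
    show "fst (regluing 0 (a, p, q, r)) \<in> cubics b N (l + 3)"
      using regluing_unglue[OF N(1) _ _ a(2) e] a(1) unfolding e by (auto simp: cubics_def)
  next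
    fix a p q r assume a: "a \<in> cubics b N (l + 3)" "(p, q, r) \<in> leaf_triples N a"
    obtain a' p' s r' where e: "regluing 0 (a, p, q, r) = (a', p', s, r')" by (metis prod_cases4)
    have g: "a' \<in> cubic_gluings N" "(p', s, r') \<in> nodes_of N 0 a'" "regluing 0 (a', p', s, r') = (a, p, q, r)"
      using regluing_glue[OF N(1), of 0 a p q r a' p' s r'] a e d0 by (auto simp: cubics_def)
    show "fst (regluing (block_dual 0) (a, p, q, r)) \<in> cubics b N l"
      using regluing_unglue(3,4)[OF N(1) _ g(1,2) g(3)] a(1) g(1) unfolding d0 e by (auto simp: cubics_def)
  qed (auto simp: cubics_def)
  then show ?thesis by simp
qed

text \<open>A twisted node contradicts orientability, so gluing by such a pattern lands among the
  non-orientable maps wherever it starts; splitting may lead to either kind.\<close>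

lemma sum_card_nodes_of_twisted:
  assumes N: "even N" "0 < N" and k: "k < 4" "k \<noteq> 0"
  shows "(\<Sum>a\<in>cubics False N l. card (nodes_of N k a)) =
    ((l + 2) choose 3) * (card (cubics True N (l + 3)) + card (cubics False N (l + 3)))"
proof -
  have "(\<Sum>a\<in>cubics False N l. card (nodes_of N k a)) =
      ((l + 3 - 1) choose 3) * card (cubics True N (l + 3) \<union> cubics False N (l + 3))"
  proof (rule sum_card_nodes_of[OF N k(1)])
    fix a p q r assume a: "a \<in> cubics False N l" "(p, q, r) \<in> nodes_of N k a"
    obtain a' p' s r' where e: "regluing k (a, p, q, r) = (a', p', s, r')" by (metis prod_cases4)
    show "fst (regluing k (a, p, q, r)) \<in> cubics True N (l + 3) \<union> cubics False N (l + 3)"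
      using regluing_unglue[OF N(1) k(1) _ a(2) e] a(1) unfolding e by (auto simp: cubics_def)
  next
    fix a p q r assume a: "a \<in> cubics True N (l + 3) \<union> cubics False N (l + 3)" "(p, q, r) \<in> leaf_triples N a"
    obtain a' p' s r' where e: "regluing (block_dual k) (a, p, q, r) = (a', p', s, r')" by (metis prod_cases4)
    have g: "a' \<in> cubic_gluings N" "(p', s, r') \<in> nodes_of N k a'" "regluing k (a', p', s, r') = (a, p, q, r)"
      using regluing_glue[OF N(1) k(1), of a p q r a' p' s r'] a e by (auto simp: cubics_def)
    have "\<not> parity_changing N a'"
      using g(2) pattern_not_parity_changing[of N p' s r' k a'] k by (auto simp: nodes_of_def)
    then show "fst (regluing (block_dual k) (a, p, q, r)) \<in> cubics False N l"
      using regluing_unglue(3)[OF N(1) k(1) g(1,2) g(3)] a(1) g(1) unfolding e by (auto simp: cubics_def)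
  qed (auto simp: cubics_def)
  moreover have "cubics True N (l + 3) \<inter> cubics False N (l + 3) = {}" by (auto simp: cubics_def)
  ultimately show ?thesis by (simp add: card_Un_disjoint)
qed

lemma nodes_of_twisted_orientable:
  assumes "a \<in> cubics True N l" "k < 4" "k \<noteq> 0"
  shows "nodes_of N k a = {}"
  using assms pattern_not_parity_changing by (fastforce simp: nodes_of_def cubics_def)

section \<open>The averaging involution\<close>

text \<open>The flags of the edges that are traversed twice in the same direction.\<close>

definition same_flags :: "nat \<Rightarrow> (nat \<Rightarrow> nat) \<Rightarrow> nat set" where
  "same_flags N a = {x. x < N \<and> (even (a x) \<longleftrightarrow> even x)}"

text \<open>The sides of those edges cut the cyclic walk into contents; \<open>link\<close> exchanges the two flags at the
  ends of a content.\<close>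

definition link :: "nat set \<Rightarrow> nat \<Rightarrow> nat" where
  "link S u =
     (if odd u then if u = Max S then Min S else Min {x \<in> S. u < x}
      else if u = Min S then Max S else Max {z \<in> S. z < u})"

text \<open>Exchanges the contents that end with \<open>u\<close> and \<open>a u\<close>, for all \<open>u\<close> at which a content ends. Exactly
  one of the two consists of a single corner, and the other one is reversed.\<close>

definition swap_corners ::
    "(nat \<Rightarrow> nat) \<Rightarrow> nat set \<Rightarrow> (nat \<Rightarrow> nat) \<Rightarrow> (nat \<Rightarrow> nat) \<Rightarrow> nat \<Rightarrow> nat" where
  "swap_corners c S th a u =
     (if u \<in> S then
        if c u \<in> S then if even u then c (th (a u)) else c (a (c u)) else th u
      else if c u \<in> S then if even (c u) then c (a (c u)) else a (th (c u))
      else c u)"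

definition swapped :: "nat \<Rightarrow> (nat \<Rightarrow> nat) \<Rightarrow> nat \<Rightarrow> nat" where
  "swapped N a = swap_corners (cn N) (same_flags N a) (link (same_flags N a)) a"

text \<open>Sides and half-edges are kept and only corners change. Flags outside
  \<open>same_flags N a\<close> end up traversed in the opposite direction, those of the root
  content included, so the walk starts at \<open>N - 1\<close> in order to keep the direction of the
  sides inside.\<close>

definition swapped_map :: "nat \<Rightarrow> (nat \<Rightarrow> nat) \<Rightarrow> nat rooted_map" where
  "swapped_map N a = \<lparr>flags = {..<N}, adj = (\<lambda>i. if i = 0 then sd else if i = 1 then swapped N a else a),
     root = N - 1\<rparr>"

lemma swapped_map_simps [simp]:
  "flags (swapped_map N a) = {..<N}" "root (swapped_map N a) = N - 1"
  "adj (swapped_map N a) 0 = sd" "adj (swapped_map N a) (Suc 0) = swapped N a"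
  "adj (swapped_map N a) 2 = a"
  by (simp_all add: swapped_map_def)

locale nonorientable_gluing =
  fixes N :: nat and a :: "nat \<Rightarrow> nat"
  assumes N: "even N" "0 < N" and a: "a \<in> cubic_gluings N" and np: "\<not> parity_changing N a"
begin

abbreviation "c \<equiv> cn N"
abbreviation "S \<equiv> same_flags N a"
abbreviation "th \<equiv> link (same_flags N a)"
abbreviation "nc \<equiv> swapped N a"

lemma ag: "a \<in> gluings N" using a by (simp add: cubic_gluings_def)

lemmas A = gluingsD[OF ag]

lemma S_less: "u \<in> S \<Longrightarrow> u < N" by (simp add: same_flags_def)

lemma S_parity: "u \<in> S \<Longrightarrow> even (a u) \<longleftrightarrow> even u" by (simp add: same_flags_def)

lemma notS_parity: "u < N \<Longrightarrow> u \<notin> S \<Longrightarrow> even (a u) \<longleftrightarrow> odd u" by (auto simp: same_flags_def)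

lemma a_S: "u < N \<Longrightarrow> a u \<in> S \<longleftrightarrow> u \<in> S"
  using A(1,3) by (auto simp: same_flags_def)

lemma sd_S: "sd u \<in> S \<longleftrightarrow> u \<in> S"
proof -
  have "sd u \<in> S" if "u \<in> S" for u
    using that A(4)[of u] sd_less[OF N(1)] by (auto simp: same_flags_def)
  then show ?thesis by (metis sd_sd)
qed

lemma c_less: "u < N \<Longrightarrow> c u < N" by (rule cn_less)
lemma c_c: "u < N \<Longrightarrow> c (c u) = u" by (rule cn_cn[OF N(1)])
lemma c_even: "u < N \<Longrightarrow> even (c u) \<longleftrightarrow> odd u" by (rule even_cn[OF N(1)])

lemma ends_notS: "0 \<notin> S" "N - 1 \<notin> S"
proof -
  have "a 0 = N - 1" "a (N - 1) = 0" using a_root[OF N a] .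
  then show "0 \<notin> S" "N - 1 \<notin> S" using N by (auto simp: same_flags_def)
qed

text \<open>Around a vertex the parity is flipped by each corner and by each half-edge outside \<open>S\<close>, so
  a vertex of degree three has none or exactly two half-edges in \<open>S\<close>.\<close>

lemma through_iff:
  assumes u: "u \<in> S"
  shows "c u \<in> S \<longleftrightarrow> c (a u) \<notin> S"
proof -
  define v1 v2 v3 v4 v5 where v: "v1 = a u" "v2 = c v1" "v3 = a v2" "v4 = c v3" "v5 = a v4"
  have uN: "u < N" using u S_less by simp
  have l: "v1 < N" "v2 < N" "v3 < N" "v4 < N" "v5 < N"
    unfolding v using uN A(1) c_less by simp_all
  have "c v5 = u" using a_cubic[OF N a uN] unfolding v .
  then have v5: "v5 = c u" using c_c[OF l(5)] by simp
  have p: "even (a w) \<longleftrightarrow> (even w \<longleftrightarrow> w \<in> S)" if "w < N" for w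
    using that by (auto simp: same_flags_def)
  have "even v1 \<longleftrightarrow> even u" using S_parity[OF u] by (simp add: v)
  moreover have "even v2 \<longleftrightarrow> odd v1" using c_even[OF l(1)] by (simp add: v)
  moreover have "even v3 \<longleftrightarrow> (even v2 \<longleftrightarrow> v2 \<in> S)" using p[OF l(2)] by (simp add: v)
  moreover have "even v4 \<longleftrightarrow> odd v3" using c_even[OF l(3)] by (simp add: v)
  moreover have "even v5 \<longleftrightarrow> (even v4 \<longleftrightarrow> v4 \<in> S)" using p[OF l(4)] by (simp add: v)
  moreover have "even v5 \<longleftrightarrow> odd u" using c_even[OF uN] by (simp add: v5)
  moreover have "v5 \<in> S \<longleftrightarrow> v4 \<in> S" using a_S[OF l(4)] by (simp add: v)
  ultimately have "v2 \<in> S \<longleftrightarrow> v5 \<notin> S" by blast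
  then show ?thesis unfolding v5 by (simp add: v)
qed

lemma S_fin: "finite S" by (simp add: same_flags_def)
lemma S_ne: "S \<noteq> {}"
  using np by (auto simp: parity_changing_def same_flags_def)

abbreviation "lo \<equiv> Min S"
abbreviation "hi \<equiv> Max S"

lemma lo: "lo \<in> S" "even lo" "\<And>u. u \<in> S \<Longrightarrow> lo \<le> u"
proof -
  show 1: "lo \<in> S" and 2: "\<And>u. u \<in> S \<Longrightarrow> lo \<le> u" using S_fin S_ne by simp_all
  show "even lo"
  proof (rule ccontr)
    assume "odd lo"
    then have "sd lo < lo" by (auto simp: sd_def elim: oddE)
    then show False using 2[of "sd lo"] sd_S 1 by auto
  qed
qed

lemma hi: "hi \<in> S" "odd hi" "\<And>u. u \<in> S \<Longrightarrow> u \<le> hi"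
proof -
  show 1: "hi \<in> S" and 2: "\<And>u. u \<in> S \<Longrightarrow> u \<le> hi" using S_fin S_ne by simp_all
  show "odd hi"
  proof
    assume "even hi"
    then have "hi < sd hi" by (auto simp: sd_def)
    then show False using 2[of "sd hi"] sd_S 1 by auto
  qed
qed

text \<open>A side lies in \<open>S\<close> with both flags or with none, so the first flag of
  \<open>S\<close> after the end of such a side is the start of another one.\<close>

lemma link_odd:
  assumes z: "z \<in> S" "odd z" "z \<noteq> hi"
  shows "th z \<in> S" "even (th z)" "z < th z" "\<And>w. w \<in> S \<Longrightarrow> w \<le> z \<or> th z \<le> w"
proof -
  let ?T = "{x \<in> S. z < x}"
  have T: "finite ?T" "?T \<noteq> {}" using S_fin hi(1) hi(3)[OF z(1)] z(3) by auto
  have e: "th z = Min ?T" using z by (simp add: link_def)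
  note m = Min_in[OF T] Min_le[OF T(1)]
  show 1: "th z \<in> S" "z < th z" using m(1) unfolding e by auto
  show 3: "w \<le> z \<or> th z \<le> w" if "w \<in> S" for w
    using m(2)[of w] that unfolding e by (cases "z < w") auto
  show "even (th z)"
  proof (rule ccontr)
    assume o: "odd (th z)"
    then have "sd (th z) = th z - 1" by (simp add: sd_def)
    moreover have "sd (th z) \<in> S" using 1 sd_S by simp
    ultimately have "th z - 1 \<le> z \<or> th z \<le> th z - 1" using 3[of "th z - 1"] by simp
    then have "th z = Suc z" using 1(2) by linarith
    then show False using z(2) o by simp
  qed
qed

lemma link_even:
  assumes x: "x \<in> S" "even x" "x \<noteq> lo"
  shows "th x \<in> S" "odd (th x)" "th x < x" "\<And>w. w \<in> S \<Longrightarrow> w \<le> th x \<or> x \<le> w"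
proof -
  let ?T = "{z \<in> S. z < x}"
  have T: "finite ?T" "?T \<noteq> {}" using S_fin lo(1) lo(3)[OF x(1)] x(3) by auto
  have e: "th x = Max ?T" using x by (simp add: link_def)
  note m = Max_in[OF T] Max_ge[OF T(1)]
  show 1: "th x \<in> S" "th x < x" using m(1) unfolding e by auto
  show 3: "w \<le> th x \<or> x \<le> w" if "w \<in> S" for w
    using m(2)[of w] that unfolding e by (cases "w < x") auto
  show "odd (th x)"
  proof
    assume o: "even (th x)"
    then have "sd (th x) = Suc (th x)" by (simp add: sd_def)
    moreover have "sd (th x) \<in> S" using 1 sd_S by simp
    ultimately have "Suc (th x) \<le> th x \<or> x \<le> Suc (th x)" using 3[of "Suc (th x)"] by simp
    then have "x = Suc (th x)" using 1(2) by auto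
    then show False using x(2) o by auto
  qed
qed

lemma link_hi: "th hi = lo" using hi by (simp add: link_def)
lemma link_lo: "th lo = hi" using lo by (simp add: link_def)

lemma link_S: "u \<in> S \<Longrightarrow> th u \<in> S \<and> (even (th u) \<longleftrightarrow> odd u)"
proof -
  assume u: "u \<in> S"
  show ?thesis
  proof (cases "even u")
    case True
    then show ?thesis using link_even[OF u True] link_lo hi by (cases "u = lo") auto
  next
    case False
    then show ?thesis using link_odd[OF u False] link_hi lo by (cases "u = hi") auto
  qed
qed

lemma link_link: "u \<in> S \<Longrightarrow> th (th u) = u"
proof -
  assume u: "u \<in> S"
  consider "u = hi" | "u = lo" | "even u" "u \<noteq> lo" | "odd u" "u \<noteq> hi" by blast
  then show ?thesis
  proof cases
    case 3
    note x = link_even[OF u 3]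
    have "th u \<noteq> hi" using x(3) hi(3)[OF u] by auto
    note z = link_odd[OF x(1,2) this]
    show ?thesis using x(4)[OF z(1)] z(4)[OF u] x(3) z(3) by auto
  next
    case 4
    note z = link_odd[OF u 4]
    have "th u \<noteq> lo" using z(3) lo(3)[OF u] by auto
    note x = link_even[OF z(1,2) this]
    show ?thesis using z(4)[OF x(1)] x(4)[OF u] x(3) z(3) by auto
  qed (simp_all add: link_hi link_lo)
qed

text \<open>A corner with both flags in \<open>S\<close> is a content on its own: no flag lies
  between its two ends.\<close>

lemma link_through:
  assumes u: "u \<in> S" "c u \<in> S"
  shows "th u = c u"
proof -
  have z: "th z = Suc z" if z: "z \<in> S" "odd z" "Suc z \<in> S" for z
  proof -
    have "z \<noteq> hi" using hi(3)[OF z(3)] by auto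
    note l = link_odd[OF z(1,2) this]
    show ?thesis using l(4)[OF z(3)] l(3) by auto
  qed
  show ?thesis
  proof (cases "even u")
    case False
    have "u \<noteq> N - 1" using ends_notS u by metis
    then have "c u = Suc u" using False S_less[OF u(1)] by (auto simp: cn_def)
    then show ?thesis using z[of u] u False by simp
  next
    case True
    have "u \<noteq> 0" using ends_notS u by metis
    then have "c u = u - 1" "Suc (u - 1) = u" using True by (auto simp: cn_def)
    then have "th (c u) = u" using z[of "c u"] u True by auto
    then show ?thesis using link_link[OF u(2)] by simp
  qed
qed

lemma link_nonthrough:
  assumes u: "u \<in> S" "c u \<notin> S"
  shows "c (th u) \<notin> S"
proof
  assume *: "c (th u) \<in> S"
  have t: "th u \<in> S" using link_S u by simp
  then have "u = c (th u)" using link_through[OF t *] link_link[OF u(1)] by simp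
  then have "c u = th u" using c_c[OF S_less[OF t]] by simp
  then show False using u t by simp
qed

text \<open>In this order: a longer content collapses to a corner; a single corner receives the
  partner content, left through its first flag and entered through its last one; the same two
  junctions seen from the content; and corners in the interior stay.\<close>

lemma nc_simps:
  "u \<in> S \<Longrightarrow> c u \<notin> S \<Longrightarrow> nc u = th u"
  "u \<in> S \<Longrightarrow> c u \<in> S \<Longrightarrow> even u \<Longrightarrow> nc u = c (th (a u))"
  "u \<in> S \<Longrightarrow> c u \<in> S \<Longrightarrow> odd u \<Longrightarrow> nc u = c (a (c u))"
  "u \<notin> S \<Longrightarrow> c u \<in> S \<Longrightarrow> even (c u) \<Longrightarrow> nc u = c (a (c u))"
  "u \<notin> S \<Longrightarrow> c u \<in> S \<Longrightarrow> odd (c u) \<Longrightarrow> nc u = a (th (c u))"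
  "u \<notin> S \<Longrightarrow> c u \<notin> S \<Longrightarrow> nc u = c u"
  by (simp_all add: swapped_def swap_corners_def)

text \<open>By the last statement, the construction applied to \<open>nc\<close> returns the original corners.\<close>

lemma nc_facts:
  assumes u: "u < N"
  shows "nc u < N" "nc (nc u) = u" "nc u \<noteq> u"
    "(even (nc u) \<longleftrightarrow> nc u \<in> S) \<noteq> (even u \<longleftrightarrow> u \<in> S)"
    "u \<in> S \<Longrightarrow> nc u \<in> S \<longleftrightarrow> c u \<notin> S"
    "u \<notin> S \<Longrightarrow> nc u \<in> S \<longleftrightarrow> c u \<in> S"
    "swap_corners nc S th a u = c u"
proof -
  have "nc u < N \<and> nc (nc u) = u \<and> nc u \<noteq> u \<and> (even (nc u) \<longleftrightarrow> nc u \<in> S) \<noteq> (even u \<longleftrightarrow> u \<in> S) \<and>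
    (u \<in> S \<longrightarrow> (nc u \<in> S \<longleftrightarrow> c u \<notin> S)) \<and> (u \<notin> S \<longrightarrow> (nc u \<in> S \<longleftrightarrow> c u \<in> S)) \<and>
    swap_corners nc S th a u = c u"
  proof (cases "u \<in> S")
    case uS: True
    have au: "a u \<in> S" "even (a u) \<longleftrightarrow> even u" "a (a u) = u"
      using uS a_S[OF u] S_parity A(3)[OF u] by auto
    show ?thesis
    proof (cases "c u \<in> S")
      case False
      note t = link_S[OF uS] link_nonthrough[OF uS False] link_link[OF uS]
      have n: "nc u = th u" "nc (th u) = u" using nc_simps(1) uS False t by auto
      have cau: "c (a u) \<in> S" using through_iff[OF uS] False by simp
      have "swap_corners nc S th a u = (if even u then nc (th (a u)) else nc (a (th u)))"
        using uS t n by (simp add: swap_corners_def)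
      also have "\<dots> = c u"
      proof (cases "even u")
        case True
        have 1: "th (a u) = c (a u)" using link_through[OF au(1) cau] .
        have 2: "odd (c (a u))" "c (c (a u)) = a u"
          using True c_even[OF S_less[OF au(1)]] c_c[OF S_less[OF au(1)]] au(2) by auto
        show ?thesis using True nc_simps(3)[of "c (a u)"] cau au 1 2 by simp
      next
        case False
        let ?x = "th u"
        have x: "?x \<in> S" "even ?x" "c ?x \<notin> S" using t False by auto
        have ax: "a ?x \<in> S" "even (a ?x)" "c (a ?x) \<in> S" "a (a ?x) = ?x"
          using x a_S[OF S_less[OF x(1)]] S_parity[OF x(1)] through_iff[OF x(1)] A(3)[OF S_less[OF x(1)]] by auto
        show ?thesis using False nc_simps(2)[OF ax(1,3,2)] ax(4) t by simp
      qed
      finally show ?thesis using n t uS False S_less by auto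
    next
      case True
      have cau: "c (a u) \<notin> S" using through_iff[OF uS] True by simp
      have swp: "th u = c u" using link_through[OF uS True] .
      show ?thesis
      proof (cases "even u")
        case ev: True
        let ?z = "th (a u)"
        have z: "?z \<in> S" "odd ?z" "c ?z \<notin> S" "th ?z = a u"
          using link_S[OF au(1)] link_nonthrough[OF au(1) cau] link_link[OF au(1)] au ev by auto
        have g: "c ?z < N" "c (c ?z) = ?z" "even (c ?z)"
          using z c_less[OF S_less[OF z(1)]] c_c[OF S_less[OF z(1)]] c_even[OF S_less[OF z(1)]] by auto
        have n: "nc u = c ?z" using nc_simps(2)[OF uS True ev] .
        have "nc (c ?z) = u" using nc_simps(5)[of "c ?z"] z g au by simp
        moreover have "swap_corners nc S th a u = c u"
          using uS z n swp by (simp add: swap_corners_def)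
        ultimately show ?thesis using n g z uS True ev by auto
      next
        case od: False
        let ?t = "c u"
        have t: "?t \<in> S" "even ?t" "c ?t = u" using True c_even[OF u] c_c[OF u] od by auto
        have at: "a ?t \<in> S" "even (a ?t)" "a (a ?t) = ?t" "c (a ?t) \<notin> S"
          using t a_S[OF S_less[OF t(1)]] S_parity[OF t(1)] A(3)[OF S_less[OF t(1)]] through_iff[OF t(1)] uS
          by auto
        have f: "c (a ?t) < N" "c (c (a ?t)) = a ?t" "odd (c (a ?t))"
          using at c_less[OF S_less[OF at(1)]] c_c[OF S_less[OF at(1)]] c_even[OF S_less[OF at(1)]] by auto
        have n: "nc u = c (a ?t)" using nc_simps(3)[OF uS True od] .
        have "nc (c (a ?t)) = u" using nc_simps(4)[of "c (a ?t)"] f at t by simp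
        moreover have "swap_corners nc S th a u = c u"
          using uS at n swp by (simp add: swap_corners_def)
        ultimately show ?thesis using n f at uS True od by auto
      qed
    qed
  next
    case uS: False
    show ?thesis
    proof (cases "c u \<in> S")
      case False
      have n: "nc u = c u" using nc_simps(6)[OF uS False] .
      have "nc (c u) = u" using nc_simps(6)[OF False] c_c[OF u] uS by simp
      then show ?thesis
        using n uS False c_less[OF u] c_even[OF u] cn_neq[OF N(1) u] by (simp add: swap_corners_def)
    next
      case cS: True
      have cc: "c (c u) = u" using c_c[OF u] .
      show ?thesis
      proof (cases "even (c u)")
        case ev: True
        let ?x = "c u"
        have ax: "a ?x \<in> S" "even (a ?x)" "c (a ?x) \<in> S" "a (a ?x) = ?x"
          using cS ev uS cc a_S[OF S_less[OF cS]] S_parity[OF cS] through_iff[OF cS] A(3)[OF S_less[OF cS]] by auto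
        let ?z = "c (a ?x)"
        have z: "c ?z = a ?x" "odd ?z" "?z < N"
          using ax c_c[OF S_less[OF ax(1)]] c_even[OF S_less[OF ax(1)]] S_less[OF ax(3)] by auto
        have n: "nc u = ?z" using nc_simps(4)[OF uS cS ev] .
        have "nc ?z = u" using nc_simps(3)[OF ax(3)] z ax cc by simp
        moreover have "th ?z = a ?x" using link_through[OF ax(3)] z ax by simp
        then have "swap_corners nc S th a u = c u"
          using uS n ax z by (simp add: swap_corners_def)
        moreover have "odd u" using ev c_even[OF u] by simp
        ultimately show ?thesis using n z ax uS cS by auto
      next
        case od: False
        let ?z = "c u"
        have x: "th ?z \<in> S" "even (th ?z)" "c (th ?z) \<notin> S" "th (th ?z) = ?z"
          using link_S[OF cS] od link_nonthrough[OF cS] uS cc link_link[OF cS] by auto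
        have ax: "a (th ?z) \<in> S" "even (a (th ?z))" "c (a (th ?z)) \<in> S" "a (a (th ?z)) = th ?z"
          using x a_S[OF S_less[OF x(1)]] S_parity[OF x(1)] through_iff[OF x(1)] A(3)[OF S_less[OF x(1)]] by auto
        have n: "nc u = a (th ?z)" using nc_simps(5)[OF uS cS od] .
        have "nc (a (th ?z)) = u" using nc_simps(2)[OF ax(1,3,2)] ax(4) x(4) cc by simp
        moreover have "nc (th ?z) = ?z" using nc_simps(1)[OF x(1,3)] x(4) by simp
        then have "swap_corners nc S th a u = c u"
          using uS n ax by (simp add: swap_corners_def)
        moreover have "even u" using od c_even[OF u] by simp
        ultimately show ?thesis using n ax uS cS S_less by auto
      qed
    qed
  qed
  then show "nc u < N" "nc (nc u) = u" "nc u \<noteq> u"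
    "(even (nc u) \<longleftrightarrow> nc u \<in> S) \<noteq> (even u \<longleftrightarrow> u \<in> S)"
    "u \<in> S \<Longrightarrow> nc u \<in> S \<longleftrightarrow> c u \<notin> S"
    "u \<notin> S \<Longrightarrow> nc u \<in> S \<longleftrightarrow> c u \<in> S"
    "swap_corners nc S th a u = c u" by blast+
qed

text \<open>The relation passes from a flag to its images under \<open>nc\<close> and
  \<open>a\<close>, so one odd flag \<open>z\<close> that starts a longer content is enough for each
  vertex touched by the exchange. All other vertices keep their corners.\<close>

lemma swapped_cubic:
  assumes u: "u < N"
  shows "nc (a (nc (a (nc (a u))))) = u"
proof -
  define C where "C u \<longleftrightarrow> nc (a (nc (a (nc (a u))))) = u" for u
  have lt: "a v < N" "nc v < N" if "v < N" for v using A(1) nc_facts(1) that by auto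
  have inv: "a (a v) = v" "nc (nc v) = v" if "v < N" for v using A(3) nc_facts(2) that by auto
  have Cnc: "C (nc v)" if "C v" "v < N" for v
  proof -
    have e: "nc (a (nc (a (nc (a v))))) = v" using that by (simp add: C_def)
    let ?p = "nc (a (nc (a v)))" let ?q = "nc (a v)"
    have l: "?p < N" "?q < N" "a ?p < N" "a ?q < N" "a v < N" using lt that(2) by auto
    have "nc v = a ?p" using e inv(2)[OF l(3)] by simp
    then have "a (nc v) = ?p" using inv(1)[OF l(1)] by simp
    then have "nc (a (nc v)) = a ?q" using inv(2)[OF l(4)] by simp
    then have "a (nc (a (nc v))) = ?q" using inv(1)[OF l(2)] by simp
    then have "nc (a (nc (a (nc v)))) = a v" using inv(2)[OF l(5)] by simp
    then have "nc (a (nc (a (nc (a (nc v)))))) = nc v" using inv(1)[OF that(2)] by simp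
    then show ?thesis by (simp add: C_def)
  qed
  have Ca: "C (a v)" if "C v" "v < N" for v
  proof -
    have e: "nc (a (nc (a (nc (a v))))) = v" using that by (simp add: C_def)
    let ?p = "nc (a (nc (a v)))" let ?q = "nc (a v)"
    have l: "?p < N" "?q < N" "a ?p < N" "a ?q < N" "a v < N" using lt that(2) by auto
    have "nc (a (a v)) = a ?p" using e inv(2)[OF l(3)] inv(1)[OF that(2)] by simp
    then have "nc (a (nc (a (a v)))) = a ?q" using inv(1)[OF l(1)] inv(2)[OF l(4)] by simp
    then have "nc (a (nc (a (nc (a (a v)))))) = a v" using inv(1)[OF l(2)] inv(2)[OF l(5)] by simp
    then show ?thesis by (simp add: C_def)
  qed
  have base: "C z" if z: "z \<in> S" "odd z" "c z \<notin> S" for z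
  proof -
    have zN: "z < N" using z S_less by simp
    have az: "a z \<in> S" "odd (a z)" "c (a z) \<in> S"
      using z a_S[OF zN] S_parity[OF z(1)] through_iff[OF z(1)] by auto
    have "nc (a z) = c (a (c (a z)))" using nc_simps(3)[OF az(1,3,2)] .
    moreover have "c (a (c (a (c (a z))))) = z" using a_cubic[OF N a zN] .
    moreover have "a (c (a (c (a z)))) < N" using zN A(1) c_less by simp
    ultimately have "a (nc (a z)) = c z" using c_c by metis
    moreover have "nc (c z) = a (th z)" using nc_simps(5)[of "c z"] z c_c[OF zN] by simp
    moreover have "th z \<in> S" "c (th z) \<notin> S" using link_S z link_nonthrough by auto
    then have "a (a (th z)) = th z" "nc (th z) = z"
      using A(3)[OF S_less] nc_simps(1) link_link[OF z(1)] by auto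
    ultimately show ?thesis by (simp add: C_def)
  qed
  have C1: "C v" if v: "v \<in> S" "c v \<notin> S" for v
  proof (cases "even v")
    case False
    then show ?thesis using base v by simp
  next
    case True
    have t: "th v \<in> S" "odd (th v)" "c (th v) \<notin> S" using link_S v link_nonthrough True by auto
    then have "nc (th v) = v" using nc_simps(1) link_link[OF v(1)] by simp
    then show ?thesis using Cnc[OF base[OF t] S_less[OF t(1)]] by simp
  qed
  have C2: "C v" if v: "v \<in> S" for v
  proof (cases "c v \<in> S")
    case True
    have "v < N" using v S_less by simp
    then have "C (a v)" using C1[of "a v"] a_S through_iff[OF v] v True by simp
    then show ?thesis using Ca[of "a v"] A(1,3)[OF \<open>v < N\<close>] by simp
  qed (use C1 v in simp)
  have C3: "C v" if v: "v < N" "c v \<in> S" for v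
  proof (cases "v \<in> S")
    case False
    then have "C (nc v)" using C2 nc_facts(6)[OF v(1)] v by simp
    then show ?thesis using Cnc[of "nc v"] lt inv v by simp
  qed (use C2 in simp)
  show ?thesis
  proof (cases "u \<in> S \<or> c u \<in> S \<or> c (a u) \<in> S")
    case True
    then consider "u \<in> S" | "c u \<in> S" | "c (a u) \<in> S" by blast
    then have "C u"
    proof cases
      case 3
      then have "C (a u)" using C3 lt u by simp
      then show ?thesis using Ca[of "a u"] lt inv u by simp
    qed (use C2 C3 u in auto)
    then show ?thesis by (simp add: C_def)
  next
    case False
    have au: "a u < N" "a u \<notin> S" using lt u a_S False by auto
    define w where "w = c (a u)"
    have w: "w < N" "w \<notin> S" "nc (a u) = w"
      using au False c_less nc_simps(6)[of "a u"] by (auto simp: w_def)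
    define y where "y = c (a w)"
    have yN: "y < N" using w A(1) c_less by (simp add: y_def)
    have cay: "c (a y) = u" using a_cubic[OF N a u] by (simp add: w_def y_def)
    then have ay: "a y = c u" using c_c[of "a y"] A(1)[OF yN] by simp
    have "y \<notin> S" using a_S[OF yN] ay False by simp
    then have "nc (a w) = y" using nc_simps(6)[of "a w"] a_S[OF w(1)] w by (simp add: y_def)
    moreover have "nc (a y) = u" using nc_simps(6)[of "a y"] ay cay False by simp
    ultimately show ?thesis using w by simp
  qed
qed

lemma S_pos: "u \<in> S \<Longrightarrow> 0 < u \<and> u < N - 1"
  using S_less ends_notS by (metis One_nat_def Suc_pred N(2) less_SucE not_gr_zero)

text \<open>In a stretch free of \<open>S\<close> the new corners are the old ones, so a set closed
  under the new moves contains all of the stretch or nothing.\<close>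

lemma orbit_gap:
  assumes closed: "\<forall>v<N. v \<in> W \<longrightarrow> sd v \<in> W \<and> nc v \<in> W"
    and gap: "\<forall>v. i \<le> v \<and> v \<le> j \<longrightarrow> v \<notin> S" and j: "j < N"
    and u: "u \<in> W" "i \<le> u" "u \<le> j" and v: "i \<le> v" "v \<le> j"
  shows "v \<in> W"
proof -
  have W: "\<And>v. v < N \<Longrightarrow> v \<in> W \<Longrightarrow> sd v \<in> W" "\<And>v. v < N \<Longrightarrow> v \<in> W \<Longrightarrow> nc v \<in> W"
    using closed by auto
  have step: "v \<in> W \<longleftrightarrow> Suc v \<in> W" if v: "i \<le> v" "Suc v \<le> j" for v
  proof (cases "even v")
    case True
    then have "sd v = Suc v" "sd (Suc v) = v" by (auto simp: sd_def)
    then show ?thesis using W(1)[of v] W(1)[of "Suc v"] v j by auto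
  next
    case False
    then have cv: "c v = Suc v" "c (Suc v) = v" using v j by (auto simp: cn_def)
    then have "nc v = Suc v" "nc (Suc v) = v"
      using nc_simps(6) gap v by auto
    then show ?thesis using W(2)[of v] W(2)[of "Suc v"] v j by auto
  qed
  have i: "i + d \<le> j \<Longrightarrow> i + d \<in> W \<longleftrightarrow> i \<in> W" for d
    by (induction d) (use step in auto)
  show ?thesis using i[of "u - i"] i[of "v - i"] u v by simp
qed

text \<open>The partner of the first flag of \<open>S\<close>. The content ending with
  \<open>lo\<close> holds the root and is no single corner, so the one ending with
  \<open>piv\<close> is; it is here that the root content is inserted.\<close>

abbreviation "piv \<equiv> a lo"

lemma piv: "piv \<in> S" "even piv" "lo < piv" "c piv \<in> S" "c piv = piv - 1" "th piv = c piv" "a piv = lo"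
proof -
  have l: "lo < N" using lo(1) S_less by simp
  show 1: "piv \<in> S" "even piv" "a piv = lo" using a_S[OF l] lo S_parity A(3)[OF l] by auto
  have "piv \<noteq> lo" using A(2)[OF l] .
  then show "lo < piv" using lo(3)[OF 1(1)] by simp
  have "c lo \<notin> S"
  proof
    assume "c lo \<in> S"
    moreover have "c lo = lo - 1" "0 < lo" using lo(2) S_pos[OF lo(1)] by (auto simp: cn_def)
    ultimately show False using lo(3)[of "c lo"] by simp
  qed
  then show 2: "c piv \<in> S" using through_iff[OF 1(1)] 1(3) by simp
  show "c piv = piv - 1" using 1(2) S_pos[OF 1(1)] by (simp add: cn_def)
  show "th piv = c piv" using link_through[OF 1(1) 2] .
qed

text \<open>The new walk misses nothing, so there is still one face; the statement uses an arbitrary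
  closed set \<open>W\<close> in place of the orbit. The root content leads to \<open>c piv\<close>.
  From there the old cyclic order of \<open>S\<close> can be followed, because the two ends of a
  content stay connected.\<close>

lemma orbit_all:
  assumes W: "\<And>v. v < N \<Longrightarrow> v \<in> W \<Longrightarrow> sd v \<in> W" "\<And>v. v < N \<Longrightarrow> v \<in> W \<Longrightarrow> nc v \<in> W"
    and r: "N - 1 \<in> W" and u: "u < N"
  shows "u \<in> W"
proof -
  have "\<forall>v<N. v \<in> W \<longrightarrow> sd v \<in> W \<and> nc v \<in> W" using W by simp
  note G = orbit_gap[OF this]
  have l: "lo < N" "hi < N" using lo hi S_less by auto
  have c0: "c (N - 1) = 0" "c 0 = N - 1" using N by (auto simp: cn_def)
  then have "nc (N - 1) = 0" using nc_simps(6) ends_notS by simp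
  then have z: "0 \<in> W" using W(2)[of "N - 1"] r N by simp
  have lpos: "0 < lo" using S_pos[OF lo(1)] by simp
  have below: "v \<in> W" if "v < lo" for v
  proof (rule G[of 0 "lo - 1" 0 v])
    show "\<forall>w. 0 \<le> w \<and> w \<le> lo - 1 \<longrightarrow> w \<notin> S" using lo(3) lpos by fastforce
  qed (use that z l lpos in auto)
  have above: "v \<in> W" if "hi < v" "v < N" for v
  proof (rule G[of "Suc hi" "N - 1" "N - 1" v])
    show "\<forall>w. Suc hi \<le> w \<and> w \<le> N - 1 \<longrightarrow> w \<notin> S" using hi(3) by fastforce
  qed (use that r in auto)
  have f0: "c lo = lo - 1" "lo - 1 < lo" using lo(2) S_pos[OF lo(1)] by (auto simp: cn_def)
  have "c lo \<notin> S" using lo(3)[of "c lo"] f0 by auto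
  then have "nc (c lo) = c piv"
    using nc_simps(4)[of "c lo"] c_c[OF l(1)] lo by simp
  then have k: "c piv \<in> W" using W(2)[of "c lo"] below[of "c lo"] f0 l by auto
  \<comment> \<open>The first and last flag of a longer content are connected through its interior,
    and for the content from \<open>hi\<close> to \<open>lo\<close> through the root corner.\<close>
  have ends: "c (th x) \<in> W \<longleftrightarrow> c x \<in> W" if x: "x \<in> S" "even x" "c x \<notin> S" for x
  proof (cases "x = lo")
    case True
    have "c hi = Suc hi" "Suc hi < N" using hi(2) S_pos[OF hi(1)] by (auto simp: cn_def)
    then show ?thesis using True link_lo below[of "c lo"] above[of "c hi"] f0 by auto
  next
    case False
    note t = link_even[OF x(1,2) False]
    have "th x \<noteq> hi" using t(3) hi(3)[OF x(1)] by auto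
    have e: "c x = x - 1" "c (th x) = Suc (th x)"
      using x t S_pos[OF x(1)] S_pos[OF t(1)] by (auto simp: cn_def)
    have ns: "\<forall>v. Suc (th x) \<le> v \<and> v \<le> x - 1 \<longrightarrow> v \<notin> S" using t(3,4) by fastforce
    have "th x \<noteq> x - 1" using t(1) x(3) e(1) by metis
    then have le: "Suc (th x) \<le> x - 1" using t(3) by linarith
    have xN: "x - 1 < N" using S_less[OF x(1)] by simp
    show ?thesis unfolding e using G[OF ns xN] le by blast
  qed
  \<comment> \<open>From one end of a single corner the way to the other end now leads through the
    content inserted there.\<close>
  have th: "th v \<in> W" if v: "v \<in> S" "v \<in> W" for v
  proof (cases "c v \<in> S")
    case False
    then show ?thesis using nc_simps(1)[OF v(1) False] W(2)[OF S_less[OF v(1)] v(2)] by simp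
  next
    case True
    have vN: "v < N" using v S_less by simp
    have t: "th v = c v" using link_through[OF v(1) True] .
    show ?thesis
    proof (cases "even v")
      case ev: True
      have av: "a v \<in> S" "even (a v)" "c (a v) \<notin> S" using a_S[OF vN] S_parity through_iff v True ev by auto
      have "nc v = c (th (a v))" using nc_simps(2)[OF v(1) True ev] .
      then have "c (th (a v)) \<in> W" using W(2)[OF vN v(2)] by simp
      then have f: "c (a v) \<in> W" using ends[OF av] by simp
      have aN: "a v < N" using A(1)[OF vN] .
      have "nc (c (a v)) = c v"
        using nc_simps(4)[of "c (a v)"] av c_c[OF aN] A(3)[OF vN] by simp
      then show ?thesis using W(2)[OF c_less[OF aN] f] t by simp
    next
      case od: False
      let ?t = "c v"
      have tt: "?t < N" "even ?t" "c ?t = v" using c_less vN c_even[OF vN] od c_c[OF vN] by auto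
      have at: "a ?t \<in> S" "even (a ?t)" "c (a ?t) \<notin> S" "a (a ?t) = ?t"
        using a_S[OF tt(1)] S_parity[OF True] through_iff[OF True] True tt A(3)[OF tt(1)] v(1) by auto
      have "nc v = c (a ?t)" using nc_simps(3)[OF v(1) True od] .
      then have "c (a ?t) \<in> W" using W(2)[OF vN v(2)] by simp
      then have g: "c (th (a ?t)) \<in> W" using ends[OF at(1-3)] by simp
      have z: "th (a ?t) \<in> S" "odd (th (a ?t))" "c (th (a ?t)) \<notin> S" "th (th (a ?t)) = a ?t"
        using link_S[OF at(1)] at link_nonthrough[OF at(1,3)] link_link[OF at(1)] by auto
      have "nc (c (th (a ?t))) = ?t"
        using nc_simps(5)[of "c (th (a ?t))"] z c_c[OF S_less[OF z(1)]] at by simp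
      then show ?thesis using W(2)[OF c_less[OF S_less[OF z(1)]] g] t by simp
    qed
  qed
  have up: "u \<in> W \<Longrightarrow> u \<in> S \<Longrightarrow> v \<in> S \<Longrightarrow> u \<le> v \<Longrightarrow> v \<in> W" for u v
  proof (induction v rule: less_induct)
    case (less v)
    show ?case
    proof (cases "u = v")
      case False
      then have uv: "u < v" using less.prems by simp
      show ?thesis
      proof (cases "even v")
        case True
        have "v \<noteq> lo" using lo(3)[OF less.prems(2)] uv by auto
        note t = link_even[OF less.prems(3) True this]
        have "u \<le> th v" using t(4)[OF less.prems(2)] uv by auto
        then have "th v \<in> W" using less.IH[OF t(3)] less.prems t by simp
        then show ?thesis using th[OF t(1)] link_link[OF less.prems(3)] by simp
      next
        case False
        then have s: "sd v = v - 1" "v - 1 < v" using uv by (auto simp: sd_def)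
        then have "v - 1 \<in> S" using sd_S[of v] less.prems by simp
        then have "v - 1 \<in> W" using less.IH[OF s(2)] less.prems uv by simp
        then have "sd (v - 1) \<in> W" using W(1) S_less \<open>v - 1 \<in> S\<close> by simp
        then show ?thesis using s(1) by (metis sd_sd)
      qed
    qed (use less in simp)
  qed
  have "hi \<in> W" using up[OF k piv(4) hi(1)] hi(3) piv(4) by simp
  then have "lo \<in> W" using th[OF hi(1)] link_hi by simp
  then have SW: "v \<in> W" if "v \<in> S" for v using up lo that by simp
  show ?thesis
  proof (cases "u \<in> S \<or> u < lo \<or> hi < u")
    case True
    then show ?thesis using SW below above u by auto
  next
    case False
    let ?T = "{z \<in> S. z < u}"
    \<comment> \<open>The remaining flags are interior to a content between consecutive flags
      \<open>z\<close> and \<open>th z\<close> of \<open>S\<close>. The last flag of that content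
      has a flag of \<open>S\<close> as its new corner neighbour.\<close>
    define z where "z = Max ?T"
    have "lo \<noteq> u" using lo(1) False by auto
    then have T: "finite ?T" "?T \<noteq> {}" using lo(1) False S_fin by auto
    have z: "z \<in> S" "z < u" "\<And>w. w \<in> S \<Longrightarrow> w < u \<Longrightarrow> w \<le> z"
      using Max_in[OF T] Max_ge[OF T(1)] unfolding z_def by auto
    have zo: "odd z"
    proof
      assume "even z"
      then have "sd z = Suc z" by (simp add: sd_def)
      then have "Suc z \<in> S" using sd_S[of z] z by simp
      then have "Suc z \<noteq> u" using False by auto
      then show False using z(3)[OF \<open>Suc z \<in> S\<close>] z(2) by simp
    qed
    have "z \<noteq> hi" using False z by auto
    note t = link_odd[OF z(1) zo this]
    have ut: "u < th z" using z(3)[OF t(1)] t(1,3) False by (metis leD linorder_neqE_nat)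
    have c1: "c (th z) = th z - 1" using t S_pos[OF t(1)] by (auto simp: cn_def)
    have ns: "\<forall>v. u \<le> v \<and> v \<le> th z - 1 \<longrightarrow> v \<notin> S" using t(4) z(2) ut by fastforce
    have f: "c (th z) \<notin> S" using ns ut c1 by simp
    have thN: "th z < N" using S_less t by simp
    have "nc (c (th z)) \<in> S" using nc_facts(6)[OF c_less[OF thN] f] c_c[OF thN] t by simp
    then have "nc (nc (c (th z))) \<in> W" using SW W(2) S_less by simp
    then have "c (th z) \<in> W" using nc_facts(2)[OF c_less[OF thN]] by simp
    then show ?thesis using G[OF ns, of "th z - 1" u] c1 ut thN by simp
  qed
qed

lemma swapped_map_rooted: "is_rooted_map (swapped_map N a)" "unicellular (swapped_map N a)"
proof -
  have adj: "adj (swapped_map N a) i x \<in> flags (swapped_map N a) \<and> adj (swapped_map N a) i x \<noteq> x \<and>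
      adj (swapped_map N a) i (adj (swapped_map N a) i x) = x"
    if "x \<in> flags (swapped_map N a)" "i \<in> {0, 1, 2}" for x i
    using that A nc_facts(1-3) sd_less[OF N(1)] by auto
  have orb: "{..<N} \<subseteq> orbit (swapped_map N a) {0, 1} (N - 1)"
  proof
    fix u assume "u \<in> {..<N}"
    then have u: "u < N" by simp
    show "u \<in> orbit (swapped_map N a) {0, 1} (N - 1)"
    proof (rule orbit_all[OF _ _ orbit_refl u])
      fix v assume v: "v < N" "v \<in> orbit (swapped_map N a) {0, 1} (N - 1)"
      show "sd v \<in> orbit (swapped_map N a) {0, 1} (N - 1)"
        using orbit_step[OF v(2), of 0] v(1) by simp
      show "nc v \<in> orbit (swapped_map N a) {0, 1} (N - 1)"
        using orbit_step[OF v(2), of 1] v(1) by simp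
    qed
  qed
  have 1: "cells (swapped_map N a) {0, 1} = {flags (swapped_map N a)}"
    using adj orb N by (intro cells_singleton[where r = "N - 1"]) auto
  have "{..<N} \<subseteq> orbit (swapped_map N a) {0, 1, 2} (N - 1)"
    using orb orbit_mono[of "{0, 1}" "{0, 1, 2}" "swapped_map N a" "N - 1"] by auto
  then have 2: "cells (swapped_map N a) {0, 1, 2} = {flags (swapped_map N a)}"
    using adj N by (intro cells_singleton[where r = "N - 1"]) auto
  have "\<forall>x<N. sd (a x) = a (sd x) \<and> sd (a x) \<noteq> x" using A by (metis sd_sd)
  then show "is_rooted_map (swapped_map N a)"
    unfolding is_rooted_map_def using adj 2 N by auto
  show "unicellular (swapped_map N a)" using 1 by (simp add: unicellular_def)
qed

text \<open>Indexing by the odd flag of a single-corner content suits the exchange, which makes the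
  longer contents take over this role.\<close>

lemma through_sum_eq:
  "through_sum N a = (\<Sum>z\<in>{z \<in> S. odd z \<and> c z \<in> S}. of_bool (z < a z) - of_bool (c z < a (c z)))"
proof -
  let ?Z = "{z \<in> S. odd z \<and> c z \<in> S}"
  let ?X = "{x \<in> inner_evens N. even (a x) \<and> odd (a (x - 1))}"
  have X: "even x" "0 < x" "x < N" "even (a x)" "odd (a (x - 1))" "c x = x - 1" "c (x - 1) = x"
    "x \<in> S" "x - 1 \<in> S" if "x \<in> ?X" for x
    using that by (auto simp: inner_evens_def cn_def same_flags_def)
  have Z: "c z = Suc z" "c z \<in> ?X" "c (c z) = z" if "z \<in> ?Z" for z
  proof -
    have z: "z \<in> S" "odd z" "c z \<in> S" "z < N - 1" using that S_pos by auto
    then show e: "c z = Suc z" by (simp add: cn_def)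
    show "c (c z) = z" using c_c S_less z by simp
    show "c z \<in> ?X" using z unfolding e by (auto simp: same_flags_def inner_evens_def)
  qed
  have "through_sum N a = (\<Sum>x\<in>?X. of_bool (x - 1 < a (x - 1)) - of_bool (x < a x))"
    unfolding through_sum_def through_sign_def
    by (rule sum.mono_neutral_cong_right) auto
  also have "\<dots> = (\<Sum>z\<in>?Z. of_bool (z < a z) - of_bool (c z < a (c z)))"
  proof (rule sum.reindex_bij_witness[of _ c c])
    fix x assume "x \<in> ?X"
    note X = X[OF this]
    show "c (c x) = x" "c x \<in> ?Z" using X by simp_all
    show "of_bool (c x < a (c x)) - of_bool (c (c x) < a (c (c x))) =
        (of_bool (x - 1 < a (x - 1)) - of_bool (x < a x) :: int)"
      using X by simp
  next
    fix z assume "z \<in> ?Z"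
    then show "c z \<in> ?X" "c (c z) = z" using Z by blast+
  qed
  finally show ?thesis .
qed

end

section \<open>The gluing obtained by exchanging contents\<close>

declare tour.simps(2) [simp del]

text \<open>The normal form of the exchanged map, chosen together with its walk as isomorphism;
  uniqueness of normal forms makes the choice canonical.\<close>

definition flip :: "nat \<Rightarrow> (nat \<Rightarrow> nat) \<Rightarrow> nat \<Rightarrow> nat" where
  "flip N a = (SOME b. b \<in> gluings N \<and> iso_by (tour (swapped_map N a)) (polygon_map N b) (swapped_map N a))"

context nonorientable_gluing
begin

abbreviation "b \<equiv> flip N a"
abbreviation "p \<equiv> tour (swapped_map N a)"
abbreviation "t \<equiv> inv_into {..<N} p"

lemma flip: "b \<in> gluings N" "iso_by p (polygon_map N b) (swapped_map N a)"
proof -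
  obtain b' where "b' \<in> gluings N" "iso_by p (polygon_map N b') (swapped_map N a)"
    using normal_form_tour[OF swapped_map_rooted, of N] by auto
  then show "b \<in> gluings N" "iso_by p (polygon_map N b) (swapped_map N a)"
    unfolding flip_def by (metis (mono_tags, lifting) someI_ex)+
qed

lemma p_bij: "bij_betw p {..<N} {..<N}"
  using flip(2) by (simp add: iso_by_def)

lemma p_adj:
  assumes "i < N"
  shows "p (sd i) = sd (p i)" "p (c i) = nc (p i)" "p (b i) = a (p i)"
  using flip(2) assms by (auto simp: iso_by_def)

lemma p_less: "i < N \<Longrightarrow> p i < N"
  using p_bij by (auto simp: bij_betw_def)

lemma t_p: "i < N \<Longrightarrow> t (p i) = i"
  using p_bij by (simp add: bij_betw_def)

lemma p_image: "p ` {..<N} = {..<N}"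
  using p_bij by (simp add: bij_betw_def)

lemma p_t: "u < N \<Longrightarrow> p (t u) = u"
  by (rule f_inv_into_f) (simp add: p_image)

lemma t_less: "u < N \<Longrightarrow> t u < N"
  using inv_into_into[of u p "{..<N}"] by (simp add: p_image)

lemma p_0: "p 0 = N - 1" and p_last: "p (N - 1) = 0"
proof -
  show "p 0 = N - 1" by simp
  have "c 0 = N - 1" "c (N - 1) = 0" using N by (auto simp: cn_def)
  then show "p (N - 1) = 0" using p_adj(2)[OF N(2)] nc_simps(6)[of "N - 1"] ends_notS by simp
qed

text \<open>Contents are traversed backwards and sides in \<open>S\<close> forwards: a position has
  the parity of its flag precisely on \<open>S\<close>. Along the walk this follows from the parity
  part of \<open>nc_facts\<close>.\<close>

lemma p_parity: "i < N \<Longrightarrow> even i \<longleftrightarrow> (even (p i) \<longleftrightarrow> p i \<in> S)"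
proof (induction i)
  case 0
  then show ?case using ends_notS N by simp
next
  case (Suc i)
  then have i: "i < N" and IH: "even i \<longleftrightarrow> (even (p i) \<longleftrightarrow> p i \<in> S)" by simp_all
  show ?case
  proof (cases "even i")
    case True
    then have "p (Suc i) = sd (p i)" using p_adj(1)[OF i] by (simp add: sd_def)
    then show ?thesis using True IH sd_S by simp
  next
    case False
    then have "p (Suc i) = nc (p i)" using p_adj(2)[OF i] Suc.prems by (simp add: cn_def)
    then show ?thesis using False IH nc_facts(4)[OF p_less[OF i]] by simp
  qed
qed

lemma t_parity: "u < N \<Longrightarrow> even (t u) \<longleftrightarrow> (even u \<longleftrightarrow> u \<in> S)"
  using p_parity[OF t_less] p_t by simp

lemma t_sd:
  assumes "u < N" "even u \<longleftrightarrow> u \<in> S"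
  shows "t (sd u) = Suc (t u)"
proof -
  have e: "even (t u)" "t u < N" using t_parity[OF assms(1)] t_less[OF assms(1)] assms by simp_all
  then have s: "sd (t u) = Suc (t u)" "sd (t u) < N" using sd_less[OF N(1) e(2)] by (simp_all add: sd_def)
  then have "p (Suc (t u)) = sd u" using p_adj(1)[OF e(2)] p_t[OF assms(1)] by simp
  then show ?thesis using t_p[OF s(2)] s by simp
qed

text \<open>The flag 0 occupies the last position, so it is the one place where the new corner wraps
  around.\<close>

lemma t_nc:
  assumes "u < N" "even u \<longleftrightarrow> u \<notin> S" "u \<noteq> 0"
  shows "t (nc u) = Suc (t u)"
proof -
  have e: "odd (t u)" "t u < N" using t_parity[OF assms(1)] t_less[OF assms(1)] assms by simp_all
  moreover have "t u \<noteq> N - 1" using p_t[OF assms(1)] p_last assms(3) by auto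
  ultimately have s: "c (t u) = Suc (t u)" "Suc (t u) < N" by (auto simp: cn_def)
  then have "p (Suc (t u)) = nc u" using p_adj(2)[OF e(2)] p_t[OF assms(1)] by simp
  then show ?thesis using t_p[OF s(2)] by simp
qed

text \<open>As \<open>a\<close> preserves \<open>S\<close>, the parities of \<open>u\<close> and
  \<open>a u\<close> are both kept or both changed, so the same half-edges are traversed twice in
  one direction.\<close>

lemma flip_same_flags: "i \<in> same_flags N b \<longleftrightarrow> i < N \<and> p i \<in> S"
proof -
  have "even (b i) \<longleftrightarrow> even i \<longleftrightarrow> p i \<in> S" if i: "i < N"
  proof -
    note v = p_less[OF i]
    have "even (b i) \<longleftrightarrow> (even (a (p i)) \<longleftrightarrow> a (p i) \<in> S)"
      using p_parity[OF gluingsD(1)[OF flip(1) i]] p_adj(3)[OF i] by simp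
    then show ?thesis
      using p_parity[OF i] S_parity[of "p i"] notS_parity[OF v] a_S[OF v] by blast
  qed
  then show ?thesis by (auto simp: same_flags_def)
qed

lemma flip_cubic: "b \<in> cubic_gluings N"
proof -
  have inj: "i = j" if "p i = p j" "i < N" "j < N" for i j using t_p that by metis
  note B = gluingsD(1)[OF flip(1)]
  have "p (b 0) = p (N - 1)" using p_adj(3)[OF N(2)] p_0 p_last a_root(2)[OF N a] by simp
  then have "b 0 = N - 1" using inj B[OF N(2)] N by simp
  moreover have "c (b (c (b (c (b i))))) = i" if i: "i < N" for i
  proof (rule inj)
    have l: "b i < N" "c (b i) < N" "b (c (b i)) < N" "c (b (c (b i))) < N" "b (c (b (c (b i)))) < N"
      using i B c_less by simp_all
    show "p (c (b (c (b (c (b i)))))) = p i"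
      using swapped_cubic[OF p_less[OF i]] by (simp only: p_adj i l)
    show "c (b (c (b (c (b i))))) < N" using l c_less by simp
  qed (rule i)
  ultimately show ?thesis using flip(1) by (simp add: cubic_gluings_def)
qed

lemma flip_nonorientable: "\<not> parity_changing N b"
proof -
  obtain u where "u \<in> S" using S_ne by blast
  then have "t u \<in> same_flags N b" using flip_same_flags p_t t_less S_less by simp
  then show ?thesis by (auto simp: same_flags_def parity_changing_def)
qed

text \<open>At a leaf the two flags have opposite parity, so neither is in \<open>S\<close> and the
  corner is untouched; the same reasoning with \<open>nc\<close> shows that no leaf is
  created.\<close>

lemma flip_leaves: "card (leaves N b) = card (leaves N a)"
proof -
  have iff: "a v = nc v \<longleftrightarrow> a v = c v" if v: "v < N" for v
  proof
    assume "a v = c v"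
    then have "v \<notin> S" using c_even[OF v] by (auto simp: same_flags_def)
    then have "c v \<notin> S" using a_S[OF v] \<open>a v = c v\<close> by simp
    then show "a v = nc v" using nc_simps(6)[OF \<open>v \<notin> S\<close>] \<open>a v = c v\<close> by simp
  next
    assume e: "a v = nc v"
    have "v \<notin> S"
    proof
      assume "v \<in> S"
      then have "nc v \<in> S" using a_S[OF v] e by simp
      then show False using nc_facts(4)[OF v] S_parity[OF \<open>v \<in> S\<close>] e \<open>v \<in> S\<close> by simp
    qed
    then have "nc v \<notin> S" using a_S[OF v] e by simp
    then have "c v \<notin> S" using nc_facts(6)[OF v \<open>v \<notin> S\<close>] by simp
    then show "a v = c v" using nc_simps(6)[OF \<open>v \<notin> S\<close>] e by simp
  qed
  have inj: "i = j" if "p i = p j" "i < N" "j < N" for i j using t_p that by metis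
  have lf: "i \<in> leaf_flags N b \<longleftrightarrow> p i \<in> leaf_flags N a" if i: "i < N" for i
  proof -
    have "b i = c i \<longleftrightarrow> p (b i) = p (c i)"
      using inj[OF _ gluingsD(1)[OF flip(1) i] c_less[OF i]] by auto
    also have "\<dots> \<longleftrightarrow> a (p i) = c (p i)" using p_adj[OF i] iff[OF p_less[OF i]] by simp
    finally show ?thesis using i p_less by (simp add: leaf_flags_def)
  qed
  have "leaf_flags N a = p ` leaf_flags N b"
  proof (intro equalityI subsetI)
    fix u assume u: "u \<in> leaf_flags N a"
    then have uN: "u < N" by (simp add: leaf_flags_def)
    then have "t u \<in> leaf_flags N b" using lf[OF t_less[OF uN]] p_t[OF uN] u by simp
    then show "u \<in> p ` leaf_flags N b" using p_t[OF uN] by (metis imageI)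
  next
    fix u assume "u \<in> p ` leaf_flags N b"
    then obtain i where "i \<in> leaf_flags N b" "u = p i" by blast
    then show "u \<in> leaf_flags N a" using lf[of i] by (simp add: leaf_flags_def)
  qed
  moreover have "inj_on p (leaf_flags N b)"
    using inj by (auto simp: inj_on_def leaf_flags_def)
  ultimately have "card (leaf_flags N a) = card (leaf_flags N b)" by (simp add: card_image)
  then show ?thesis using card_leaf_flags[OF N(1)] ag flip(1) by simp
qed

lemma nonorientable_flip: "nonorientable_gluing N b"
  using N flip_cubic flip_nonorientable by unfold_locales

text \<open>The new walk meets the flags of \<open>S\<close> in the old cyclic order, but starting with \<open>piv\<close>, since
  the content with the root has been moved in front of it.\<close>

lemma t_link:
  assumes z: "z \<in> S" "odd z" "z \<noteq> c piv"
  shows "t z < t (th z)"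
proof (cases "c z \<in> S")
  case False
  have "z \<noteq> 0" using z(2) by (intro notI) simp
  then show ?thesis using t_nc[OF S_less[OF z(1)]] z nc_simps(1)[OF z(1) False] by simp
next
  case True
  have zN: "z < N" using z S_less by simp
  let ?x = "c z"
  have x: "?x < N" "even ?x" "c ?x = z" using c_less zN c_even[OF zN] z c_c[OF zN] by auto
  define y where "y = a ?x"
  have y: "y \<in> S" "even y" "c y \<notin> S" "a y = ?x" "y < N"
    using a_S[OF x(1)] S_parity[OF True] through_iff[OF True] True x A(3)[OF x(1)] A(1)[OF x(1)] z(1)
    unfolding y_def by auto
  have "y \<noteq> lo" using y(4) z(3) x(3) by auto
  note l = link_even[OF y(1,2) this]
  define g f where "g = Suc (th y)" "f = y - 1"
  have hN: "th y \<noteq> hi" using l(3) hi(3)[OF y(1)] by auto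
  have c1: "c y = f" "c (th y) = g"
    using y l S_pos[OF y(1)] S_pos[OF l(1)] unfolding g_f_def by (auto simp: cn_def)
  have "th y \<noteq> f" using l(1) y(3) c1 by auto
  then have gf: "g \<le> f" "f < N" using l(3) y(5) unfolding g_f_def by linarith+
  have ns: "v \<notin> S" if "g \<le> v" "v \<le> f" for v using l(4)[of v] that l(3) y unfolding g_f_def by auto
  have ze: "nc z = f" using nc_simps(3)[OF z(1) True z(2)] c1 by (simp add: y_def)
  have "z \<noteq> 0" using z(2) by (intro notI) simp
  then have tf: "t f = Suc (t z)" using t_nc[OF zN] z(1,2) ze by simp
  \<comment> \<open>The inserted content is run through backwards from its last flag
    \<open>f\<close> to its first flag \<open>g\<close>, one position per flag.\<close>
  have walk: "g + d \<le> f \<Longrightarrow> t f \<le> t (f - d)" for d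
  proof (induction d)
    case (Suc d)
    define v where "v = f - d"
    have v: "g < v" "v \<le> f" "f - Suc d = v - 1" "v < N" using Suc.prems gf unfolding v_def by auto
    have vn: "v \<notin> S" "v - 1 \<notin> S" using ns v by auto
    have "t (v - 1) = Suc (t v)"
    proof (cases "even v")
      case False
      then have "sd v = v - 1" by (simp add: sd_def)
      then show ?thesis using t_sd[OF v(4)] False vn by simp
    next
      case True
      then have cv: "c v = v - 1" "v \<noteq> 0" using v(1) by (simp_all add: cn_def)
      then have "nc v = v - 1" using nc_simps(6)[OF vn(1)] vn(2) by simp
      then show ?thesis using t_nc[OF v(4) _ cv(2)] True vn(1) by simp
    qed
    moreover have "t f \<le> t v" using Suc.IH Suc.prems unfolding v_def by simp
    ultimately have "t f \<le> t (v - 1)" by simp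
    then show ?case unfolding v(3) .
  qed simp
  have "t f \<le> t g" using walk[of "f - g"] gf by simp
  moreover have "t ?x = Suc (t g)"
  proof -
    have gn: "g \<notin> S" "even g" using ns gf l(2) unfolding g_f_def by auto
    have "c g = th y" using c1 c_c[OF S_less[OF l(1)]] by auto
    then have "nc g = ?x" using nc_simps(5)[of g] gn l link_link[OF y(1)] y by simp
    then show ?thesis using t_nc[of g] gn gf unfolding g_f_def by simp
  qed
  ultimately show ?thesis using tf link_through[OF z(1) True] by simp
qed

text \<open>Consecutive flags of \<open>S\<close> are joined by a side or by a content, and either
  increases the position; the only exception is the content ending with \<open>piv\<close>, at which
  the new numbering starts.\<close>

lemma t_less_same_side:
  "u \<in> S \<Longrightarrow> v \<in> S \<Longrightarrow> u < v \<Longrightarrow> u < piv \<longleftrightarrow> v < piv \<Longrightarrow> t u < t v"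
proof (induction v rule: less_induct)
  case (less v)
  show ?case
  proof (cases "even v")
    case True
    have "v \<noteq> lo" using lo(3)[OF less.prems(1)] less.prems(3) by auto
    note l = link_even[OF less.prems(2) True this]
    have ul: "u \<le> th v" using l(4)[OF less.prems(1)] less.prems(3) by auto
    have tv: "th (th v) = v" using link_link[OF less.prems(2)] .
    have "th v \<noteq> c piv"
    proof
      assume e: "th v = c piv"
      then have "v = piv" using tv link_link[OF piv(1)] piv(6) by simp
      then show False using less.prems by simp
    qed
    then have s: "t (th v) < t v" using t_link[OF l(1,2)] tv by simp
    show ?thesis
    proof (cases "u = th v")
      case False
      then have "u < th v" using ul by simp
      then have "t u < t (th v)" using less.IH[OF l(3) less.prems(1) l(1)] less.prems(3,4) l(3) by linarith
      then show ?thesis using s by simp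
    qed (use s in simp)
  next
    case False
    then have e: "sd v = v - 1" "v - 1 < v" "even (v - 1)" "sd (v - 1) = v"
      using less.prems(3) by (auto simp: sd_def)
    have vS: "v - 1 \<in> S" using sd_S[of v] e less.prems(2) by simp
    have s: "t v = Suc (t (v - 1))" using t_sd[OF S_less[OF vS]] vS e by simp
    show ?thesis
    proof (cases "u = v - 1")
      case False
      then have "u < v - 1" using less.prems(3) by simp
      then have "t u < t (v - 1)" using less.IH[OF e(2) less.prems(1) vS] less.prems(4) e(2) by linarith
      then show ?thesis using s by simp
    qed (use s in simp)
  qed
qed

text \<open>The content from \<open>hi\<close> to \<open>lo\<close>, formerly cut by the root, is an
  ordinary one on the new walk and puts \<open>hi\<close> before \<open>lo\<close>.\<close>

lemma t_less_other_side:
  assumes "u \<in> S" "v \<in> S" "u < piv" "piv \<le> v"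
  shows "t v < t u"
proof -
  have ph: "piv < hi" using hi(3)[OF piv(1)] hi(2) piv(2) by (metis le_neq_implies_less)
  have "t v \<le> t hi"
    using t_less_same_side[OF assms(2) hi(1)] hi(3)[OF assms(2)] assms(4) ph by (cases "v = hi") auto
  also have "hi \<noteq> c piv" using ph piv(5) by simp
  then have "t hi < t lo" using t_link[OF hi(1,2)] link_hi by simp
  also have "t lo \<le> t u"
    using t_less_same_side[OF lo(1) assms(1)] lo(3)[OF assms(1)] piv(3) assms(3) by (cases "u = lo") auto
  finally show ?thesis .
qed

lemma t_less_iff:
  assumes "u \<in> S" "v \<in> S" "u \<noteq> v"
  shows "t u < t v \<longleftrightarrow> (if u < piv \<longleftrightarrow> v < piv then u < v else v < piv)"
proof -
  consider "u < piv \<longleftrightarrow> v < piv" "u < v" | "u < piv \<longleftrightarrow> v < piv" "v < u" | "u < piv" "piv \<le> v" | "v < piv" "piv \<le> u"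
    using assms(3) by linarith
  then show ?thesis
  proof cases
    case 1 then show ?thesis using t_less_same_side[OF assms(1,2)] by simp
  next
    case 2 then show ?thesis using t_less_same_side[OF assms(2,1)] by fastforce
  next
    case 3 then show ?thesis using t_less_other_side[OF assms(1,2)] by fastforce
  next
    case 4 then show ?thesis using t_less_other_side[OF assms(2,1)] by fastforce
  qed
qed

text \<open>On \<open>S\<close> the new order is a rotation of the old one, so cyclic successors
  agree; the wrap-around has moved from \<open>hi\<close>, \<open>lo\<close> to
  \<open>c piv\<close>, \<open>piv\<close>.\<close>

lemma flip_link_odd:
  assumes z: "z \<in> S" "odd z"
  shows "link (same_flags N b) (t z) = t (th z)"
proof -
  interpret B: nonorientable_gluing N b by (rule nonorientable_flip)
  have im: "same_flags N b = t ` S"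
    using flip_same_flags t_less p_t t_p S_less by (auto simp: image_iff) metis
  have tz: "t z \<in> same_flags N b" "odd (t z)" using z im t_parity[OF S_less[OF z(1)]] by auto
  have x: "th z \<in> S" using link_S z by simp
  have tinj: "t u = t v \<longleftrightarrow> u = v" if "u \<in> S" "v \<in> S" for u v using p_t S_less that by metis
  show ?thesis
  proof (cases "z = c piv")
    case True
    have e: "z < piv" "th z = piv" "z = piv - 1"
      using True piv link_link[OF piv(1)] by auto
    have "t w \<le> t z" if w: "w \<in> S" for w
    proof (cases "w = z")
      case False
      have "t w < t z" using t_less_iff[OF w z(1) False] e False by auto
      then show ?thesis by simp
    qed simp
    then have "Max (same_flags N b) = t z"
      using tz im B.S_fin by (intro Max_eqI) auto
    moreover have "t piv \<le> t w" if w: "w \<in> S" for w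
    proof (cases "w = piv")
      case False
      have "t piv < t w" using t_less_iff[OF piv(1) w] False by auto
      then show ?thesis by simp
    qed simp
    then have "Min (same_flags N b) = t piv"
      using im piv(1) B.S_fin by (intro Min_eqI) auto
    ultimately show ?thesis using tz e by (simp add: link_def)
  next
    case False
    have lt: "t z < t (th z)" using t_link[OF z False] .
    have gap: "t w \<le> t z \<or> t (th z) \<le> t w" if w: "w \<in> S" for w
    proof (cases "w = z \<or> w = th z")
      case nw: False
      show ?thesis
      proof (cases "z = hi")
        case True
        have ph: "piv \<le> hi" using hi(3)[OF piv(1)] .
        have "w < z" "lo < w" using hi(3)[OF w] lo(3)[OF w] nw True link_hi by auto
        then show ?thesis
          using t_less_same_side[OF lo(1) w] t_less_same_side[OF w hi(1)] True link_hi piv(3) ph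
          by (cases "w < piv") simp_all
      next
        case False2: False
        note l = link_odd[OF z False2]
        have "th z \<noteq> piv" using False link_link[OF z(1)] piv(6) by auto
        then have "z < piv \<longleftrightarrow> th z < piv" using l(3) l(4)[OF piv(1)] piv(2) z(2) by auto
        then show ?thesis
          using t_less_iff[OF w z(1)] t_less_iff[OF l(1) w] nw l(4)[OF w] l(3) by (auto split: if_splits)
      qed
    qed auto
    have ne: "t z \<noteq> Max (same_flags N b)"
    proof
      assume "t z = Max (same_flags N b)"
      then have "t (th z) \<le> t z" using B.hi(3)[of "t (th z)"] x im by auto
      then show False using lt by simp
    qed
    have "Min {w \<in> same_flags N b. t z < w} = t (th z)"
    proof (rule Min_eqI)
      show "finite {w \<in> same_flags N b. t z < w}" using B.S_fin by simp
      show "t (th z) \<in> {w \<in> same_flags N b. t z < w}" using x im lt by auto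
      fix y assume "y \<in> {w \<in> same_flags N b. t z < w}"
      then obtain w where "w \<in> S" "y = t w" "t z < t w" using im by auto
      then show "t (th z) \<le> y" using gap[of w] by auto
    qed
    then show ?thesis using tz ne by (simp add: link_def)
  qed
qed

lemma flip_link:
  assumes i: "i \<in> same_flags N b"
  shows "p (link (same_flags N b) i) = th (p i)"
proof -
  interpret B: nonorientable_gluing N b by (rule nonorientable_flip)
  have pi: "i < N" "p i \<in> S" using i flip_same_flags by auto
  have par: "even i \<longleftrightarrow> even (p i)" using p_parity[OF pi(1)] pi(2) by simp
  have thS: "th (p i) \<in> S" "even (th (p i)) \<longleftrightarrow> odd (p i)" using link_S[OF pi(2)] by auto
  have "link (same_flags N b) i = t (th (p i))"
  proof (cases "even i")
    case False
    then show ?thesis using flip_link_odd[OF pi(2)] par t_p[OF pi(1)] by simp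
  next
    case True
    have tS: "t (th (p i)) \<in> same_flags N b"
      using flip_same_flags t_less p_t S_less thS by simp
    have "link (same_flags N b) (t (th (p i))) = t (p i)"
      using flip_link_odd[OF thS(1)] thS par True link_link[OF pi(2)] by simp
    also have "\<dots> = i" using t_p[OF pi(1)] .
    finally show ?thesis using B.link_link[OF tS] by metis
  qed
  then show ?thesis using p_t S_less thS by simp
qed

text \<open>The walk \<open>p\<close> transports every ingredient of \<open>swap_corners\<close>,
  with \<open>nc\<close> in the role of the corners, and exchanging \<open>nc\<close> again restores
  the old corners by the last part of \<open>nc_facts\<close>.\<close>

lemma flip_swapped:
  assumes i: "i < N"
  shows "p (swapped N b i) = c (p i)"
proof -
  interpret B: nonorientable_gluing N b by (rule nonorientable_flip)
  let ?S = "same_flags N b"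
  have iS: "j \<in> ?S \<longleftrightarrow> p j \<in> S" if "j < N" for j using flip_same_flags that by simp
  have ev: "even j \<longleftrightarrow> even (p j)" if "j \<in> ?S" for j
    using p_parity[of j] that flip_same_flags by auto
  have ci: "c i < N" "p (c i) = nc (p i)" using c_less i p_adj(2) by auto
  have bl: "b j < N" "p (b j) = a (p j)" if "j < N" for j using gluingsD(1)[OF flip(1) that] p_adj(3)[OF that] by auto
  have cl: "c j < N" "p (c j) = nc (p j)" if "j < N" for j using c_less that p_adj(2) by auto
  have ll: "link ?S j < N" "p (link ?S j) = th (p j)" if "j \<in> ?S" for j
    using B.S_less B.link_S[OF that] flip_link[OF that] by auto
  have bS: "b j \<in> ?S" if "j \<in> ?S" for j using B.a_S[OF B.S_less[OF that]] that by simp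
  have "p (swapped N b i) = swap_corners nc S th a (p i)"
  proof (cases "i \<in> ?S")
    case True
    then have pS: "p i \<in> S" using iS i by simp
    show ?thesis
      using True pS iS[OF ci(1)] ci ev[OF True] ll bl[OF i] cl bS[OF True] ll[OF True] bl[OF ci(1)]
      by (auto simp: swapped_def swap_corners_def)
  next
    case False
    then have pS: "p i \<notin> S" using iS i by simp
    show ?thesis
    proof (cases "c i \<in> ?S")
      case cS: True
      then have "nc (p i) \<in> S" using iS ci by metis
      then show ?thesis
        using False pS cS ci ev[OF cS] ll[OF cS] bl cl by (auto simp: swapped_def swap_corners_def)
    next
      case cS: False
      then have "nc (p i) \<notin> S" using iS ci by metis
      then show ?thesis using False pS cS ci by (simp add: swapped_def swap_corners_def)
    qed
  qed
  also have "\<dots> = c (p i)" using nc_facts(7)[OF p_less[OF i]] .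
  finally show ?thesis .
qed

text \<open>The same walk \<open>p\<close> identifies the map exchanged twice with the original
  polygon, taking the start \<open>N - 1\<close> to 0, and normal forms are unique.\<close>

lemma flip_flip: "flip N b = a"
proof -
  interpret B: nonorientable_gluing N b by (rule nonorientable_flip)
  have "iso_by p (swapped_map N b) (polygon_map N a)"
    unfolding iso_by_def using p_bij flip_swapped p_adj p_last N by auto
  then have "map_isomorphic (polygon_map N (flip N b)) (polygon_map N a)"
    using iso_by_trans[OF B.flip(2)] by (auto simp: map_isomorphic_iff)
  then show ?thesis
    using polygon_map_unique[OF N(1) B.flip(1) ag] by simp
qed

text \<open>Comparisons before and after the exchange complement each other, except for pairs
  \<open>u\<close>, \<open>a u\<close> on different sides of \<open>piv\<close>. These exceptions
  are differences of \<open>L\<close> and telescope along the contents. The content ending with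
  \<open>piv\<close> and the one from \<open>hi\<close> to \<open>lo\<close> each leave 1.\<close>

lemma flip_through_sum: "through_sum N a + through_sum N b = 2"
proof -
  interpret B: nonorientable_gluing N b by (rule nonorientable_flip)
  define Zt Zn where Z: "Zt = {z \<in> S. odd z \<and> c z \<in> S}" "Zn = {z \<in> S. odd z \<and> c z \<notin> S}"
  define L :: "nat \<Rightarrow> int" where "L u = of_bool (u < piv)" for u
  have fin: "finite Zt" "finite Zn" unfolding Z using S_fin by auto
  have Zn: "z < N" "z \<in> S" "odd z" "c z \<notin> S" "th z \<in> S" "even (th z)" "c (th z) \<notin> S" "th (th z) = z"
    "a z \<in> S" "odd (a z)" "c (a z) \<in> S" "a (a z) = z"
    "a (th z) \<in> S" "even (a (th z))" "c (a (th z)) \<in> S" "a (a (th z)) = th z" "th z < N"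
    if "z \<in> Zn" for z
  proof -
    show z: "z < N" "z \<in> S" "odd z" "c z \<notin> S" using that S_less by (auto simp: Z)
    show x: "th z \<in> S" "even (th z)" "c (th z) \<notin> S" "th (th z) = z" "th z < N"
      using link_S[OF z(2)] link_nonthrough[OF z(2,4)] link_link[OF z(2)] S_less[of "th z"] z(3) by simp_all
    show "a z \<in> S" "odd (a z)" "c (a z) \<in> S" "a (a z) = z"
      using a_S[OF z(1)] S_parity[OF z(2)] through_iff[OF z(2)] A(3)[OF z(1)] z by simp_all
    show "a (th z) \<in> S" "even (a (th z))" "c (a (th z)) \<in> S" "a (a (th z)) = th z"
      using a_S[OF x(5)] S_parity[OF x(1)] through_iff[OF x(1)] A(3)[OF x(5)] x by simp_all
  qed
  have Zt: "z < N" "z \<in> S" "odd z" "c z \<in> S" "even (c z)" "c (c z) = z" "th z = c z"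
    "a z \<in> Zn" "a (a z) = z" "th (a (c z)) \<in> Zn" "th (th (a (c z))) = a (c z)" "a (a (c z)) = c z" if "z \<in> Zt" for z
  proof -
    show z: "z < N" "z \<in> S" "odd z" "c z \<in> S" using that S_less by (auto simp: Z)
    show x: "even (c z)" "c (c z) = z" "th z = c z"
      using c_even[OF z(1)] c_c[OF z(1)] link_through[OF z(2,4)] z by simp_all
    have cN: "c z < N" using c_less z by simp
    show "a z \<in> Zn" "a (a z) = z"
      using a_S[OF z(1)] S_parity[OF z(2)] through_iff[OF z(2)] A(3)[OF z(1)] z by (auto simp: Z)
    have y: "a (c z) \<in> S" "even (a (c z))" "c (a (c z)) \<notin> S" "a (a (c z)) = c z"
      using a_S[OF cN] S_parity[OF z(4)] through_iff[OF z(4)] A(3)[OF cN] z x by auto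
    then show "th (a (c z)) \<in> Zn" "th (th (a (c z))) = a (c z)" "a (a (c z)) = c z"
      using link_S[OF y(1)] link_nonthrough[OF y(1,3)] link_link[OF y(1)] by (auto simp: Z)
  qed
  \<comment> \<open>A half-edge of \<open>S\<close> has one flag at a single corner and one at a
    longer content, and \<open>a\<close> keeps parity on \<open>S\<close>, so \<open>a\<close>
    exchanges the odd flags of the two kinds.\<close>
  have re1: "(\<Sum>z\<in>Zt. h z) = (\<Sum>z\<in>Zn. h (a z))" for h :: "nat \<Rightarrow> int"
  proof (rule sum.reindex_bij_witness[of _ a a])
    fix z assume z: "z \<in> Zt"
    show "a (a z) = z" "a z \<in> Zn" "h (a (a z)) = h z" using Zt(8,9)[OF z] by simp_all
  next
    fix z assume z: "z \<in> Zn"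
    show "a (a z) = z" "a z \<in> Zt" using Zn[OF z] by (simp_all add: Z)
  qed
  \<comment> \<open>The same exchange for even flags, each of them named by the odd flag at the
    other end of its content.\<close>
  have re2: "(\<Sum>z\<in>Zt. h (c z)) = (\<Sum>z\<in>Zn. h (a (th z)))" for h :: "nat \<Rightarrow> int"
  proof (rule sum.reindex_bij_witness[of _ "\<lambda>z. c (a (th z))" "\<lambda>z. th (a (c z))"])
    fix z assume z: "z \<in> Zn"
    have "c (c (a (th z))) = a (th z)" using c_c S_less Zn[OF z] by simp
    moreover have "odd (c (a (th z)))" using c_even S_less Zn[OF z] by simp
    ultimately show "c (a (th z)) \<in> Zt" "th (a (c (c (a (th z))))) = z" using Zn[OF z] by (auto simp: Z)
  next
    fix z assume z: "z \<in> Zt"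
    show "th (a (c z)) \<in> Zn" "c (a (th (th (a (c z))))) = z" "h (a (th (th (a (c z))))) = h (c z)"
      using Zt[OF z] by simp_all
  qed
  have "through_sum N a = (\<Sum>z\<in>Zt. of_bool (z < a z)) - (\<Sum>z\<in>Zt. of_bool (c z < a (c z)))"
    unfolding through_sum_eq Z[symmetric] by (simp add: sum_subtractf)
  also have "\<dots> = (\<Sum>z\<in>Zn. of_bool (a z < z)) - (\<Sum>z\<in>Zn. of_bool (a (th z) < th z))"
  proof -
    have "(\<Sum>z\<in>Zt. of_bool (z < a z)) = (\<Sum>z\<in>Zn. of_bool (a z < a (a z)) :: int)" by (rule re1)
    moreover have "(\<Sum>z\<in>Zt. of_bool (c z < a (c z))) = (\<Sum>z\<in>Zn. of_bool (a (th z) < a (a (th z))) :: int)"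
      by (rule re2)
    ultimately show ?thesis using Zn(12,16) by simp
  qed
  finally have Sa: "through_sum N a = \<dots>" .
  have "through_sum N b = (\<Sum>z\<in>Zn. of_bool (t z < t (a z)) - of_bool (t (th z) < t (a (th z))))"
    unfolding B.through_sum_eq
  proof (rule sum.reindex_bij_witness[of _ t p])
    have tb: "b (t u) = t (a u)" if "u < N" for u
      using p_adj(3)[OF t_less[OF that]] p_t[OF that] t_p[OF gluingsD(1)[OF flip(1) t_less[OF that]]] by simp
    have tc: "c (t u) = t (nc u)" if "u < N" for u
      using p_adj(2)[OF t_less[OF that]] p_t[OF that] t_p[OF c_less[OF t_less[OF that]]] by simp
    have sf: "t u \<in> same_flags N b \<longleftrightarrow> u \<in> S" if "u < N" for u
      using flip_same_flags t_less p_t that by simp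
    {
      fix i assume "i \<in> {z \<in> same_flags N b. odd z \<and> c z \<in> same_flags N b}"
      then have i: "i \<in> same_flags N b" "odd i" "c i \<in> same_flags N b" by auto
      have iN: "i < N" and pS: "p i \<in> S" using i flip_same_flags by auto
      define z where "z = p i"
      have z: "z < N" "z \<in> S" using p_less[OF iN] pS by (simp_all add: z_def)
      have tz: "t z = i" using t_p[OF iN] by (simp add: z_def)
      have ci: "c i = t (nc z)" using tc[OF z(1)] unfolding tz .
      have "nc z \<in> S" using i(3) sf[OF nc_facts(1)[OF z(1)]] unfolding ci by simp
      then have cz: "c z \<notin> S" using nc_facts(5)[OF z] by simp
      have "odd z" using i(2) t_parity[OF z(1)] z(2) unfolding tz by simp
      then have zZ: "z \<in> Zn" using z cz by (simp add: Z)
      have n: "nc z = th z" using nc_simps(1)[OF z(2) cz] .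
      have "th z < N" using S_less link_S[OF z(2)] by simp
      note tb' = tb[OF this] tb[OF z(1)]
      show "t (p i) = i" "p i \<in> Zn" using tz zZ by (simp_all only: z_def)
      have "of_bool (t z < t (a z)) - of_bool (t (th z) < t (a (th z))) =
          (of_bool (i < b i) - of_bool (c i < b (c i)) :: int)"
        using tb' unfolding ci n tz by simp
      then show "of_bool (t (p i) < t (a (p i))) - of_bool (t (th (p i)) < t (a (th (p i)))) =
          (of_bool (i < b i) - of_bool (c i < b (c i)) :: int)"
        unfolding z_def .
    }
    fix z assume z: "z \<in> Zn"
    note Zn = Zn[OF z]
    show "p (t z) = z" using p_t[OF Zn(1)] .
    have "nc z = th z" using nc_simps(1)[OF Zn(2,4)] .
    then show "t z \<in> {z \<in> same_flags N b. odd z \<and> c z \<in> same_flags N b}"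
      using sf[OF Zn(1)] sf[OF Zn(17)] Zn(2,3,5) tc[OF Zn(1)] t_parity[OF Zn(1)] by simp
  qed
  then have Sb: "through_sum N b = (\<Sum>z\<in>Zn. of_bool (t z < t (a z))) - (\<Sum>z\<in>Zn. of_bool (t (th z) < t (a (th z))))"
    by (simp add: sum_subtractf)
  \<comment> \<open>The new order is the old one rotated at \<open>piv\<close>, so the comparison of
    \<open>u\<close> with \<open>a u\<close> is reversed exactly when the two lie on different
    sides.\<close>
  have pair: "of_bool (a u < u) + of_bool (t u < t (a u)) = 1 + L (a u) - L u" if u: "u \<in> S" for u
  proof -
    have "u \<noteq> a u" "a u \<in> S" using A(2)[OF S_less[OF u]] a_S[OF S_less[OF u]] u by auto
    then show ?thesis using t_less_iff[OF u, of "a u"] by (auto simp: L_def)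
  qed
  have "through_sum N a + through_sum N b =
      (\<Sum>z\<in>Zn. of_bool (a z < z) + of_bool (t z < t (a z))) -
      (\<Sum>z\<in>Zn. of_bool (a (th z) < th z) + of_bool (t (th z) < t (a (th z))))"
    unfolding Sa Sb by (simp add: sum.distrib)
  also have "\<dots> = (\<Sum>z\<in>Zn. 1 + L (a z) - L z) - (\<Sum>z\<in>Zn. 1 + L (a (th z)) - L (th z))"
    using pair Zn by (intro arg_cong2[of _ _ _ _ "(-)"] sum.cong) auto
  also have "\<dots> = (\<Sum>z\<in>Zn. L (a z)) - (\<Sum>z\<in>Zn. L (a (th z))) - (\<Sum>z\<in>Zn. L z - L (th z))"
    by (simp add: sum.distrib sum_subtractf)
  also have "\<dots> = (\<Sum>z\<in>Zt. L z - L (th z)) - (\<Sum>z\<in>Zn. L z - L (th z))"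
    using re1[of L] re2[of L] Zt by (simp add: sum_subtractf)
  \<comment> \<open>Among the single corners only the one ending with \<open>piv\<close> leads from
    below \<open>piv\<close> to a flag that is not below it.\<close>
  also have "(\<Sum>z\<in>Zt. L z - L (th z)) = 1"
  proof -
    have k: "c piv \<in> Zt" "th (c piv) = piv" "c piv < piv"
      using piv c_even[OF S_less[OF piv(1)]] c_c[OF S_less[OF piv(1)]] link_link[OF piv(1)] by (auto simp: Z)
    have "L z - L (th z) = (if z = c piv then 1 else 0)" if z: "z \<in> Zt" for z
    proof (cases "z = c piv")
      case True
      then show ?thesis using k by (simp add: L_def)
    next
      case False
      note z = Zt[OF z]
      have "c z = Suc z" using z(3) S_pos[OF z(2)] by (auto simp: cn_def)
      then have "z \<noteq> hi" using hi(3)[OF z(4)] by auto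
      note l = link_odd[OF z(2,3) this]
      have "th z \<noteq> piv" using False link_link[OF z(2)] piv(6) by auto
      then have "z < piv \<longleftrightarrow> th z < piv" using l(3) l(4)[OF piv(1)] piv(2) z(3) by auto
      then show ?thesis using False by (simp add: L_def)
    qed
    then have "(\<Sum>z\<in>Zt. L z - L (th z)) = (\<Sum>z\<in>Zt. if z = c piv then 1 else 0)" by (rule sum.cong[OF refl])
    then show ?thesis using k fin by simp
  qed
  \<comment> \<open>Among the longer contents only the root content, from \<open>hi\<close> to
    \<open>lo\<close>, changes sides.\<close>
  also have "(\<Sum>z\<in>Zn. L z - L (th z)) = - 1"
  proof -
    have "c hi \<notin> S"
    proof
      assume "c hi \<in> S"
      moreover have "c hi = Suc hi" using hi(2) S_pos[OF hi(1)] by (auto simp: cn_def)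
      ultimately show False using hi(3)[of "c hi"] by simp
    qed
    then have h: "hi \<in> Zn" using hi by (simp add: Z)
    have ph: "piv \<le> hi" using hi(3)[OF piv(1)] .
    have "L z - L (th z) = (if z = hi then - 1 else 0)" if z: "z \<in> Zn" for z
    proof (cases "z = hi")
      case True
      then show ?thesis using link_hi piv(3) ph by (simp add: L_def)
    next
      case False
      note z = Zn[OF z]
      note l = link_odd[OF z(2,3) False]
      have "th z \<noteq> piv" using piv(4) z(7) by auto
      then have "z < piv \<longleftrightarrow> th z < piv" using l(3) l(4)[OF piv(1)] piv(2) z(3) by auto
      then show ?thesis using False by (simp add: L_def)
    qed
    then have "(\<Sum>z\<in>Zn. L z - L (th z)) = (\<Sum>z\<in>Zn. if z = hi then - 1 else 0)" by (rule sum.cong[OF refl])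
    then show ?thesis using h fin by simp
  qed
  finally show ?thesis by simp
qed

end

lemma sum_through_sum:
  assumes "even N" "0 < N"
  shows "(\<Sum>a\<in>cubics False N l. through_sum N a) = int (card (cubics False N l))"
proof -
  have ng: "nonorientable_gluing N a" if "a \<in> cubics False N l" for a
    using that assms by unfold_locales (auto simp: cubics_def)
  have fl: "flip N a \<in> cubics False N l" "flip N (flip N a) = a"
    "through_sum N (flip N a) = 2 - through_sum N a" if asm: "a \<in> cubics False N l" for a
  proof -
    interpret nonorientable_gluing N a using ng[OF asm] .
    show "flip N a \<in> cubics False N l" using flip_cubic flip_nonorientable flip_leaves asm by (auto simp: cubics_def)
    show "flip N (flip N a) = a" by (rule flip_flip)
    show "through_sum N (flip N a) = 2 - through_sum N a" using flip_through_sum by simp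
  qed
  have "(\<Sum>a\<in>cubics False N l. through_sum N a) = (\<Sum>a\<in>cubics False N l. through_sum N (flip N a))"
    by (rule sum.reindex_bij_witness[of _ "flip N" "flip N"]) (use fl in auto)
  also have "\<dots> = (\<Sum>a\<in>cubics False N l. 2 - through_sum N a)"
    using fl by (intro sum.cong) auto
  finally show ?thesis by (simp add: sum_subtractf)
qed

lemma through_sum_orientable:
  assumes "parity_changing N a"
  shows "through_sum N a = 0"
  unfolding through_sum_def
  by (rule sum.neutral) (use assms in \<open>auto simp: through_sign_def parity_changing_def inner_evens_def\<close>)

section \<open>Plane trees and the recurrences\<close>

text \<open>With \<open>N = 4 E\<close> and \<open>2 l = E + 3 - 6 h\<close> the right-hand side is
  12 times the difference of \<open>2 h\<close> and the through sum.\<close>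

lemma intertwined_balance:
  assumes N: "even N" "0 < N" and a: "a \<in> cubics b N l"
  shows "12 * int (\<Sum>k<4. card (nodes_of N k a)) = int N - 8 * int l + 12 - 12 * through_sum N a"
proof -
  have a': "a \<in> cubic_gluings N" "card (leaves N a) = l" using a by (auto simp: cubics_def)
  have "6 * int (card (all_nodes N a)) + 2 * int l = int N"
    using card_all_nodes[OF N a'(1)] a'(2) by linarith
  then show ?thesis
    using intertwined_count[OF N a'(1)] card_intertwined[OF N a'(1)] a'(2) by simp
qed

lemma orientable_recurrence:
  assumes N: "even N" "0 < N"
  shows "12 * int (((l + 2) choose 3) * card (cubics True N (l + 3))) =
    (int N - 8 * int l + 12) * int (card (cubics True N l))"
proof -
  have "12 * int (card (nodes_of N 0 a)) = int N - 8 * int l + 12" if a: "a \<in> cubics True N l" for a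
  proof -
    have "through_sum N a = 0" using a through_sum_orientable by (simp add: cubics_def)
    moreover have "(\<Sum>k<4. card (nodes_of N k a)) = card (nodes_of N 0 a)"
      using nodes_of_twisted_orientable[OF a] by (simp add: eval_nat_numeral)
    ultimately show ?thesis using intertwined_balance[OF N a] by simp
  qed
  then have "12 * int (\<Sum>a\<in>cubics True N l. card (nodes_of N 0 a)) = (\<Sum>a\<in>cubics True N l. int N - 8 * int l + 12)"
    unfolding of_nat_sum sum_distrib_left by (rule sum.cong[OF refl])
  then show ?thesis unfolding sum_card_nodes_of_0[OF N] by (simp add: mult.commute)
qed

text \<open>The mean 1 of the through sum cancels the constant 12. On the other side pattern 0 keeps
  to non-orientable maps, while each of the three twisted patterns splits into maps of both
  kinds.\<close>

lemma nonorientable_recurrence: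
  assumes N: "even N" "0 < N"
  shows "12 * int (((l + 2) choose 3) * (4 * card (cubics False N (l + 3)) + 3 * card (cubics True N (l + 3)))) =
    (int N - 8 * int l) * int (card (cubics False N l))"
proof -
  let ?Y = "cubics False N l" and ?y' = "card (cubics False N (l + 3))" and ?x' = "card (cubics True N (l + 3))"
  let ?C = "(l + 2) choose 3"
  have "12 * int (\<Sum>a\<in>?Y. \<Sum>k<4. card (nodes_of N k a)) = (\<Sum>a\<in>?Y. int N - 8 * int l + 12 - 12 * through_sum N a)"
    unfolding of_nat_sum[of _ ?Y] sum_distrib_left using intertwined_balance[OF N] by (intro sum.cong) auto
  also have "\<dots> = (int N - 8 * int l + 12) * int (card ?Y) - 12 * int (card ?Y)"
    using sum_through_sum[OF N, of l] by (simp add: sum_subtractf sum_distrib_left[symmetric])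
  also have "(\<Sum>a\<in>?Y. \<Sum>k<4. card (nodes_of N k a)) = (\<Sum>k<4. \<Sum>a\<in>?Y. card (nodes_of N k a))"
    by (rule sum.swap)
  also have "\<dots> = ?C * ?y' + 3 * (?C * (?x' + ?y'))"
    using sum_card_nodes_of_0[OF N, of False l] sum_card_nodes_of_twisted[OF N, of _ l]
    by (simp add: eval_nat_numeral)
  finally show ?thesis by (simp add: algebra_simps)
qed

lemma cubics_empty:
  assumes "even N" "0 < N" "N < 2 * l"
  shows "cubics b N l = {}"
  using card_all_nodes[OF assms(1,2)] assms(3) by (fastforce simp: cubics_def)

lemma cubics_0:
  assumes "even N" "0 < N"
  shows "cubics b N 0 = {}"
proof -
  have "card (leaves N a) \<noteq> 0" if "a \<in> cubic_gluings N" for a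
    using root_leaf[OF assms that] by (auto simp: leaves_def card_eq_0_iff)
  then show ?thesis by (auto simp: cubics_def)
qed

text \<open>Splitting leads to more and more leaves, which is bounded because a leaf takes two
  flags. The factor \<open>8 m - 8 l + 12\<close> is 4 modulo 8 and thus never zero, so emptiness
  comes back from large \<open>l\<close> to all \<open>l\<close>. This is the integrality of the
  genus of an orientable surface.\<close>

lemma card_cubics_odd:
  assumes N: "N = 8 * m" "0 < m"
  shows "card (cubics True N l) = 0"
proof (induction "N - l" arbitrary: l rule: less_induct)
  case less
  have N': "even N" "0 < N" using N by auto
  show ?case
  proof (cases "N < 2 * l")
    case True
    then show ?thesis using cubics_empty[OF N'] by simp
  next
    case False
    then have "N - (l + 3) < N - l" using N' by linarith
    then have "card (cubics True N (l + 3)) = 0" by (rule less)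
    then have "(int N - 8 * int l + 12) * int (card (cubics True N l)) = 0"
      using orientable_recurrence[OF N', of l] by simp
    moreover have "int N - 8 * int l + 12 \<noteq> 0" unfolding N by presburger
    ultimately show ?thesis by simp
  qed
qed

section \<open>Plane trees and Catalan numbers\<close>

definition planar_gluings :: "nat \<Rightarrow> (nat \<Rightarrow> nat) set" where
  "planar_gluings N = {a \<in> gluings N. a 0 = N - 1 \<and>
     (\<forall>x. even x \<and> 0 < x \<and> x < N \<longrightarrow> a x = x - 1 \<or>
        (\<exists>p q r. node_triple N p q r \<and> x \<in> {p, q, r} \<and> a p = q - 1 \<and> a q = r - 1 \<and> a r = p - 1))}"

lemma planar_gluingsD:
  assumes "a \<in> planar_gluings N" "even x" "0 < x" "x < N" "a x \<noteq> x - 1"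
  obtains p q r where "node_triple N p q r" "x \<in> {p, q, r}" "a p = q - 1" "a q = r - 1" "a r = p - 1"
  using assms unfolding planar_gluings_def by blast

lemma planar_parity:
  assumes N: "even N" "0 < N" and a: "a \<in> planar_gluings N"
  shows "parity_changing N a"
proof -
  have ag: "a \<in> gluings N" and a0: "a 0 = N - 1" using a by (auto simp: planar_gluings_def)
  have ev: "odd (a x)" if x: "even x" "x < N" for x
  proof (cases "x = 0")
    case True
    then show ?thesis using a0 N by simp
  next
    case False
    show ?thesis
    proof (cases "a x = x - 1")
      case True
      then show ?thesis using x False by simp
    next
      case neq: False
      obtain p q r where "node_triple N p q r" "x \<in> {p, q, r}" "a p = q - 1" "a q = r - 1" "a r = p - 1"
        using planar_gluingsD[OF a x(1) _ x(2) neq] False by auto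
      then show ?thesis by (auto simp: node_triple_def)
    qed
  qed
  have "even (a x)" if x: "odd x" "x < N" for x
  proof -
    have "odd (a (sd x))" using ev[of "sd x"] x sd_less[OF N(1) x(2)] by simp
    then show ?thesis using gluingsD(4)[OF ag x(2)] by simp
  qed
  then show ?thesis using ev by (auto simp: parity_changing_def)
qed

lemma planar_cubic:
  assumes N: "even N" "0 < N" and a: "a \<in> planar_gluings N"
  shows "a \<in> cubic_gluings N"
proof -
  have ag: "a \<in> gluings N" and a0: "a 0 = N - 1" using a by (auto simp: planar_gluings_def)
  note I = gluingsD(3)[OF ag]
  have ev: "cn N (a (cn N (a (cn N (a x))))) = x \<and> cn N (a (cn N (a (cn N (a (cn N x)))))) = cn N x"
    if x: "even x" "x < N" for x
  proof (cases "a x = cn N x")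
    case True
    then have "a (cn N x) = x" using I[OF x(2)] by simp
    then show ?thesis using True cn_cn[OF N(1) x(2)] by simp
  next
    case neq: False
    have x0: "x \<noteq> 0"
    proof
      assume "x = 0"
      then show False using neq a0 by (simp add: cn_def)
    qed
    then have "a x \<noteq> x - 1" using neq x by (simp add: cn_def)
    then obtain p q r where t: "node_triple N p q r" "x \<in> {p, q, r}"
      and e: "a p = q - 1" "a q = r - 1" "a r = p - 1"
      using planar_gluingsD[OF a x(1) _ x(2)] x0 by auto
    have "p < N" "q < N" "r < N" using t by (auto simp: node_triple_def)
    then have e': "a (q - 1) = p" "a (r - 1) = q" "a (p - 1) = r" using e I by metis+
    show ?thesis using t(2) by (elim insertE emptyE; simp only: node_cn[OF t(1)] e e' simp_thms)
  qed
  have "cn N (a (cn N (a (cn N (a x))))) = x" if x: "x < N" for x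
  proof (cases "even x")
    case True
    then show ?thesis using ev x by simp
  next
    case False
    then have "even (cn N x)" "cn N x < N" using even_cn[OF N(1) x] cn_less[OF x] by simp_all
    then show ?thesis using ev[of "cn N x"] cn_cn[OF N(1) x] by simp
  qed
  then show ?thesis using ag a0 by (simp add: cubic_gluings_def)
qed

text \<open>The planar condition puts every corner at a leaf or at a plain node, and a corner
  determines its node, so no node is intertwined; the balance then fixes the number of
  leaves.\<close>

lemma planar_leaves:
  assumes N: "even N" "0 < N" and a: "a \<in> planar_gluings N"
  shows "N + 12 = 8 * card (leaves N a)"
proof -
  have ac: "a \<in> cubics True N (card (leaves N a))"
    using planar_cubic[OF assms] planar_parity[OF assms] by (simp add: cubics_def)
  then have c: "a \<in> cubic_gluings N" by (simp add: cubics_def)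
  have "\<not> intertwined a p q r" if t: "(p, q, r) \<in> all_nodes N a" for p q r
  proof -
    have nt: "node_triple N p q r" and ip: "intertwined a p q r \<or> plain a p q r"
      using t by (auto simp: all_nodes_def)
    have d: "even p" "0 < p" "p < N" using nt by (auto simp: node_triple_def)
    have "a p \<noteq> cn N p" using node_corners(2)[OF N c nt ip] by simp
    then have "a p \<noteq> p - 1" using d by (simp add: cn_def)
    then obtain p' q' r' where t': "node_triple N p' q' r'" "p \<in> {p', q', r'}"
      and e: "a p' = q' - 1" "a q' = r' - 1" "a r' = p' - 1"
      using planar_gluingsD[OF a d(1,2,3)] by auto
    have "(p', q', r') \<in> all_nodes N a" using t' e by (auto simp: all_nodes_def plain_def)
    then have eq: "(p, q, r) = (p', q', r')" using node_unique[OF N c t, of p' q' r' p] t' by simp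
    then have "a p = q - 1" using e by simp
    moreover note nt e eq
    ultimately show ?thesis
      using node_neq[OF nt] unfolding intertwined_iff by auto
  qed
  then have "{(p, q, r) \<in> all_nodes N a. intertwined a p q r} = {}" by auto
  then have "(\<Sum>k<4. card (nodes_of N k a)) = 0" using card_intertwined[OF N c] by (metis card.empty)
  then have "int N - 8 * int (card (leaves N a)) + 12 = 0"
    using intertwined_balance[OF N ac] through_sum_orientable[OF planar_parity[OF assms]] by simp
  then show ?thesis by linarith
qed

text \<open>For \<open>m + 2\<close> leaves the balance is zero, so all nodes are plain, and parity
  leaves one plain configuration. This replaces genus 0 by a condition at each corner, which passes
  to subtrees and to joined trees.\<close>

lemma planar_gluings_eq:
  shows "cubics True (8 * m + 4) (m + 2) = planar_gluings (8 * m + 4)"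
proof -
  define N where "N = 8 * m + 4"
  have N: "even N" "0 < N" by (auto simp: N_def)
  have "a \<in> planar_gluings N" if a: "a \<in> cubics True N (m + 2)" for a
  proof -
    have c: "a \<in> cubic_gluings N" and pc: "parity_changing N a" using a by (auto simp: cubics_def)
    have "(\<Sum>k<4. card (nodes_of N k a)) = 0"
    proof -
      have "12 * int (\<Sum>k<4. card (nodes_of N k a)) = 0"
        using intertwined_balance[OF N a] through_sum_orientable[OF pc] unfolding N_def by simp
      then show ?thesis by linarith
    qed
    then have "card {(p, q, r) \<in> all_nodes N a. intertwined a p q r} = 0"
      using card_intertwined[OF N c] by simp
    then have ni: "{(p, q, r) \<in> all_nodes N a. intertwined a p q r} = {}"
      by (rule card_0_eq[THEN iffD1, rotated]) (rule finite_subset[OF _ finite_all_nodes[of N a]], auto)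
    have "a x = x - 1 \<or> (\<exists>p q r. node_triple N p q r \<and> x \<in> {p, q, r} \<and> a p = q - 1 \<and> a q = r - 1 \<and> a r = p - 1)"
      if x: "even x" "0 < x" "x < N" for x
    proof (cases "a x = cn N x")
      case True
      then show ?thesis using x by (simp add: cn_def)
    next
      case False
      then obtain p q r where t: "(p, q, r) \<in> all_nodes N a" "x \<in> {p, q, r}"
        using node_exists[OF N c, of x] x by (auto simp: inner_evens_def)
      then have pl: "plain a p q r" and nt: "node_triple N p q r" using ni by (auto simp: all_nodes_def)
      have d: "even p" "even q" "even r" "p < N" "q < N" using nt by (auto simp: node_triple_def)
      then have "odd (a p)" "odd (a q)" using pc by (auto simp: parity_changing_def)
      then have "a p = q - 1 \<and> a q = r - 1 \<and> a r = p - 1"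
        using pl d unfolding plain_def by auto
      then show ?thesis using nt t(2) by blast
    qed
    then show ?thesis using c by (simp add: planar_gluings_def cubic_gluings_def)
  qed
  moreover have "a \<in> cubics True N (m + 2)" if a: "a \<in> planar_gluings N" for a
    using planar_cubic[OF N a] planar_parity[OF N a] planar_leaves[OF N a] by (simp add: cubics_def N_def)
  ultimately show ?thesis unfolding N_def by blast
qed

text \<open>The side starting at \<open>s\<close> and its partner ending with \<open>a s\<close>
  enclose a subtree. Its edge leads to a leaf, when the block has four flags, or to a node that cuts
  the interior into two shorter blocks.\<close>

lemma planar_block:
  assumes N: "even N" "0 < N" and a: "a \<in> planar_gluings N"
  shows "even s \<Longrightarrow> s < a s \<Longrightarrow> a s < N \<Longrightarrow> s \<le> x \<Longrightarrow> x \<le> a s \<Longrightarrow> s \<le> a x \<and> a x \<le> a s"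
proof (induction "a s - s" arbitrary: s x rule: less_induct)
  case less
  have ag: "a \<in> gluings N" using a by (simp add: planar_gluings_def)
  note A = gluingsD[OF ag]
  have sN: "s < N" using less.prems by simp
  define e where "e = a s"
  have e: "s < e" "e < N" "a s = e" "a e = s" "odd e"
    using less.prems A(3)[OF sN] planar_parity[OF N a] sN by (auto simp: e_def parity_changing_def)
  have "e \<noteq> Suc s" using A(5)[OF sN] less.prems(1) e(3) by (simp add: sd_def)
  moreover have "e \<noteq> Suc (Suc s)" using e(5) less.prems(1) by auto
  ultimately have es: "s + 3 \<le> e" using e(1) by linarith
  have s1: "a (Suc s) = e - 1" "a (e - 1) = Suc s"
  proof -
    show 1: "a (Suc s) = e - 1" using A(4)[OF sN] less.prems(1) e by (simp add: sd_def)
    have "Suc s < N" using es e by simp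
    then show "a (e - 1) = Suc s" using A(3)[of "Suc s"] 1 by simp
  qed
  show ?case
  proof (cases "e = s + 3")
    case True
    have "x = s \<or> x = Suc s \<or> x = e - 1 \<or> x = e"
      using less.prems(4,5) True unfolding e_def[symmetric] by linarith
    then have "a x \<in> {s, Suc s, e - 1, e}" using s1 e by auto
    then show ?thesis using es unfolding e_def[symmetric] by auto
  next
    case False
    define u where "u = s + 2"
    have u: "even u" "0 < u" "u < N" "u - 1 = Suc s" "u < e - 1"
      using less.prems(1) es e False by (auto simp: u_def)
    have "a u \<noteq> u - 1"
    proof
      assume "a u = u - 1"
      then have "a (Suc s) = u" using A(3)[OF u(3)] u(4) by simp
      then show False using s1 u by simp
    qed
    then obtain p q r where t: "node_triple N p q r" "u \<in> {p, q, r}"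
      and ne: "a p = q - 1" "a q = r - 1" "a r = p - 1"
      using planar_gluingsD[OF a u(1,2,3)] by blast
    have o: "p < q - 1" "q < r - 1" "r < N" "even p" "even q" using t node_order[OF t(1)] by (auto simp: node_triple_def)
    have "a (q - 1) = p" "a (r - 1) = q" "a (p - 1) = r" using ne A(3) o by (metis less_trans less_imp_diff_less order_less_trans)+
    moreover have "a (u - 1) = e - 1" using s1 u by simp
    \<comment> \<open>At the corners \<open>q\<close> and \<open>r\<close> the odd flag is glued to
      a smaller corner, but that of \<open>u\<close> is glued to the larger flag
      \<open>e - 1\<close>; hence \<open>u\<close> is the first corner.\<close>
    ultimately have up: "u = p" "r = e - 1" using t(2) u(5) o by auto
    show ?thesis
    proof -
      have dec: "a p - p < a s - s" "a q - q < a s - s"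
        using ne o up es unfolding e(3) u_def by auto
      have "x \<in> {s, Suc s, e - 1, e} \<or> (p \<le> x \<and> x \<le> a p) \<or> (q \<le> x \<and> x \<le> a q)"
        using less.prems(4,5) up u_def unfolding ne e_def[symmetric] by auto
      then show ?thesis
      proof (elim disjE)
        assume "x \<in> {s, Suc s, e - 1, e}"
        then have "a x \<in> {s, Suc s, e - 1, e}" using s1 e by auto
        then show ?thesis using es unfolding e_def[symmetric] by auto
      next
        assume x: "p \<le> x \<and> x \<le> a p"
        have "p \<le> a x \<and> a x \<le> a p" using less.hyps[OF dec(1)] x ne o by auto
        then show ?thesis using up u_def o unfolding ne e_def[symmetric] by auto
      next
        assume x: "q \<le> x \<and> x \<le> a q"
        have "q \<le> a x \<and> a x \<le> a q" using less.hyps[OF dec(2)] x ne o by auto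
        then show ?thesis using up u_def o unfolding ne e_def[symmetric] by auto
      qed
    qed
  qed
qed

definition restrict_gluing :: "nat \<Rightarrow> nat \<Rightarrow> (nat \<Rightarrow> nat) \<Rightarrow> nat \<Rightarrow> nat" where
  "restrict_gluing s n a x = (if x < n then a (s + x) - s else x)"

text \<open>The block is closed under \<open>a\<close>, so what needs an argument is that a node
  with one corner in it has all three there.\<close>

lemma restrict_planar:
  assumes N: "even N" "0 < N" and a: "a \<in> planar_gluings N"
    and s: "even s" "a s = s + n - 1" "0 < n" "even n" "s + n \<le> N"
  shows "restrict_gluing s n a \<in> planar_gluings n"
proof -
  have ag: "a \<in> gluings N" using a by (simp add: planar_gluings_def)
  note A = gluingsD[OF ag]
  let ?b = "restrict_gluing s n a"
  have n: "s < a s" "a s < N" using s by (auto elim!: evenE)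
  have cl: "s \<le> a (s + x)" "a (s + x) < s + n" if "x < n" for x
    using planar_block[OF N a s(1) n, of "s + x"] that s(2,3) by linarith+
  have b: "s + ?b x = a (s + x)" "?b x < n" if "x < n" for x
    using cl[OF that] that by (auto simp: restrict_gluing_def)
  have bI: "?b x = y \<longleftrightarrow> a (s + x) = s + y" if "x < n" for x y
    using b(1)[OF that] by auto
  have sx: "sd (s + x) = s + sd x" for x by (rule sd_add[OF s(1)])
  have "?b \<in> gluings n"
    unfolding gluings_def
  proof (intro CollectI conjI allI impI)
    fix x assume x: "x < n"
    then have sN: "s + x < N" using s by simp
    note A = A[OF sN]
    show "?b x < n" using b x by simp
    show "?b x \<noteq> x" using A(2) bI[OF x] by simp
    show "?b (?b x) = x" using bI[OF b(2)[OF x]] b(1)[OF x] A(3) by simp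
    have "sd x < n" using sd_less[OF s(4) x] .
    then show "?b (sd x) = sd (?b x)" using bI A(4) b(1)[OF x] sx by metis
    show "?b x \<noteq> sd x" using A(5) bI[OF x] sx by simp
  qed (simp add: restrict_gluing_def)
  moreover have "?b 0 = n - 1" using s by (simp add: restrict_gluing_def)
  moreover have "?b x = x - 1 \<or> (\<exists>p q r. node_triple n p q r \<and> x \<in> {p, q, r} \<and> ?b p = q - 1 \<and> ?b q = r - 1 \<and> ?b r = p - 1)"
    if x: "even x" "0 < x" "x < n" for x
  proof (cases "a (s + x) = s + x - 1")
    case True
    then show ?thesis using x bI[OF x(3), of "x - 1"] by simp
  next
    case False
    then obtain p q r where t: "node_triple N p q r" "s + x \<in> {p, q, r}"
      and ne: "a p = q - 1" "a q = r - 1" "a r = p - 1"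
      using planar_gluingsD[OF a, of "s + x"] x s by auto
    have o: "p < q - 1" "q < r - 1" "r < N" "even p" "even q" "even r" "0 < p"
      using t node_order[OF t(1)] by (auto simp: node_triple_def)
    have "p < N" "q < N" using o by simp_all
    then have ne': "a (q - 1) = p" "a (r - 1) = q" "a (p - 1) = r" using ne A(3) o(3) by metis+
    have as: "a (s + n - 1) = s" using A(3)[of s] s n by (metis less_trans)
    have in_block: "s \<le> a y \<and> a y < s + n" if "s \<le> y" "y < s + n" for y
      using cl[of "y - s"] that by auto
    \<comment> \<open>The flag \<open>z - 1\<close> is glued into the block and differs from its
      last flag, which is glued to \<open>s\<close>; so the whole corner lies in the block. The next
      claim treats the lower end in the same way.\<close>
    have up: "z < s + n" if y: "s < y" "y < s + n" "a y = z - 1" "a (z - 1) = y" for y z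
    proof -
      have "z - 1 < s + n" using in_block[of y] y by simp
      moreover have "z - 1 \<noteq> s + n - 1" using as y(1,4) by auto
      ultimately show ?thesis by linarith
    qed
    have down: "s < y" if z: "s < z" "z < s + n" "a y = z - 1" "a (z - 1) = y" for y z
    proof -
      have "s \<le> y" using in_block[of "z - 1"] z by simp
      moreover have "y \<noteq> s" using s(2) z by force
      ultimately show ?thesis by simp
    qed
    have pq: "s < p \<and> r < s + n"
    proof -
      have y: "s < s + x" "s + x < s + n" using x by simp_all
      consider "s + x = p" | "s + x = q" | "s + x = r" using t(2) by blast
      then show ?thesis
      proof cases
        case 1
        then have p: "s < p" "p < s + n" using y by simp_all
        have "q < s + n" using up[OF p ne(1) ne'(1)] .
        then have "r < s + n" using up[of q r] ne(2) ne'(2) p o by simp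
        then show ?thesis using p by simp
      next
        case 2
        then have q: "s < q" "q < s + n" using y by simp_all
        show ?thesis using up[OF q ne(2) ne'(2)] down[OF q ne(1) ne'(1)] by simp
      next
        case 3
        then have r: "s < r" "r < s + n" using y by simp_all
        have "s < q" using down[OF r ne(2) ne'(2)] .
        then have "s < p" using down[of q p] ne(1) ne'(1) r o by simp
        then show ?thesis using r by simp
      qed
    qed
    have e: "node_triple n (p - s) (q - s) (r - s)" using pq o s(1) by (auto simp: node_triple_def)
    have "?b (p - s) = (q - s) - 1" "?b (q - s) = (r - s) - 1" "?b (r - s) = (p - s) - 1"
      using bI[of "p - s" "q - s - 1"] bI[of "q - s" "r - s - 1"] bI[of "r - s" "p - s - 1"] ne pq o by auto
    moreover have "x \<in> {p - s, q - s, r - s}" using t(2) by auto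
    ultimately show ?thesis using e by blast
  qed
  ultimately show ?thesis by (auto simp: planar_gluings_def)
qed

text \<open>The root edge takes the first two and the last two flags. Its far end is a node carrying
  the two trees one after the other.\<close>

definition join_gluings :: "nat \<Rightarrow> nat \<Rightarrow> (nat \<Rightarrow> nat) \<Rightarrow> (nat \<Rightarrow> nat) \<Rightarrow> nat \<Rightarrow> nat" where
  "join_gluings n m a b x =
     (if x = 0 then n + m + 3 else if x = 1 then n + m + 2
      else if x < 2 + n then 2 + a (x - 2)
      else if x < 2 + n + m then 2 + n + b (x - (2 + n))
      else if x = 2 + n + m then 1 else if x = 3 + n + m then 0 else x)"

lemma join_gluings_simps:
  "join_gluings n m a b 0 = 3 + n + m" "join_gluings n m a b 1 = 2 + n + m"
  "y < n \<Longrightarrow> join_gluings n m a b (2 + y) = 2 + a y"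
  "y < m \<Longrightarrow> join_gluings n m a b (2 + n + y) = 2 + n + b y"
  "join_gluings n m a b (2 + n + m) = 1" "join_gluings n m a b (3 + n + m) = 0"
  "n + m + 4 \<le> x \<Longrightarrow> join_gluings n m a b x = x"
  by (auto simp: join_gluings_def)

lemma join_cases:
  assumes "x < n + m + 4"
  obtains "x = 0" | "x = 1" | y where "x = 2 + y" "y < n" | y where "x = 2 + n + y" "y < m"
    | "x = 2 + n + m" | "x = 3 + (n::nat) + m"
proof -
  consider "x = 0" | "x = 1" | "2 \<le> x" "x < 2 + n" | "2 + n \<le> x" "x < 2 + n + m" | "x = 2 + n + m" | "x = 3 + n + m"
    using assms by linarith
  then show ?thesis
    by cases (use that(1,2,5,6) that(3)[of "x - 2"] that(4)[of "x - (2 + n)"] in auto)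
qed

lemma node_triple_shift:
  "even s \<Longrightarrow> node_triple n p q r \<Longrightarrow> s + n \<le> N \<Longrightarrow> node_triple N (s + p) (s + q) (s + r)"
  by (auto simp: node_triple_def)

lemma join_planar:
  assumes n: "even n" "0 < n" and m: "even m" "0 < m"
    and a: "a \<in> planar_gluings n" and b: "b \<in> planar_gluings m"
  shows "join_gluings n m a b \<in> planar_gluings (n + m + 4)"
proof -
  let ?J = "join_gluings n m a b" and ?N = "n + m + 4"
  note J = join_gluings_simps[where n = n and m = m and a = a and b = b]
  have ag: "a \<in> gluings n" "a 0 = n - 1" and bg: "b \<in> gluings m" "b 0 = m - 1"
    using a b by (auto simp: planar_gluings_def)
  note A = gluingsD[OF ag(1)] and B = gluingsD[OF bg(1)]
  have sd0: "sd 0 = 1" "sd 1 = 0" "sd (2 + n + m) = 3 + n + m" "sd (3 + n + m) = 2 + n + m"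
    using n m by (auto simp: sd_def)
  have sda: "sd (2 + y) = 2 + sd y" "sd (2 + n + y) = 2 + n + sd y" for y
    using n by (simp_all only: sd_add even_add even_numeral)
  have glue: "?J \<in> gluings ?N"
    unfolding gluings_def
  proof (intro CollectI conjI allI impI)
    fix x assume x: "x < ?N"
    have "?J x < ?N \<and> ?J x \<noteq> x \<and> ?J (?J x) = x \<and> ?J (sd x) = sd (?J x) \<and> ?J x \<noteq> sd x"
      using x
    proof (cases rule: join_cases)
      case 1
      then show ?thesis using J(1,2,5,6) sd0 by simp
    next
      case 2
      then show ?thesis using J(1,2,5,6) sd0 by simp
    next
      case (3 y)
      have "sd y < n" using sd_less[OF n(1) 3(2)] .
      then show ?thesis using A[OF 3(2)] 3 by (simp add: sda J del: add_2_eq_Suc add_2_eq_Suc')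
    next
      case (4 y)
      have "sd y < m" using sd_less[OF m(1) 4(2)] .
      then show ?thesis using B[OF 4(2)] 4 by (simp add: sda J del: add_2_eq_Suc add_2_eq_Suc')
    next
      case 5
      then show ?thesis using J(1,2,5,6) sd0 by simp
    next
      case 6
      then show ?thesis using J(1,2,5,6) sd0 by simp
    qed
    then show "?J x < ?N" "?J x \<noteq> x" "?J (?J x) = x" "?J (sd x) = sd (?J x)" "?J x \<noteq> sd x" by blast+
  qed (simp add: J)
  have new: "node_triple ?N 2 (2 + n) (2 + n + m)" "?J 2 = (2 + n) - 1" "?J (2 + n) = (2 + n + m) - 1"
    "?J (2 + n + m) = 2 - 1"
    using n m J(3)[of 0] J(4)[of 0] J(5) ag(2) bg(2) by (auto simp: node_triple_def)
  have "?J x = x - 1 \<or> (\<exists>p q r. node_triple ?N p q r \<and> x \<in> {p, q, r} \<and> ?J p = q - 1 \<and> ?J q = r - 1 \<and> ?J r = p - 1)"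
    if x: "even x" "0 < x" "x < ?N" for x
    using x(3)
  proof (cases rule: join_cases)
    case (3 y)
    show ?thesis
    proof (cases "y = 0")
      case True
      then show ?thesis using new 3 by (intro disjI2 exI[of _ 2] exI[of _ "2 + n"] exI[of _ "2 + n + m"]) simp
    next
      case False
      have ye: "even y" using x 3 by simp
      show ?thesis
      proof (cases "a y = y - 1")
        case True
        then show ?thesis using J(3)[OF 3(2)] 3 False by simp
      next
        case neq: False
        obtain p q r where t: "node_triple n p q r" "y \<in> {p, q, r}"
          and e: "a p = q - 1" "a q = r - 1" "a r = p - 1"
          using planar_gluingsD[OF a ye _ 3(2) neq] False by auto
        have d: "p < n" "q < n" "r < n" "0 < p" "0 < q" "0 < r" using t by (auto simp: node_triple_def)
        have "node_triple ?N (2 + p) (2 + q) (2 + r)" using t(1) by (intro node_triple_shift) auto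
        moreover have "?J (2 + p) = 2 + q - 1" "?J (2 + q) = 2 + r - 1" "?J (2 + r) = 2 + p - 1"
          using J(3) d e by simp_all
        moreover have "x \<in> {2 + p, 2 + q, 2 + r}" using 3 t(2) by auto
        ultimately show ?thesis by blast
      qed
    qed
  next
    case (4 y)
    show ?thesis
    proof (cases "y = 0")
      case True
      then show ?thesis using new 4 by (intro disjI2 exI[of _ 2] exI[of _ "2 + n"] exI[of _ "2 + n + m"]) simp
    next
      case False
      have ye: "even y" using x 4 n by simp
      show ?thesis
      proof (cases "b y = y - 1")
        case True
        then show ?thesis using J(4)[OF 4(2)] 4 False by simp
      next
        case neq: False
        obtain p q r where t: "node_triple m p q r" "y \<in> {p, q, r}"
          and e: "b p = q - 1" "b q = r - 1" "b r = p - 1"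
          using planar_gluingsD[OF b ye _ 4(2) neq] False by auto
        have d: "p < m" "q < m" "r < m" "0 < p" "0 < q" "0 < r" using t by (auto simp: node_triple_def)
        have "node_triple ?N (2 + n + p) (2 + n + q) (2 + n + r)" using t(1) n by (intro node_triple_shift) auto
        moreover have "?J (2 + n + p) = 2 + n + q - 1" "?J (2 + n + q) = 2 + n + r - 1" "?J (2 + n + r) = 2 + n + p - 1"
          using J(4) d e by simp_all
        moreover have "x \<in> {2 + n + p, 2 + n + q, 2 + n + r}" using 4 t(2) by auto
        ultimately show ?thesis by blast
      qed
    qed
  next
    case 5
    then show ?thesis using new by (intro disjI2 exI[of _ 2] exI[of _ "2 + n"] exI[of _ "2 + n + m"]) simp
  qed (use x n m in auto)
  moreover have "?J 0 = ?N - 1" using J(1) by simp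
  ultimately show ?thesis using glue unfolding planar_gluings_def by blast
qed

text \<open>Beyond a single edge the root edge ends in a node. Its first corner is 2, and its last
  one is \<open>N - 2\<close> because that flag is glued to 1; the middle corner separates the two
  subtrees.\<close>

lemma planar_decomposition:
  assumes N: "even N" "4 < N" and a: "a \<in> planar_gluings N"
  obtains n m where "even n" "0 < n" "even m" "0 < m" "N = n + m + 4"
    "restrict_gluing 2 n a \<in> planar_gluings n" "restrict_gluing (2 + n) m a \<in> planar_gluings m"
    "a = join_gluings n m (restrict_gluing 2 n a) (restrict_gluing (2 + n) m a)"
proof -
  have N0: "0 < N" using N by simp
  have ag: "a \<in> gluings N" and a0: "a 0 = N - 1" using a by (auto simp: planar_gluings_def)
  note A = gluingsD[OF ag]
  have a1: "a 1 = N - 2" using A(4)[OF N0] a0 N by (auto simp: sd_def)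
  have l: "a (N - 1) = 0" "a (N - 2) = 1" using A(3)[of 0] A(3)[of 1] a0 a1 N by auto
  have "a 2 \<noteq> 1"
  proof
    assume "a 2 = 1"
    then have "a 1 = 2" using A(3)[of 2] N by simp
    then show False using a1 N by simp
  qed
  then obtain p q r where t: "node_triple N p q r" "2 \<in> {p, q, r}"
    and e: "a p = q - 1" "a q = r - 1" "a r = p - 1"
    using planar_gluingsD[OF a, of 2] N by auto
  have o: "p < q - 1" "q < r - 1" "r < N" "even p" "even q" "even r" "0 < p"
    using t node_order[OF t(1)] by (auto simp: node_triple_def)
  have p2: "p = 2"
  proof -
    have "2 \<le> p" using o(4,7) by (auto elim!: evenE)
    then show ?thesis using t(2) o by auto
  qed
  have rN: "r = N - 2" using A(3)[OF o(3)] e(3) p2 a1 by simp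
  define n m where nm: "n = q - 2" "m = N - 2 - q"
  have q: "q = 2 + n" "N = n + m + 4" and pos: "0 < n" "0 < m" "even n" "even m"
    using o p2 rN N nm by auto
  have e': "a 2 = 2 + n - 1" "a (2 + n) = 2 + n + m - 1" using e p2 q rN by auto
  let ?a = "restrict_gluing 2 n a" and ?b = "restrict_gluing (2 + n) m a"
  have P: "?a \<in> planar_gluings n" "?b \<in> planar_gluings m"
    using restrict_planar[OF N(1) N0 a, of 2 n] restrict_planar[OF N(1) N0 a, of "2 + n" m] e' pos q by simp_all
  have "1 < n" "1 < m" using pos by (auto elim!: evenE)
  note pos = pos this
  have cl: "2 \<le> a (2 + y)" if "y < n" for y
    using planar_block[OF N(1) N0 a, of 2 "2 + y"] e' pos q that by simp
  have cl': "2 + n \<le> a (2 + n + y)" if "y < m" for y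
    using planar_block[OF N(1) N0 a, of "2 + n" "2 + n + y"] e' pos q that by simp
  have l': "a 0 = 3 + n + m" "a 1 = 2 + n + m" "a (2 + n + m) = 1" "a (3 + n + m) = 0"
    using a0 a1 l unfolding q(2) by (simp_all add: ac_simps numeral_eq_Suc)
  have "a x = join_gluings n m ?a ?b x" for x
  proof (cases "x < n + m + 4")
    case True
    then show ?thesis
    proof (cases rule: join_cases)
      case (3 y)
      then show ?thesis using join_gluings_simps(3)[of y n m ?a ?b] cl[of y] by (simp add: restrict_gluing_def)
    next
      case (4 y)
      then show ?thesis using join_gluings_simps(4)[of y m n ?a ?b] cl'[of y] by (simp add: restrict_gluing_def)
    qed (simp_all only: l' join_gluings_simps)
  next
    case False
    then show ?thesis using ag q by (simp add: join_gluings_simps gluings_def)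
  qed
  then show ?thesis using that[OF pos(3,1,4,2) q(2) P] by blast
qed

lemma restrict_join:
  assumes "a \<in> gluings n" "b \<in> gluings m"
  shows "restrict_gluing 2 n (join_gluings n m a b) = a" "restrict_gluing (2 + n) m (join_gluings n m a b) = b"
  using assms join_gluings_simps(3,4)[of _ _ _ a b]
  by (auto simp: restrict_gluing_def gluings_def fun_eq_iff)

lemma finite_planar_gluings: "even N \<Longrightarrow> 0 < N \<Longrightarrow> finite (planar_gluings N)"
  using planar_cubic by (intro finite_subset[OF _ finite_cubic_gluings[of N]]) blast

text \<open>Injectivity holds because the value at 2 reveals the size of the first subtree. Subtree
  sizes are 4 modulo 8 by \<open>planar_leaves\<close>, and with the four flags of the root edge
  they add up to \<open>8 n + 12\<close>.\<close>

lemma card_planar_Suc: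
  "card (planar_gluings (8 * Suc n + 4)) =
    (\<Sum>i\<le>n. card (planar_gluings (8 * i + 4)) * card (planar_gluings (8 * (n - i) + 4)))"
proof -
  let ?T = "\<lambda>i. planar_gluings (8 * i + 4)"
  let ?S = "SIGMA i:{..n}. ?T i \<times> ?T (n - i)"
  let ?f = "\<lambda>(i, a, b). join_gluings (8 * i + 4) (8 * (n - i) + 4) a b"
  have pg: "a \<in> gluings N" "a 0 = N - 1" if "a \<in> planar_gluings N" for a N
    using that by (auto simp: planar_gluings_def)
  have "bij_betw ?f ?S (?T (Suc n))"
  proof (rule bij_betw_imageI)
    show "inj_on ?f ?S"
    proof (rule inj_onI)
      fix x y assume xy: "x \<in> ?S" "y \<in> ?S" "?f x = ?f y"
      obtain i a b j a' b' where e: "x = (i, a, b)" "y = (j, a', b')" by (metis prod_cases3)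
      let ?J = "join_gluings (8 * i + 4) (8 * (n - i) + 4) a b"
      let ?J' = "join_gluings (8 * j + 4) (8 * (n - j) + 4) a' b'"
      have J: "?J = ?J'" using xy(3) unfolding e by simp
      have m: "a \<in> ?T i" "b \<in> ?T (n - i)" "a' \<in> ?T j" "b' \<in> ?T (n - j)" using xy unfolding e by auto
      have "?J 2 = 2 + a 0" "?J' 2 = 2 + a' 0"
        using join_gluings_simps(3)[of 0 "8 * i + 4"] join_gluings_simps(3)[of 0 "8 * j + 4"] by simp_all
      then have "a 0 = a' 0" using J by simp
      then have ij: "i = j" using pg(2)[OF m(1)] pg(2)[OF m(3)] by simp
      then show "x = y"
        using restrict_join[OF pg(1)[OF m(1)] pg(1)[OF m(2)]] restrict_join[OF pg(1)[OF m(3)] pg(1)[OF m(4)]] J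
        unfolding e by simp
    qed
    show "?f ` ?S = ?T (Suc n)"
    proof (intro equalityI subsetI)
      fix a assume "a \<in> ?f ` ?S"
      then obtain i b c where i: "i \<le> n" and bc: "b \<in> ?T i" "c \<in> ?T (n - i)"
        and e: "a = join_gluings (8 * i + 4) (8 * (n - i) + 4) b c" by auto
      have "join_gluings (8 * i + 4) (8 * (n - i) + 4) b c \<in> planar_gluings ((8 * i + 4) + (8 * (n - i) + 4) + 4)"
        by (rule join_planar) (use bc in auto)
      moreover have "(8 * i + 4) + (8 * (n - i) + 4) + 4 = 8 * Suc n + 4" using i by simp
      ultimately show "a \<in> ?T (Suc n)" unfolding e by simp
    next
      fix a assume a: "a \<in> ?T (Suc n)"
      obtain k m where km: "even k" "0 < k" "even m" "0 < m" "8 * Suc n + 4 = k + m + 4"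
        and P: "restrict_gluing 2 k a \<in> planar_gluings k" "restrict_gluing (2 + k) m a \<in> planar_gluings m"
        and e: "a = join_gluings k m (restrict_gluing 2 k a) (restrict_gluing (2 + k) m a)"
        using planar_decomposition[OF _ _ a] by auto
      define i where "i = (k - 4) div 8"
      have "k = 8 * i + 4" using planar_leaves[OF km(1,2) P(1)] km(2) unfolding i_def by presburger
      moreover from this have "i \<le> n" "m = 8 * (n - i) + 4" using planar_leaves[OF km(3,4) P(2)] km by auto
      ultimately show "a \<in> ?f ` ?S" using P e
        by (intro image_eqI[of _ _ "(i, restrict_gluing 2 k a, restrict_gluing (2 + k) m a)"]) auto
    qed
  qed
  then have "card (?T (Suc n)) = card ?S" by (simp add: bij_betw_same_card)
  also have "\<dots> = (\<Sum>i\<le>n. card (?T i) * card (?T (n - i)))"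
    using finite_planar_gluings by (simp add: card_cartesian_product)
  finally show ?thesis .
qed

lemma card_planar_0: "card (planar_gluings 4) = 1"
proof -
  define w :: "nat \<Rightarrow> nat" where "w x = (if x < 4 then 3 - x else x)" for x
  have four: "x < 4 \<longleftrightarrow> x = 0 \<or> x = 1 \<or> x = 2 \<or> x = 3" for x :: nat by auto
  have w: "w 0 = 3" "w 1 = 2" "w 2 = 1" "w 3 = 0" "sd 0 = 1" "sd 1 = 0" "sd 2 = 3" "sd 3 = 2"
    by (simp_all add: w_def sd_def)
  have "w x < 4 \<and> w x \<noteq> x \<and> w (w x) = x \<and> w (sd x) = sd (w x) \<and> w x \<noteq> sd x" if "x < 4" for x
    using that unfolding four by (elim disjE) (simp_all only: w, simp_all)
  moreover have "w x = x" if "4 \<le> x" for x using that by (simp add: w_def)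
  ultimately have "w \<in> gluings 4" by (simp add: gluings_def)
  moreover have "x = 2" if "even x" "0 < x" "x < 4" for x :: nat using that by presburger
  moreover have "w 2 = 2 - 1" "w 0 = 4 - 1" using w by simp_all
  ultimately have "w \<in> planar_gluings 4" unfolding planar_gluings_def by blast
  moreover have "a = w" if a: "a \<in> planar_gluings 4" for a
  proof
    fix x
    have ag: "a \<in> gluings 4" and a0: "a 0 = 3" using a by (auto simp: planar_gluings_def)
    have a1: "a 1 = 2" using gluingsD(4)[OF ag, of 0] a0 by (simp add: sd_def)
    have "a 3 = 0" "a 2 = 1" using gluingsD(3)[OF ag, of 0] gluingsD(3)[OF ag, of 1] a0 a1 by simp_all
    then have "x < 4 \<Longrightarrow> a x = w x" using a0 a1 w unfolding four by (elim disjE) simp_all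
    moreover have "4 \<le> x \<Longrightarrow> a x = w x" using ag by (simp add: w_def gluings_def)
    ultimately show "a x = w x" by linarith
  qed
  ultimately have "planar_gluings 4 = {w}" by blast
  then show ?thesis by simp
qed

text \<open>If \<open>C = 1 + X C\<^sup>2\<close>, then \<open>A = 1 - 2 X C\<close> satisfies \<open>A\<^sup>2 = 1 - 4 X\<close>, hence
  \<open>(1 - 4 X) A' = - 2 A\<close>, which is a two-term recurrence for the coefficients.\<close>

lemma catalan_recurrence:
  fixes f :: "nat \<Rightarrow> rat"
  assumes f0: "f 0 = 1" and fS: "\<And>n. f (Suc n) = (\<Sum>i\<le>n. f i * f (n - i))"
  shows "of_nat (n + 2) * f (Suc n) = of_nat (4 * n + 2) * f n"
proof -
  define C where "C = Abs_fps f"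
  have Cn: "fps_nth C k = f k" for k by (simp add: C_def)
  have C2: "fps_nth (C ^ 2) k = (\<Sum>i\<le>k. f i * f (k - i))" for k
    by (simp add: power2_eq_square fps_mult_nth Cn atMost_atLeast0)
  have C: "C = 1 + fps_X * C ^ 2"
  proof (rule fps_ext)
    fix n
    show "fps_nth C n = fps_nth (1 + fps_X * C ^ 2) n"
      by (cases n) (simp_all add: Cn f0 fS C2)
  qed
  define A where "A = 1 - 2 * fps_X * C"
  have "A ^ 2 = 1 - 4 * fps_X * (C - fps_X * C ^ 2)"
    by (simp add: A_def power2_eq_square algebra_simps)
  also have "C - fps_X * C ^ 2 = 1" using C by (simp add: algebra_simps)
  finally have A2: "A ^ 2 = 1 - 4 * fps_X" by simp
  have "fps_deriv (A ^ 2) = - 4" unfolding A2 by simp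
  then have "2 * A * fps_deriv A = - 4" by (simp add: power2_eq_square algebra_simps)
  then have "2 * (A * fps_deriv A) = 2 * (- 2)" by (simp add: algebra_simps)
  then have "A * fps_deriv A = - 2" by (subst (asm) mult_cancel_left) simp
  then have "A ^ 2 * fps_deriv A = - 2 * A" by (simp add: power2_eq_square algebra_simps)
  then have D: "(1 - 4 * fps_X) * fps_deriv A = - 2 * A" unfolding A2 .
  have An: "fps_nth A (Suc k) = - 2 * f k" for k
    by (simp add: A_def C_def mult.assoc numeral_fps_const)
  have "fps_nth ((1 - 4 * fps_X) * fps_deriv A) (Suc n) = fps_nth (- 2 * A) (Suc n)" using D by simp
  moreover have "fps_nth ((1 - 4 * fps_X) * fps_deriv A) (Suc n) = fps_nth (fps_deriv A) (Suc n) - 4 * fps_nth (fps_deriv A) n"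
    by (simp add: left_diff_distrib mult.assoc numeral_fps_const)
  moreover have "fps_nth (- 2 * A) (Suc n) = - 2 * fps_nth A (Suc n)"
    by (simp add: numeral_fps_const)
  ultimately have "of_nat (n + 2) * fps_nth A (Suc (Suc n)) - 4 * (of_nat (n + 1) * fps_nth A (Suc n)) = - 2 * fps_nth A (Suc n)"
    by simp
  then show ?thesis unfolding An by (simp add: algebra_simps)
qed

lemma Cat_eq_fact: "Cat m = fact (2 * m) / (fact m * fact (Suc m))"
  by (simp add: Cat_def binomial_fact field_simps mult_2)

lemma card_planar_gluings: "of_nat (card (planar_gluings (8 * m + 4))) = Cat m"
proof -
  define f :: "nat \<Rightarrow> rat" where "f m = of_nat (card (planar_gluings (8 * m + 4)))" for m
  have f0: "f 0 = 1" using card_planar_0 by (simp add: f_def)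
  have fS: "f (Suc n) = (\<Sum>i\<le>n. f i * f (n - i))" for n
    unfolding f_def card_planar_Suc by simp
  have "f m = fact (2 * m) / (fact m * fact (Suc m))"
  proof (induction m)
    case (Suc m)
    have "of_nat (m + 2) * f (Suc m) = of_nat (4 * m + 2) * f m"
      using catalan_recurrence[OF f0 fS] .
    then have "f (Suc m) = of_nat (4 * m + 2) * f m / of_nat (m + 2)" by (simp add: field_simps)
    also have "\<dots> = fact (2 * Suc m) / (fact (Suc m) * fact (Suc (Suc m)))"
    proof -
      define F :: rat where "F = fact (2 * m)"
      define G :: rat where "G = fact m"
      define x :: rat where "x = of_nat m"
      have nz: "G \<noteq> 0" "x + 1 \<noteq> 0" "x + 2 \<noteq> 0" "(2 + x) \<noteq> 0" "1 + x \<noteq> 0"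
        using of_nat_0_le_iff[of m, where 'a = rat] unfolding G_def x_def by (simp, linarith+)
      have "fact (2 * Suc m) = (2 * x + 2) * ((2 * x + 1) * F)" "fact (Suc m) = (x + 1) * G"
        "fact (Suc (Suc m)) = (x + 2) * ((x + 1) * G)"
        by (simp_all add: F_def G_def x_def algebra_simps)
      moreover have "of_nat (4 * m + 2) = 4 * x + 2" "of_nat (m + 2) = x + 2" by (simp_all add: x_def)
      ultimately show ?thesis
        unfolding Suc.IH F_def[symmetric] G_def[symmetric] using nz
        by (simp only:) (simp add: divide_simps, simp add: algebra_simps)
    qed
    finally show ?case .
  qed (simp add: f0)
  then have "f m = Cat m" by (simp only: Cat_eq_fact)
  then show ?thesis by (simp add: f_def)
qed

section \<open>From gluings back to maps of a given type\<close>

lemma count_cubic_maps: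
  assumes E: "0 < E"
  shows "count_maps (\<lambda>M. unicellular M \<and> precubic M \<and> orientable M = b \<and> has_type M h \<and> card (edges M) = E) =
    card {a \<in> cubic_gluings (4 * E). parity_changing (4 * E) a = b \<and>
      2 * of_nat (card (leaves (4 * E) a)) = of_nat E + 3 - 6 * h}"
    (is "count_maps ?P = _")
proof -
  let ?N = "4 * E"
  have N: "even ?N" "0 < ?N" using E by auto
  have "count_maps ?P = card {a \<in> gluings ?N. ?P (polygon_map ?N a)}"
  proof (rule count_maps_eq_card_gluings[OF N])
    show "card (flags M) = ?N" if "is_rooted_map M" "?P M" for M :: "nat rooted_map"
      using card_flags_eq_edges[OF that(1)] that(2) by simp
    show "?P K \<longleftrightarrow> ?P M" if "iso_by \<phi> M K" "is_rooted_map M" for \<phi> and M K :: "nat rooted_map"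
      using that by (simp add: iso_unicellular iso_precubic iso_orientable iso_has_type iso_card_cells)
  qed simp
  also have "{a \<in> gluings ?N. ?P (polygon_map ?N a)} =
    {a \<in> cubic_gluings ?N. parity_changing ?N a = b \<and> 2 * of_nat (card (leaves ?N a)) = of_nat E + 3 - 6 * h}"
  proof -
    have "?P (polygon_map ?N a) \<longleftrightarrow> a \<in> cubic_gluings ?N \<and> parity_changing ?N a = b \<and>
        2 * of_nat (card (leaves ?N a)) = of_nat E + 3 - 6 * h" if a: "a \<in> gluings ?N" for a
      using polygon_has_type[OF N a _ refl] card_flags_eq_edges[OF polygon_map_rooted[OF N a]]
        polygon_map_unicellular[OF N a]
      by (auto simp: polygon_precubic[OF N a] polygon_orientable[OF N a])
    then show ?thesis by (auto simp: cubic_gluings_def)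
  qed
  finally show ?thesis .
qed

text \<open>The integer \<open>L\<close> is the number of leaves that the type prescribes; if it is
  negative, no map exists.\<close>

lemma count_cubics:
  assumes E: "0 < E" and L: "2 * of_int L = of_nat E + 3 - 6 * h"
  shows "count_maps (\<lambda>M. unicellular M \<and> precubic M \<and> orientable M = b \<and> has_type M h \<and> card (edges M) = E) =
    (if 0 \<le> L then card (cubics b (4 * E) (nat L)) else 0)"
proof -
  have "2 * of_nat l = of_nat E + 3 - 6 * h \<longleftrightarrow> 0 \<le> L \<and> l = nat L" for l :: nat
  proof -
    have "2 * of_nat l = of_nat E + 3 - 6 * h \<longleftrightarrow> (of_int (int l) :: rat) = of_int L"
      unfolding L[symmetric] by simp
    then show ?thesis by (auto simp only: of_int_eq_iff)
  qed
  then show ?thesis unfolding count_cubic_maps[OF E] by (auto simp: cubics_def conj_commute)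
qed

lemma num_edges_pos: "m \<ge> 1 \<Longrightarrow> 0 < num_edges h m"
  by (simp add: num_edges_def)

lemma eta_eq_cubics:
  assumes "m \<ge> 1" "2 * of_int L = of_nat (num_edges h m) + 3 - 6 * h"
  shows "eta h m = (if 0 \<le> L then card (cubics False (4 * num_edges h m) (nat L)) else 0)"
  using count_cubics[OF num_edges_pos[OF assms(1)] assms(2), of False] by (simp add: eta_def)

lemma xi_eq_cubics:
  assumes "m \<ge> 1" "2 * of_int L = of_nat (num_edges h m) + 3 - 6 * h"
  shows "xi h m = (if 0 \<le> L then card (cubics True (4 * num_edges h m) (nat L)) else 0)"
  using count_cubics[OF num_edges_pos[OF assms(1)] assms(2), of True] by (simp add: xi_def)

text \<open>The number of leaves is \<open>ell h m - 2\<close> in type \<open>h\<close> and three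
  more in type \<open>h - 1\<close>, with equally many edges. Thus \<open>ell h m\<close> counts the
  leaves besides the root from which three are glued.\<close>

lemma eta_recurrence:
  fixes h :: rat
  assumes m: "m \<ge> 1" and h: "2 * h \<in> \<nat>" "h \<ge> 1"
  shows "(2 * h - 1) * of_nat (eta h m) =
    4 * of_nat (choose3 (ell h m)) * of_nat (eta (h - 1) m) + 3 * of_nat (choose3 (ell h m)) * of_nat (xi (h - 1) m)"
proof -
  define E where "E = num_edges h m"
  define L where "L = ell h m - 2"
  have "h - 1 \<in> \<nat> \<longleftrightarrow> h \<in> \<nat>"
  proof
    assume "h \<in> \<nat>"
    then obtain k :: nat where k: "h = of_nat k" by (auto elim: Nats_cases)
    then have "h - 1 = of_nat (k - 1)" using h(2) by (simp add: of_nat_diff)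
    then show "h - 1 \<in> \<nat>" by simp
  next
    assume "h - 1 \<in> \<nat>"
    then have "h - 1 + 1 \<in> \<nat>" by (rule Nats_add) simp
    then show "h \<in> \<nat>" by simp
  qed
  then have E': "num_edges (h - 1) m = E" by (simp add: E_def num_edges_def)
  have LE: "2 * of_int L = of_nat E + 3 - 6 * h"
    using of_int_ell[OF h(1), of m] by (simp add: L_def E_def num_edges_def split: if_splits)
  have LE': "2 * of_int (L + 3) = of_nat (num_edges (h - 1) m) + 3 - 6 * (h - 1)"
    unfolding E' using LE by simp
  note e = eta_eq_cubics[OF m LE[unfolded E_def], folded E_def]
    eta_eq_cubics[OF m LE', unfolded E'] xi_eq_cubics[OF m LE', unfolded E']
  show ?thesis
  proof (cases "0 \<le> L")
    case False
    \<comment> \<open>Here \<open>ell h m\<close> is below 2: the coefficient is zero and there are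
      no maps on the left either.\<close>
    then show ?thesis using e(1) by (simp add: choose3_def L_def)
  next
    case True
    define l where "l = nat L"
    have l: "L = int l" "nat (L + 3) = l + 3" using True by (auto simp: l_def)
    have ch: "choose3 (ell h m) = (l + 2) choose 3"
    proof -
      have "ell h m = int (l + 2)" using l by (simp add: L_def)
      then show ?thesis by (simp add: choose3_def binomial_eq_0 nat_add_distrib)
    qed
    have N: "even (4 * E)" "0 < 4 * E" using num_edges_pos[OF m] by (simp_all add: E_def)
    define x y z where xyz: "x = card (cubics False (4 * E) l)" "y = card (cubics False (4 * E) (l + 3))"
      "z = card (cubics True (4 * E) (l + 3))"
    have "12 * int (((l + 2) choose 3) * (4 * y + 3 * z)) = (int (4 * E) - 8 * int l) * int x"
      using nonorientable_recurrence[OF N, of l] unfolding xyz .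
    then have "(of_int (12 * int (((l + 2) choose 3) * (4 * y + 3 * z))) :: rat) =
        of_int ((int (4 * E) - 8 * int l) * int x)" by (simp only:)
    then have "12 * (of_nat ((l + 2) choose 3) * (4 * of_nat y + 3 * of_nat z)) =
        (4 * of_nat E - 8 * of_nat l) * (of_nat x :: rat)" by simp
    moreover have "4 * of_nat E - 8 * of_nat l = 12 * (2 * h - 1)" using LE by (simp add: l)
    ultimately have "12 * (of_nat ((l + 2) choose 3) * (4 * of_nat y + 3 * of_nat z)) = 12 * ((2 * h - 1) * of_nat x)"
      by (simp only: mult.assoc)
    then have "of_nat ((l + 2) choose 3) * (4 * of_nat y + 3 * of_nat z) = (2 * h - 1) * of_nat x"
      by (subst (asm) mult_cancel_left) simp
    moreover have "eta h m = x" "eta (h - 1) m = y" "xi (h - 1) m = z"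
      using e True unfolding xyz by (simp_all add: l nat_add_distrib)
    ultimately show ?thesis unfolding ch by (simp add: algebra_simps)
  qed
qed

text \<open>Half-integral type goes with \<open>2 m\<close> edges, hence \<open>8 m\<close> flags,
  and then no number of leaves admits an orientable gluing.\<close>

lemma xi_half_integer:
  assumes "m \<ge> 1" "h \<notin> \<nat>"
  shows "xi h m = 0"
proof -
  define E where "E = num_edges h m"
  have E: "0 < E" "4 * E = 8 * m" using assms by (auto simp: E_def num_edges_def)
  have "a \<notin> cubic_gluings (4 * E) \<or> \<not> parity_changing (4 * E) a" for a
  proof -
    have "cubics True (4 * E) (card (leaves (4 * E) a)) = {}"
      using card_cubics_odd[OF E(2)] assms by simp
    then show ?thesis by (auto simp: cubics_def)
  qed
  then have "{a \<in> cubic_gluings (4 * E). parity_changing (4 * E) a = True \<and>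
      2 * of_nat (card (leaves (4 * E) a)) = of_nat E + 3 - 6 * h} = {}" by auto
  then show ?thesis
    using count_cubic_maps[OF E(1), of True h] unfolding xi_def E_def[symmetric]
    by (metis (no_types, lifting) card.empty)
qed

text \<open>For type \<open>h + 1\<close> the recurrence factor is \<open>24 (h + 1)\<close>, so
  each step multiplies by \<open>k choose 3\<close> and divides by \<open>2 (h + 1)\<close>. With
  the 6 from the binomial coefficient this yields \<open>12 ^ h * fact h\<close>.\<close>

lemma card_cubics_True:
  "3 * h \<le> m + 1 \<Longrightarrow> of_nat (card (cubics True (8 * m + 4) (m + 2 - 3 * h))) =
    (fact (2 * m) / (12 ^ h * fact h * fact m * fact (m + 1 - 3 * h)) :: rat)"
proof (induction h)
  case 0
  have "of_nat (card (cubics True (8 * m + 4) (m + 2))) = Cat m"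
    using planar_gluings_eq card_planar_gluings by simp
  then show ?case by (simp add: Cat_eq_fact)
next
  case (Suc h)
  define N l k where d: "N = 8 * m + 4" "l = m + 2 - 3 * Suc h" "k = m + 1 - 3 * h"
  have k: "k \<ge> 3" "l + 2 = k" "m + 2 - 3 * h = l + 3" "m + 1 - 3 * Suc h = k - 3"
    using Suc.prems by (auto simp: d)
  have N: "even N" "0 < N" by (auto simp: d)
  have "int N - 8 * int l + 12 = 24 * int (Suc h)" using Suc.prems by (simp add: d)
  then have "12 * int ((k choose 3) * card (cubics True N (l + 3))) = 24 * int (Suc h) * int (card (cubics True N l))"
    using orientable_recurrence[OF N, of l] k(2) by simp
  then have "(of_int (12 * int ((k choose 3) * card (cubics True N (l + 3)))) :: rat) =
    of_int (24 * int (Suc h) * int (card (cubics True N l)))" by (simp only:)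
  then have "12 * (of_nat (k choose 3) * of_nat (card (cubics True N (l + 3)))) =
      12 * (2 * of_nat (Suc h) * (of_nat (card (cubics True N l)) :: rat))" by simp
  then have "of_nat (k choose 3) * of_nat (card (cubics True N (l + 3))) =
      2 * of_nat (Suc h) * (of_nat (card (cubics True N l)) :: rat)"
    by (subst (asm) mult_cancel_left) simp
  moreover have "of_nat (card (cubics True N (l + 3))) = (fact (2 * m) / (12 ^ h * fact h * fact m * fact k) :: rat)"
    using Suc.IH Suc.prems unfolding k(3)[symmetric] by (simp add: d)
  moreover have "of_nat (k choose 3) = (fact k / (6 * fact (k - 3)) :: rat)"
    using binomial_fact[OF k(1), where 'a = rat] by (simp add: fact_numeral)
  ultimately have "2 * of_nat (Suc h) * (of_nat (card (cubics True N l)) :: rat) =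
      fact k / (6 * fact (k - 3)) * (fact (2 * m) / (12 ^ h * fact h * fact m * fact k))" by simp
  also have "\<dots> = 2 * of_nat (Suc h) * (fact (2 * m) / (12 ^ Suc h * fact (Suc h) * fact m * fact (k - 3)))"
    by (simp add: field_simps del: of_nat_Suc)
  finally have "of_nat (card (cubics True N l)) =
      (fact (2 * m) / (12 ^ Suc h * fact (Suc h) * fact m * fact (k - 3)) :: rat)"
    by (subst (asm) mult_cancel_left) (auto simp del: of_nat_Suc fact_Suc power_Suc)
  then show ?case unfolding k(4) d .
qed

lemma xi_closed_form:
  fixes h m :: nat
  assumes m: "m \<ge> 1"
  shows "of_nat (xi (of_nat h) m) =
    (if 3 * h \<le> m + 1
     then fact (2 * m) / (12 ^ h * fact h * fact m * fact (m + 1 - 3 * h)) else (0 :: rat))"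
proof -
  define L where "L = int m + 2 - 3 * int h"
  have E: "num_edges (of_nat h) m = 2 * m + 1" by (simp add: num_edges_def)
  have "2 * of_int L = of_nat (num_edges (of_nat h) m) + 3 - 6 * (of_nat h :: rat)"
    unfolding E by (simp add: L_def)
  note x = xi_eq_cubics[OF m this, unfolded E]
  show ?thesis
  proof (cases "3 * h \<le> m + 1")
    case True
    then have "nat L = m + 2 - 3 * h" "0 \<le> L" by (auto simp: L_def)
    then show ?thesis using card_cubics_True[OF True] True x by (simp add: algebra_simps)
  next
    case False
    \<comment> \<open>For \<open>3 h = m + 2\<close> the type would ask for 0 leaves, which the root
      leaf excludes; for larger \<open>h\<close> the number is negative.\<close>
    then have "L < 0 \<or> nat L = 0" by (auto simp: L_def)
    then have "xi (of_nat h) m = 0" using x cubics_0[of "4 * (2 * m + 1)" True] by auto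
    then show ?thesis using False by simp
  qed
qed

lemma double_fact_even: "double_fact (2 * h) = 2 ^ h * fact h"
  by (induction h) (simp_all add: algebra_simps)

lemma multinomial_closed_form:
  "1 / of_nat (double_fact (2 * h)) * multinomial (m + 1) (replicate h 3 @ [int (m + 1) - 3 * int h]) * Cat m =
    (if 3 * h \<le> m + 1
     then fact (2 * m) / (12 ^ h * fact h * fact m * fact (m + 1 - 3 * h)) else 0)"
proof (cases "3 * h \<le> m + 1")
  case True
  have "nat (int (m + 1) - 3 * int h) = m + 1 - 3 * h" using True by simp
  then have "multinomial (m + 1) (replicate h 3 @ [int (m + 1) - 3 * int h]) =
      fact (m + 1) / (6 ^ h * fact (m + 1 - 3 * h))"
    using True by (simp add: multinomial_def sum_list_replicate prod_list_replicate fact_numeral)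
  moreover have "Cat m = fact (2 * m) / (fact m * fact (m + 1))" by (simp add: Cat_eq_fact)
  ultimately have "1 / of_nat (double_fact (2 * h)) * multinomial (m + 1) (replicate h 3 @ [int (m + 1) - 3 * int h]) * Cat m =
      1 / (2 ^ h * fact h) * (fact (m + 1) / (6 ^ h * fact (m + 1 - 3 * h))) * (fact (2 * m) / (fact m * fact (m + 1)))"
    by (simp only: double_fact_even of_nat_mult of_nat_power of_nat_numeral of_nat_fact)
  also have "\<dots> = fact (2 * m) / ((2 ^ h * 6 ^ h) * fact h * fact m * fact (m + 1 - 3 * h))"
  proof -
    have "1 / (x * y) * (g / (z * w)) * (u / (v * g)) = u / ((x * z) * y * v * w)" if "g \<noteq> 0"
      for x y z w u v g :: rat
      using that by simp
    then show ?thesis by simp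
  qed
  also have "2 ^ h * 6 ^ h = (12 :: rat) ^ h" by (simp add: power_mult_distrib[symmetric])
  finally show ?thesis using True by simp
next
  case False
  then have "\<not> (0 \<le> int (m + 1) - 3 * int h)" by simp
  then have "multinomial (m + 1) (replicate h 3 @ [int (m + 1) - 3 * int h]) = 0"
    by (simp add: multinomial_def)
  then show ?thesis using False by simp
qed

theorem theorem3p3:
  fixes m :: nat
  assumes "m \<ge> 1"
  shows "(\<forall>h :: rat. 2 * h \<in> \<nat> \<and> h \<ge> 1 \<longrightarrow>
            (2 * h - 1) * of_nat (eta h m) =
              4 * of_nat (choose3 (ell h m)) * of_nat (eta (h - 1) m)
            + 3 * of_nat (choose3 (ell h m)) * of_nat (xi (h - 1) m))
       \<and> (\<forall>h :: rat. 2 * h \<in> \<nat> \<and> h \<notin> \<nat> \<longrightarrow> xi h m = 0)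
       \<and> (\<forall>h :: nat.
            of_nat (xi (of_nat h) m) =
              1 / of_nat (double_fact (2 * h))
              * multinomial (m + 1) (replicate h 3 @ [int (m + 1) - 3 * int h]) * Cat m
          \<and> of_nat (xi (of_nat h) m) =
              (if 3 * h \<le> m + 1
               then fact (2 * m) / (12 ^ h * fact h * fact m * fact (m + 1 - 3 * h))
               else (0 :: rat)))"
  using eta_recurrence[OF assms] xi_half_integer[OF assms] xi_closed_form[OF assms]
    multinomial_closed_form
  by simp

end
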